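(* Let $q\in\mathbf{b}(H^\infty)$ be a rational outer function and let $r$ be a positive real number. Then: (1) $\mathscr{H}(q^r)=\mathscr{H}(q)$ as sets. (2) If $a$ is the Pythagorean mate for $q$ and $a$ has distinct zeros $\zeta_1,\ldots,\zeta_n$ on $\mathbb{T}$ (these being all its zeros on $\mathbb{T}$) with corresponding multiplicities $m_1,\ldots,m_n$, then: (a) the functions $v_{r,j}^\ell:=v_{r,\zeta_j}^\ell$ are well-defined and belong to $\mathscr{H}(q^r)$ for $1\le j\le n$ and $0\le\ell\le m_j-1$; moreover, they are orthogonal (in the inner product of $\mathscr{H}(q^r)$) to $$aH^2=\Big(\prod_{j=1}^n(z-\zeta_j)^{m_j}\Big)H^2;$$ (b) $\mathscr{H}(q^r)$ is equal to $$\Big(\prod_{j=1}^n(z-\zeta_j)^{m_j}\Big)H^2\;\oplus\;\bigvee\big\{v_{r,j}^\ell:0\le\ell\le m_j-1,\ 1\le j\le n\big\},$$ where the orthogonal decomposition is in terms of the inner product of $\mathscr{H}(q^r)$.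
   Context: $\mathbb{D}$ is the open unit disk, $\mathbb{D}^-$ its closure, $\mathbb{T}$ the unit circle with normalized Lebesgue measure $m$. $H^2$ is the classical Hardy space of $\mathbb{D}$. $H^\infty$ is the space of bounded analytic functions on $\mathbb{D}$ with the supremum norm, and $\mathbf{b}(H^\infty)=\{g\in H^\infty:\|g\|_\infty\le 1\}$. For $b\in\mathbf{b}(H^\infty)$, the de Branges-Rovnyak space $\mathscr{H}(b)$ is the reproducing kernel Hilbert space of analytic functions on $\mathbb{D}$ with kernel $k^b_\lambda(z)=\frac{1-\overline{b(\lambda)}b(z)}{1-\overline{\lambda}z}$, $\lambda,z\in\mathbb{D}$. An outer $q$ has no zeros in $\mathbb{D}$, so $q^r\in\mathbf{b}(H^\infty)$ is defined using any analytic logarithm of $q$. If $b\in\mathbf{b}(H^\infty)$ is non-extreme (i.e. $\log(1-|b|)\in L^1(\mathbb{T},m)$), its Pythagorean mate is the unique outer function $a\in\mathbf{b}(H^\infty)$ with $a(0)>0$ and $|a|^2+|b|^2=1$ almost everywhere on $\mathbb{T}$; when $q$ is rational, its Pythagorean mate is also rational, with no poles in $\mathbb{D}^-$, and for $\zeta\in\mathbb{T}$ one has $a(\zeta)=0$ if and only if $|q(\zeta)|=1$. For $\ell\ge 0$, $z\in\mathbb{D}$ and $\lambda\in\mathbb{D}^-$, set $$v_{r,\lambda}^\ell(z):=\frac{d^\ell}{d\overline{\lambda}^\ell}\left(\frac{1-\overline{q^r(\lambda)}\,q^r(z)}{1-\overline{\lambda}z}\right)$$ (for $\lambda=\zeta_j$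 with $|q(\zeta_j)|=1$, $q^r$ extends analytically to a neighborhood of $\zeta_j$). The symbol $\bigvee$ denotes linear span. *)

theory Defs
  imports "HOL-Complex_Analysis.Complex_Analysis" "HOL-Library.Function_Algebras"
begin

text \<open>
  Elements of a function space on a set X are represented by total functions vanishing off X,
  so that two of them are equal exactly if they agree on X. Addition of functions is the
  pointwise one of Function_Algebras.
\<close>

abbreviation unit_disk :: "complex set" where
  "unit_disk \<equiv> ball 0 1"

abbreviation unit_circle :: "complex set" where
  "unit_circle \<equiv> sphere 0 1"

definition circle_measure :: "complex measure" where
  "circle_measure = distr (uniform_measure lborel {0..2 * pi}) borel cis"

definition fun_scale :: "complex \<Rightarrow> ('a \<Rightarrow> complex) \<Rightarrow> ('a \<Rightarrow> complex)" where
  "fun_scale c f = (\<lambda>x. c * f x)"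

definition extend_by_zero :: "'a set \<Rightarrow> ('a \<Rightarrow> complex) \<Rightarrow> ('a \<Rightarrow> complex)" where
  "extend_by_zero X f = (\<lambda>x. if x \<in> X then f x else 0)"


subsection \<open>Reproducing kernel Hilbert spaces\<close>

text \<open>
  H with the inner product ip (linear in the first argument) is the reproducing kernel Hilbert
  space on X whose kernel function at x is K x. For positive semidefinite K such a space exists,
  and H as well as ip on H are uniquely determined by X and K (Moore-Aronszajn).
\<close>

locale rkhs =
  fixes X :: "'a set"
    and K :: "'a \<Rightarrow> 'a \<Rightarrow> complex"
    and H :: "('a \<Rightarrow> complex) set"
    and ip :: "('a \<Rightarrow> complex) \<Rightarrow> ('a \<Rightarrow> complex) \<Rightarrow> complex"
  assumes vanishes_off: "\<And>f x. f \<in> H \<Longrightarrow> x \<notin> X \<Longrightarrow> f x = 0"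
    and subspace_H: "module.subspace fun_scale H"
    and ip_add_left: "\<And>f g h. f \<in> H \<Longrightarrow> g \<in> H \<Longrightarrow> h \<in> H \<Longrightarrow> ip (f + g) h = ip f h + ip g h"
    and ip_scale_left: "\<And>c f g. f \<in> H \<Longrightarrow> g \<in> H \<Longrightarrow> ip (fun_scale c f) g = c * ip f g"
    and ip_commute: "\<And>f g. f \<in> H \<Longrightarrow> g \<in> H \<Longrightarrow> ip g f = cnj (ip f g)"
    and ip_nonneg: "\<And>f. f \<in> H \<Longrightarrow> 0 \<le> Re (ip f f)"
    and ip_definite: "\<And>f. f \<in> H \<Longrightarrow> ip f f = 0 \<Longrightarrow> f = 0"
    and complete_H: "\<And>F :: nat \<Rightarrow> 'a \<Rightarrow> complex. (\<And>n. F n \<in> H) \<Longrightarrow>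
          (\<And>e. e > 0 \<Longrightarrow> \<exists>N. \<forall>m\<ge>N. \<forall>n\<ge>N. sqrt (Re (ip (F m - F n) (F m - F n))) < e) \<Longrightarrow>
          \<exists>f\<in>H. (\<lambda>n. sqrt (Re (ip (F n - f) (F n - f)))) \<longlonglongrightarrow> 0"
    and kernel_in: "\<And>x. x \<in> X \<Longrightarrow> extend_by_zero X (K x) \<in> H"
    and reproducing: "\<And>f x. f \<in> H \<Longrightarrow> x \<in> X \<Longrightarrow> ip f (extend_by_zero X (K x)) = f x"

definition orthogonal_sum ::
  "('a \<Rightarrow> complex) set \<Rightarrow> (('a \<Rightarrow> complex) \<Rightarrow> ('a \<Rightarrow> complex) \<Rightarrow> complex) \<Rightarrow>
   ('a \<Rightarrow> complex) set \<Rightarrow> ('a \<Rightarrow> complex) set \<Rightarrow> bool" where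
  "orthogonal_sum H ip M N \<longleftrightarrow>
     M \<subseteq> H \<and> N \<subseteq> H \<and> (\<forall>f\<in>M. \<forall>g\<in>N. ip f g = 0) \<and> H = {f + g | f g. f \<in> M \<and> g \<in> N}"


subsection \<open>Function theory on the disk\<close>

definition hardy2 :: "(complex \<Rightarrow> complex) set" where
  "hardy2 = {f. f holomorphic_on unit_disk \<and> (\<forall>z. z \<notin> unit_disk \<longrightarrow> f z = 0) \<and>
     (\<exists>C. \<forall>\<rho>\<in>{0<..<1}. (LINT \<zeta>|circle_measure. (cmod (f (of_real \<rho> * \<zeta>)))\<^sup>2) \<le> C)}"

definition mult_hardy2 :: "(complex \<Rightarrow> complex) \<Rightarrow> (complex \<Rightarrow> complex) set" where
  "mult_hardy2 g = (\<lambda>h z. g z * h z) ` hardy2"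

text \<open>The closed unit ball of the bounded analytic functions; values off the disk are ignored.\<close>

definition ball_Hinf :: "(complex \<Rightarrow> complex) set" where
  "ball_Hinf = {g. g holomorphic_on unit_disk \<and> (\<forall>z\<in>unit_disk. cmod (g z) \<le> 1)}"

definition outer :: "(complex \<Rightarrow> complex) \<Rightarrow> bool" where
  "outer f \<longleftrightarrow> (\<exists>c u. cmod c = 1 \<and> integrable circle_measure (u :: complex \<Rightarrow> real) \<and>
     (\<forall>z\<in>unit_disk. f z =
        c * exp (LINT \<zeta>|circle_measure. (\<zeta> + z) / (\<zeta> - z) * of_real (u \<zeta>))))"

text \<open>
  A rational function in lowest terms, as a function on the whole plane with value 0 at its
  poles. If it belongs to ball_Hinf, it is bounded near each point of the closed disk and
  thus has no poles there. A function given on the disk only (such as a Pythagorean mate) that is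
  rational is identified with this function, which gives meaning to its zeros on the circle and
  their multiplicities.
\<close>

definition rational_fun :: "(complex \<Rightarrow> complex) \<Rightarrow> bool" where
  "rational_fun f \<longleftrightarrow> (\<exists>p s :: complex poly. s \<noteq> 0 \<and> coprime p s \<and> f = (\<lambda>z. poly p z / poly s z))"

definition has_radial_limit :: "(complex \<Rightarrow> complex) \<Rightarrow> complex \<Rightarrow> complex \<Rightarrow> bool" where
  "has_radial_limit f \<zeta> l \<longleftrightarrow> ((\<lambda>\<rho>::real. f (of_real \<rho> * \<zeta>)) \<longlongrightarrow> l) (at_left 1)"

text \<open>
  Boundary values of bounded analytic functions are radial limits, which exist almost everywhere
  by Fatou's theorem. A mate of b exists only if b is non-extreme, since the logarithm
  of the modulus of an outer function is integrable on the circle.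
\<close>

definition pythagorean_mate :: "(complex \<Rightarrow> complex) \<Rightarrow> (complex \<Rightarrow> complex) \<Rightarrow> bool" where
  "pythagorean_mate b a \<longleftrightarrow>
     a \<in> ball_Hinf \<and> outer a \<and> Im (a 0) = 0 \<and> Re (a 0) > 0 \<and>
     (AE \<zeta> in circle_measure. \<exists>\<alpha> \<beta>. has_radial_limit a \<zeta> \<alpha> \<and> has_radial_limit b \<zeta> \<beta> \<and>
        (cmod \<alpha>)\<^sup>2 + (cmod \<beta>)\<^sup>2 = 1)"

text \<open>Q is the r-th power of q formed with some analytic logarithm of q on the disk.\<close>

definition analytic_power :: "(complex \<Rightarrow> complex) \<Rightarrow> real \<Rightarrow> (complex \<Rightarrow> complex) \<Rightarrow> bool" where
  "analytic_power q r Q \<longleftrightarrow> (\<exists>L. L holomorphic_on unit_disk \<and>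
     (\<forall>z\<in>unit_disk. exp (L z) = q z \<and> Q z = exp (of_real r * L z)))"


subsection \<open>De Branges-Rovnyak spaces\<close>

definition dBR_kernel :: "(complex \<Rightarrow> complex) \<Rightarrow> complex \<Rightarrow> complex \<Rightarrow> complex" where
  "dBR_kernel b \<xi> z = (1 - cnj (b \<xi>) * b z) / (1 - cnj \<xi> * z)"

definition de_Branges_Rovnyak ::
  "(complex \<Rightarrow> complex) \<Rightarrow> (complex \<Rightarrow> complex) set \<Rightarrow>
   ((complex \<Rightarrow> complex) \<Rightarrow> (complex \<Rightarrow> complex) \<Rightarrow> complex) \<Rightarrow> bool" where
  "de_Branges_Rovnyak b H ip \<longleftrightarrow> rkhs unit_disk (dBR_kernel b) H ip"

text \<open>
  g is an analytic extension of (the restriction to the disk of) b to a neighbourhood of a point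
  of the closed disk.
\<close>

definition analytic_extension_at ::
  "(complex \<Rightarrow> complex) \<Rightarrow> complex \<Rightarrow> (complex \<Rightarrow> complex) \<Rightarrow> bool" where
  "analytic_extension_at b \<xi> g \<longleftrightarrow>
     (\<exists>e>0. g holomorphic_on ball \<xi> e \<and> (\<forall>w \<in> ball \<xi> e \<inter> unit_disk. g w = b w))"

definition analytic_extension :: "(complex \<Rightarrow> complex) \<Rightarrow> complex \<Rightarrow> complex \<Rightarrow> complex" where
  "analytic_extension b \<xi> = (SOME g. analytic_extension_at b \<xi> g)"

text \<open>
  The l-th derivative of the kernel with respect to the conjugate of its parameter: the kernel is
  an analytic function of w, where w is the conjugate of the parameter, and is differentiated in w
  at w = cnj \<xi>. The value does not depend on the chosen local extension of b.
\<close>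

definition kernel_deriv :: "(complex \<Rightarrow> complex) \<Rightarrow> complex \<Rightarrow> nat \<Rightarrow> complex \<Rightarrow> complex" where
  "kernel_deriv b \<xi> l = extend_by_zero unit_disk (\<lambda>z.
     (deriv ^^ l) (\<lambda>w. (1 - cnj (analytic_extension b \<xi> (cnj w)) * b z) / (1 - w * z)) (cnj \<xi>))"

end

theory Submission
  imports Defs "HOL-Computational_Algebra.Fundamental_Theorem_Algebra"
begin

text \<open>
  Write k_w for the Szego kernel and g for a finite linear combination of Szego kernels. The squared
  norm of the corresponding combination of kernels of H(b) is |g|^2 - |T g|^2 in L^2 of the circle,
  where T is the co-analytic Toeplitz operator with symbol cnj b. Since T g is the projection of
  cnj b * g, this is the integral of (1 - |b|^2) |g|^2 plus the squared distance of cnj b * g to the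
  disk algebra; replacing the distance by that to s g, with a polynomial s interpolating cnj b at the
  points of the circle where |b| = 1, shows that the form is comparable to the integral of
  (1 - |b|^2) |g|^2. As 1 - |q|^(2r) is comparable to 1 - |q|^2, the kernels of q and q^r
  dominate each other, so the spaces agree.

  If a is the mate and p its monic polynomial factor vanishing on the circle, the form is comparable
  to |p g|^2. Hence p H^2 is contained in H(q^r), and by Riesz every f in H(q^r) is the
  image of some h in H^2 under the Toeplitz operator with symbol cnj p, that is,
  z^N f = c p h - W with a constant c, N = deg p and a polynomial W of degree below N. Radial limits of the
  derivatives of order below m_j of f at zeta_j therefore exist and are those of -W / z^N; they are
  bounded functionals, represented by the functions v_j^l, and vanish on p H^2. If all of them vanish
  at f, then p divides W, so W = 0 and f lies in p H^2.
\<close>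

subsection \<open>Reproducing kernel Hilbert spaces\<close>

text \<open>No boundary function of an H^2 function is formed: the forms are compared on finite
  combinations of Szego kernels, which are continuous up to the circle, and the Riesz theorem
  carries the comparison over to the spaces; H^2 itself is handled through Taylor coefficients. The
  interpolating polynomial exists because \<open>cnj b\<close>, though not analytic, agrees on the
  circle near a point with |b| = 1 with an analytic function, by the reflection z -> 1 / cnj z.
  Analyticity of q^r is thus needed only where |q| = 1; at zeros of q on the circle, where q^r may
  be merely continuous, nothing is interpolated. For the equality of the spaces no mate is given.
  With q = u / v, a polynomial of modulus ||v|^2 - |u|^2| on the circle takes over the role of p. If
  it is 0, then |q| = 1 on the whole circle and both spaces are {0}. The constant c comes from the
  zeros of p all lying on the circle: there z^N * cnj p = c p. The power z^N is also what turns the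
  Taylor terms lost by the backward shifts into the polynomial W.\<close>

interpretation fspace: vector_space "fun_scale :: complex \<Rightarrow> ('a \<Rightarrow> complex) \<Rightarrow> 'a \<Rightarrow> complex"
  by unfold_locales (auto simp: fun_scale_def fun_eq_iff algebra_simps)

text \<open>Lists stand for formal linear combinations with repetitions allowed, so that sums and
  multiples are concatenation and \<open>map\<close>, as \<open>riesz\<close> wants them.\<close>

definition kernel_comb :: "'a set \<Rightarrow> ('a \<Rightarrow> 'a \<Rightarrow> complex) \<Rightarrow> (complex \<times> 'a) list \<Rightarrow> 'a \<Rightarrow> complex" where
  "kernel_comb X K xs = (\<Sum>(c, x)\<leftarrow>xs. fun_scale c (extend_by_zero X (K x)))"

lemma kernel_comb_Nil [simp]: "kernel_comb X K [] = 0"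
  and kernel_comb_Cons [simp]: "kernel_comb X K ((c, x) # xs) =
    fun_scale c (extend_by_zero X (K x)) + kernel_comb X K xs"
  by (auto simp: kernel_comb_def)

lemma kernel_comb_append: "kernel_comb X K (xs @ ys) = kernel_comb X K xs + kernel_comb X K ys"
  by (simp add: kernel_comb_def)

lemma kernel_comb_scale:
  "kernel_comb X K (map (\<lambda>(c, x). (d * c, x)) xs) = fun_scale d (kernel_comb X K xs)"
  by (induction xs) (auto simp: fspace.scale_right_distrib fun_scale_def fun_eq_iff algebra_simps)

lemma kernel_comb_apply:
  "kernel_comb X K xs z = (if z \<in> X then \<Sum>(c, x)\<leftarrow>xs. c * K x z else 0)"
  by (induction xs) (auto simp: fun_scale_def extend_by_zero_def)

text \<open>For \<open>t\<close> a small negative multiple of \<open>cnj \<delta>\<close> the linear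
  term outweighs the quadratic one. This is the first-order condition at the minimum in
  \<open>riesz\<close>.\<close>

lemma nonneg_quadratic_imp_0:
  fixes \<delta> :: complex and s :: real
  assumes "\<And>t. 0 \<le> 2 * Re (t * \<delta>) + (cmod t)\<^sup>2 * s"
  shows "\<delta> = 0"
proof (rule ccontr)
  assume "\<delta> \<noteq> 0"
  \<comment> \<open>Any \<open>e > 0\<close> with \<open>e * \<bar>s\<bar> < 2\<close> would do; the
    1 in the denominator also covers \<open>s = 0\<close>.\<close>
  define e where "e = 1 / (1 + \<bar>s\<bar>)"
  have e: "e > 0" "e * \<bar>s\<bar> < 1" by (auto simp: e_def field_simps add_pos_nonneg)
  have "0 \<le> 2 * Re (- of_real e * cnj \<delta> * \<delta>) + (cmod (- of_real e * cnj \<delta>))\<^sup>2 * s"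
    by (rule assms)
  also have "\<dots> = e * (cmod \<delta>)\<^sup>2 * (- 2 + e * s)"
    using e unfolding cmod_power2 by (simp add: norm_mult power_mult_distrib cmod_power2, simp add: power2_eq_square algebra_simps)
  finally have "0 \<le> e * (cmod \<delta>)\<^sup>2 * (- 2 + e * s)" .
  moreover have "e * s \<le> e * \<bar>s\<bar>" using e by (intro mult_left_mono) auto
  moreover have "e * (cmod \<delta>)\<^sup>2 > 0" using e \<open>\<delta> \<noteq> 0\<close> by simp
  moreover from calculation(2) e have "- 2 + e * s < 0" by linarith
  ultimately show False using mult_pos_neg by (meson not_le)
qed

context rkhs
begin

abbreviation sqn :: "('a \<Rightarrow> complex) \<Rightarrow> real" where
  "sqn f \<equiv> Re (ip f f)"

lemma zero_in [simp, intro]: "0 \<in> H"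
  using subspace_H fspace.subspace_0 by blast

lemma add_in [intro]: "f \<in> H \<Longrightarrow> g \<in> H \<Longrightarrow> f + g \<in> H"
  using subspace_H fspace.subspace_add by blast

lemma scale_in [intro]: "f \<in> H \<Longrightarrow> fun_scale c f \<in> H"
  using subspace_H fspace.subspace_scale by blast

lemma diff_in [intro]: "f \<in> H \<Longrightarrow> g \<in> H \<Longrightarrow> f - g \<in> H"
  using subspace_H fspace.subspace_diff by blast

lemma kernel_comb_in: "snd ` set xs \<subseteq> X \<Longrightarrow> kernel_comb X K xs \<in> H"
  by (induction xs) (auto intro!: add_in scale_in kernel_in)

lemma ip_add_right: "f \<in> H \<Longrightarrow> g \<in> H \<Longrightarrow> h \<in> H \<Longrightarrow> ip f (g + h) = ip f g + ip f h"
  by (metis ip_add_left ip_commute add_in complex_cnj_add)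

lemma ip_scale_right: "f \<in> H \<Longrightarrow> g \<in> H \<Longrightarrow> ip f (fun_scale c g) = cnj c * ip f g"
  by (metis ip_scale_left ip_commute scale_in complex_cnj_mult)

lemma ip_diff_left: "f \<in> H \<Longrightarrow> g \<in> H \<Longrightarrow> h \<in> H \<Longrightarrow> ip (f - g) h = ip f h - ip g h"
  using ip_add_left[of f "fun_scale (-1) g" h] ip_scale_left[of g h "-1"] scale_in[of g "-1"] by simp

lemma ip_diff_right: "f \<in> H \<Longrightarrow> g \<in> H \<Longrightarrow> h \<in> H \<Longrightarrow> ip f (g - h) = ip f g - ip f h"
  using ip_add_right[of f g "fun_scale (-1) h"] ip_scale_right[of f h "-1"] scale_in[of h "-1"] by simp

lemma ip_self: "f \<in> H \<Longrightarrow> ip f f = of_real (sqn f)"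
  by (metis Reals_cnj_iff complex_is_Real_iff complex_eqI Re_complex_of_real Im_complex_of_real ip_commute)

lemma ip_zero_right [simp]: "f \<in> H \<Longrightarrow> ip f 0 = 0"
  using ip_add_right[of f 0 0] by simp

lemma sqn_add_scale:
  assumes "f \<in> H" "g \<in> H"
  shows "sqn (f + fun_scale t g) = sqn f + 2 * Re (t * ip g f) + (cmod t)\<^sup>2 * sqn g"
proof -
  have "ip f g = cnj (ip g f)" by (intro ip_commute assms)
  thus ?thesis using assms
    by (simp add: ip_add_left ip_add_right ip_scale_left ip_scale_right add_in scale_in cmod_power2)
       (simp add: algebra_simps power2_eq_square)
qed

lemma parallelogram:
  assumes "f \<in> H" "g \<in> H"
  shows "sqn (f - g) = 2 * sqn f + 2 * sqn g - sqn (f + g)"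
  using assms by (simp add: ip_add_left ip_add_right ip_diff_left ip_diff_right add_in diff_in)

lemma cauchy_schwarz:
  assumes "f \<in> H" "g \<in> H"
  shows "(cmod (ip f g))\<^sup>2 \<le> sqn f * sqn g"
proof (cases "sqn g = 0")
  case True
  hence "g = 0" using ip_definite[OF assms(2)] ip_self[OF assms(2)] by simp
  thus ?thesis using assms by simp
next
  case False
  hence pos: "sqn g > 0" using ip_nonneg[OF assms(2)] by simp
  have fg: "ip f g = cnj (ip g f)" by (intro ip_commute assms)
  define t where "t = - ip f g / of_real (sqn g)"
  have "0 \<le> sqn (f + fun_scale t g)" using assms by (intro ip_nonneg) auto
  also have "\<dots> = sqn f + 2 * Re (t * ip g f) + (cmod t)\<^sup>2 * sqn g" by (rule sqn_add_scale[OF assms])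
  also have "t * ip g f = - of_real ((cmod (ip f g))\<^sup>2 / sqn g)"
    using complex_norm_square[of "ip g f"] by (simp add: t_def fg mult.commute)
  also have "(cmod t)\<^sup>2 * sqn g = (cmod (ip f g))\<^sup>2 / sqn g"
    using pos by (simp add: t_def norm_divide power_divide power2_eq_square)
  finally have "0 \<le> sqn f - (cmod (ip f g))\<^sup>2 / sqn g" by simp
  thus ?thesis using pos by (simp add: field_simps)
qed

lemma reproducing_bound:
  assumes "f \<in> H" "x \<in> X"
  shows "(cmod (f x))\<^sup>2 \<le> Re (K x x) * sqn f"
proof -
  let ?k = "extend_by_zero X (K x)"
  have k: "?k \<in> H" using assms kernel_in by blast
  have "f x = ip f ?k" using reproducing assms by simp
  moreover have "ip ?k ?k = K x x" using reproducing[OF k assms(2)] assms by (simp add: extend_by_zero_def)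
  ultimately show ?thesis using cauchy_schwarz[OF assms(1) k] by (simp add: mult.commute)
qed

lemma ip_kernel_comb:
  assumes "f \<in> H" "snd ` set xs \<subseteq> X"
  shows "ip f (kernel_comb X K xs) = (\<Sum>(c, x)\<leftarrow>xs. cnj c * f x)"
  using assms(2)
  by (induction xs)
     (auto simp: assms(1) ip_add_right ip_scale_right kernel_in scale_in kernel_comb_in reproducing)

lemma ip_tendsto_left:
  assumes "\<And>n. F n \<in> H" "f \<in> H" "g \<in> H" "(\<lambda>n. sqrt (sqn (F n - f))) \<longlonglongrightarrow> 0"
  shows "(\<lambda>n. ip (F n) g) \<longlonglongrightarrow> ip f g"
proof -
  have "(\<lambda>n. ip (F n - f) g) \<longlonglongrightarrow> 0"
  proof (rule Lim_null_comparison)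
    show "\<forall>\<^sub>F n in sequentially. norm (ip (F n - f) g) \<le> sqrt (sqn (F n - f)) * sqrt (sqn g)"
    proof (rule always_eventually, rule allI)
      fix n
      have "(cmod (ip (F n - f) g))\<^sup>2 \<le> sqn (F n - f) * sqn g"
        using assms by (intro cauchy_schwarz) auto
      thus "norm (ip (F n - f) g) \<le> sqrt (sqn (F n - f)) * sqrt (sqn g)"
        by (metis real_le_rsqrt real_sqrt_mult)
    qed
    show "(\<lambda>n. sqrt (sqn (F n - f)) * sqrt (sqn g)) \<longlonglongrightarrow> 0"
      using tendsto_mult_right[OF assms(4), of "sqrt (sqn g)"] by simp
  qed
  moreover have "ip (F n - f) g = ip (F n) g - ip f g" for n using assms by (intro ip_diff_left) auto
  ultimately show ?thesis by (simp add: LIM_zero_iff)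
qed

text \<open>
  The domain is an index set rather than a subspace, so that a functional on a span may be given
  on formal linear combinations without checking that it is well defined.
\<close>

lemma riesz:
  fixes D :: "'d set" and pl :: "'d \<Rightarrow> 'd \<Rightarrow> 'd" and sc :: "complex \<Rightarrow> 'd \<Rightarrow> 'd"
    and E :: "'d \<Rightarrow> 'a \<Rightarrow> complex" and \<phi> :: "'d \<Rightarrow> complex"
  assumes "D \<noteq> {}"
    and pl: "\<And>d e. d \<in> D \<Longrightarrow> e \<in> D \<Longrightarrow> pl d e \<in> D"
      "\<And>d e. d \<in> D \<Longrightarrow> e \<in> D \<Longrightarrow> E (pl d e) = E d + E e"
      "\<And>d e. d \<in> D \<Longrightarrow> e \<in> D \<Longrightarrow> \<phi> (pl d e) = \<phi> d + \<phi> e"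
    and sc: "\<And>c d. d \<in> D \<Longrightarrow> sc c d \<in> D"
      "\<And>c d. d \<in> D \<Longrightarrow> E (sc c d) = fun_scale c (E d)"
      "\<And>c d. d \<in> D \<Longrightarrow> \<phi> (sc c d) = c * \<phi> d"
    and EH: "\<And>d. d \<in> D \<Longrightarrow> E d \<in> H"
    and C: "C \<ge> 0" "\<And>d. d \<in> D \<Longrightarrow> (cmod (\<phi> d))\<^sup>2 \<le> C * sqn (E d)"
  shows "\<exists>F\<in>H. sqn F \<le> C \<and> (\<forall>d\<in>D. ip (E d) F = \<phi> d)"
proof -
  \<comment> \<open>If \<open>F\<close> represents the functional, then \<open>J d\<close> is the
    squared distance of \<open>E d\<close> to \<open>F\<close> minus the squared norm of
    \<open>F\<close>. Minimising \<open>J\<close> therefore finds \<open>F\<close> as a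
    limit.\<close>
  define J where "J d = sqn (E d) - 2 * Re (\<phi> d)" for d
  have J_lower: "J d \<ge> - C" if "d \<in> D" for d
  proof -
    have s: "sqn (E d) \<ge> 0" using EH ip_nonneg that by blast
    have "(2 * Re (\<phi> d))\<^sup>2 \<le> 4 * (cmod (\<phi> d))\<^sup>2"
      using power_mono[OF abs_Re_le_cmod, of "\<phi> d" 2] by (simp add: power_mult_distrib)
    also have "\<dots> \<le> 4 * C * sqn (E d)" using C(2)[OF that] by simp
    also have "\<dots> \<le> (C + sqn (E d))\<^sup>2"
      using zero_le_power2[of "C - sqn (E d)"] by (simp add: power2_eq_square algebra_simps)
    finally have "\<bar>2 * Re (\<phi> d)\<bar> \<le> \<bar>C + sqn (E d)\<bar>" by (simp only: abs_le_square_iff)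
    hence "\<bar>2 * Re (\<phi> d)\<bar> \<le> C + sqn (E d)" using s C(1) by linarith
    thus ?thesis by (simp add: J_def)
  qed
  define I where "I = Inf (J ` D)"
  have bdd: "bdd_below (J ` D)" using J_lower by (auto intro!: bdd_belowI[of _ "-C"])
  have I_le: "I \<le> J d" if "d \<in> D" for d
    unfolding I_def using that bdd by (simp add: cINF_lower)
  have "\<exists>d\<in>D. J d < I + 1 / real (Suc n)" for n
  proof -
    have "Inf (J ` D) < I + 1 / real (Suc n)" unfolding I_def by simp
    thus ?thesis using \<open>D \<noteq> {}\<close> bdd by (subst (asm) cInf_less_iff) auto
  qed
  then obtain s where s: "\<And>n. s n \<in> D" "\<And>n. J (s n) < I + 1 / real (Suc n)" by metis
  \<comment> \<open>The parallelogram law, with \<open>J\<close> at the midpoint bounded below by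
    \<open>I\<close>, makes every minimising sequence Cauchy.\<close>
  have cauchy: "sqn (E d - E e) \<le> 2 * (J d - I) + 2 * (J e - I)" if "d \<in> D" "e \<in> D" for d e
  proof -
    have half: "sqn (fun_scale (1/2) (E d + E e)) = sqn (E d + E e) / 4"
      by (simp add: ip_scale_left ip_scale_right EH that add_in scale_in)
    have "I \<le> J (sc (1/2) (pl d e))" by (intro I_le sc(1) pl(1) that)
    also have "\<dots> = sqn (E d + E e) / 4 - Re (\<phi> d + \<phi> e)"
      unfolding J_def sc(2)[OF pl(1)[OF that]] sc(3)[OF pl(1)[OF that]] pl(2)[OF that] pl(3)[OF that] half by (simp add: field_simps)
    finally have "sqn (E d + E e) \<ge> 4 * I + 4 * Re (\<phi> d + \<phi> e)" by simp
    thus ?thesis using parallelogram[OF EH EH, OF that] by (simp add: J_def)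
  qed
  have "\<exists>N. \<forall>m\<ge>N. \<forall>n\<ge>N. sqrt (sqn (E (s m) - E (s n))) < e" if "e > 0" for e :: real
  proof -
    obtain N where N: "4 / e\<^sup>2 < real N" using reals_Archimedean2 by blast
    hence N0: "4 / real (Suc N) < e\<^sup>2" using \<open>e > 0\<close> 
      by (simp add: field_simps) (smt (verit, best) zero_less_power)
    have "sqrt (sqn (E (s m) - E (s n))) < e" if "m \<ge> N" "n \<ge> N" for m n
    proof -
      have b: "1 / real (Suc k) \<le> 1 / real (Suc N)" if "k \<ge> N" for k using that by (simp add: field_simps)
      have "sqn (E (s m) - E (s n)) < 4 / real (Suc N)"
        using cauchy[OF s(1) s(1), of m n] s(2)[of m] s(2)[of n] b[OF that(1)] b[OF that(2)] by simp
      also have "\<dots> < e\<^sup>2" by (rule N0)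
      finally show ?thesis using \<open>e > 0\<close> by (simp add: real_less_lsqrt)
    qed
    thus ?thesis by blast
  qed
  then obtain F where F: "F \<in> H" "(\<lambda>n. sqrt (sqn (E (s n) - F))) \<longlonglongrightarrow> 0"
    using complete_H[of "\<lambda>n. E (s n)"] EH s(1) by blast
  have lim: "(\<lambda>n. ip (E (s n)) g) \<longlonglongrightarrow> ip F g" if "g \<in> H" for g
    using ip_tendsto_left[OF _ F(1) that F(2)] EH s(1) by blast
  have rep: "ip (E d) F = \<phi> d" if d: "d \<in> D" for d
  proof -
    \<comment> \<open>Moving \<open>s n\<close> by \<open>t\<close> times \<open>d\<close> cannot
      bring \<open>J\<close> below \<open>I\<close>; letting \<open>n\<close> tend to infinity gives
      the first-order condition at \<open>F\<close>.\<close>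
    have "0 \<le> 2 * Re (t * (ip (E d) F - \<phi> d)) + (cmod t)\<^sup>2 * sqn (E d)" for t
    proof -
      have ineq: "- (1 / real (Suc n)) \<le> 2 * Re (t * (cnj (ip (E (s n)) (E d)) - \<phi> d)) + (cmod t)\<^sup>2 * sqn (E d)" for n
      proof -
        have "I \<le> J (pl (s n) (sc t d))" by (intro I_le sc(1) pl(1) d s(1))
        also have "\<dots> = J (s n) + 2 * Re (t * ip (E d) (E (s n))) + (cmod t)\<^sup>2 * sqn (E d) - 2 * Re (t * \<phi> d)"
          unfolding J_def using d s(1) sc(1) pl sc sqn_add_scale[OF EH EH, of "s n" d t] by simp
        finally show ?thesis using s(2)[of n] ip_commute[OF EH EH, OF s(1) d, of n]
          by (simp add: algebra_simps)
      qed
      have "(\<lambda>n. 2 * Re (t * (cnj (ip (E (s n)) (E d)) - \<phi> d)) + (cmod t)\<^sup>2 * sqn (E d))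
          \<longlonglongrightarrow> 2 * Re (t * (cnj (ip F (E d)) - \<phi> d)) + (cmod t)\<^sup>2 * sqn (E d)"
        by (intro tendsto_intros lim EH d)
      moreover have "(\<lambda>n. - (1 / real (Suc n))) \<longlonglongrightarrow> 0"
        using tendsto_minus[OF LIMSEQ_Suc[OF lim_1_over_n[where 'a = real]]] by simp
      ultimately have "0 \<le> 2 * Re (t * (cnj (ip F (E d)) - \<phi> d)) + (cmod t)\<^sup>2 * sqn (E d)"
        using ineq by (intro LIMSEQ_le) auto
      thus ?thesis using ip_commute[OF F(1) EH[OF d]] by simp
    qed
    from nonneg_quadratic_imp_0[OF this] show ?thesis by simp
  qed
  have "sqn F \<le> C"
  proof -
    have l1: "(\<lambda>n. \<phi> (s n)) \<longlonglongrightarrow> ip F F" using lim[OF F(1)] rep[OF s(1)] by simp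
    \<comment> \<open>Expresses the norms of the approximants through quantities whose limits are
      known, so that the bound \<open>C(2)\<close> passes to \<open>F\<close>.\<close>
    have sq: "sqn (E (s n)) = - sqn F + 2 * Re (ip (E (s n)) F) + (sqrt (sqn (E (s n) - F)))\<^sup>2" for n
    proof -
      have "sqn (E (s n) - F) \<ge> 0" using EH s(1) F(1) ip_nonneg by blast
      moreover have "ip F (E (s n)) = cnj (ip (E (s n)) F)" by (intro ip_commute EH s(1) F(1))
      ultimately show ?thesis using EH[OF s(1)] F(1)
        by (simp add: ip_diff_left ip_diff_right diff_in)
    qed
    have "(\<lambda>n. sqn (E (s n))) \<longlonglongrightarrow> - sqn F + 2 * Re (ip F F) + 0\<^sup>2"
      unfolding sq by (intro tendsto_intros lim F)
    hence "(\<lambda>n. C * sqn (E (s n))) \<longlonglongrightarrow> C * sqn F" by (auto intro!: tendsto_mult_left)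
    moreover have "(\<lambda>n. (cmod (\<phi> (s n)))\<^sup>2) \<longlonglongrightarrow> (cmod (ip F F))\<^sup>2" by (intro tendsto_intros l1)
    ultimately have "(cmod (ip F F))\<^sup>2 \<le> C * sqn F" using C(2)[OF s(1)] by (intro LIMSEQ_le) auto
    moreover have "cmod (ip F F) = sqn F" using ip_self[OF F(1)] ip_nonneg[OF F(1)]
      by (metis abs_of_nonneg norm_of_real)
    ultimately show ?thesis using ip_nonneg[OF F(1)] C(1)
      by (cases "sqn F = 0") (auto simp: power2_eq_square)
  qed
  with F(1) rep show ?thesis by blast
qed

text \<open>The bound makes the prescribed values on kernels a bounded functional on kernel
  combinations. Riesz represents it by some \<open>F\<close> in \<open>H\<close>, and testing
  against a single kernel shows that \<open>F\<close> has the values of \<open>f\<close>.\<close>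

lemma in_H_if_bounded:
  assumes "\<And>x. x \<notin> X \<Longrightarrow> f x = 0" and "C \<ge> 0"
    and bound: "\<And>xs. snd ` set xs \<subseteq> X \<Longrightarrow>
      (cmod (\<Sum>(c, x)\<leftarrow>xs. cnj c * f x))\<^sup>2 \<le> C * sqn (kernel_comb X K xs)"
  shows "f \<in> H"
proof -
  define D where "D = {xs :: (complex \<times> 'a) list. snd ` set xs \<subseteq> X}"
  \<comment> \<open>Conjugated, because \<open>riesz\<close> wants a functional that is linear in
    the coefficients.\<close>
  define \<phi> where "\<phi> xs = (\<Sum>(c, x)\<leftarrow>xs. c * cnj (f x))" for xs
  have cnj_\<phi>: "\<phi> xs = cnj (\<Sum>(c, x)\<leftarrow>xs. cnj c * f x)" for xs
    unfolding \<phi>_def by (induction xs) auto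
  have "\<exists>F\<in>H. sqn F \<le> C \<and> (\<forall>xs\<in>D. ip (kernel_comb X K xs) F = \<phi> xs)"
  proof (rule riesz[where pl = "(@)" and sc = "\<lambda>d. map (\<lambda>(c, x). (d * c, x))"])
    show "D \<noteq> {}" by (auto simp: D_def intro!: exI[of _ "[]"])
    show "(cmod (\<phi> d))\<^sup>2 \<le> C * sqn (kernel_comb X K d)" if "d \<in> D" for d
      unfolding cnj_\<phi> complex_mod_cnj using that bound by (simp add: D_def)
    show "kernel_comb X K (map (\<lambda>(c, x). (d * c, x)) xs) = fun_scale d (kernel_comb X K xs)" for d xs
      by (rule kernel_comb_scale)
    show "\<phi> (map (\<lambda>(c, x). (d * c, x)) xs) = d * \<phi> xs" for d xs
      by (induction xs) (auto simp: \<phi>_def algebra_simps)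
    show "kernel_comb X K d \<in> H" if "d \<in> D" for d using that by (simp add: D_def kernel_comb_in)
  qed (auto simp: D_def kernel_comb_append \<phi>_def \<open>C \<ge> 0\<close>)
  then obtain F where F: "F \<in> H" and rep: "\<And>xs. xs \<in> D \<Longrightarrow> ip (kernel_comb X K xs) F = \<phi> xs" by blast
  have "F x = f x" for x
  proof (cases "x \<in> X")
    case True
    have "ip (extend_by_zero X (K x)) F = cnj (f x)"
      using rep[of "[(1, x)]"] True by (simp add: D_def \<phi>_def)
    thus ?thesis using ip_commute[OF kernel_in[OF True] F] reproducing[OF F True] by simp
  next
    case False
    thus ?thesis using assms(1) F vanishes_off by simp
  qed
  hence "F = f" by blast
  with F show ?thesis by simp
qed

text \<open>The converse of \<open>in_H_if_bounded\<close>, with the constant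
  \<open>sqn f\<close>.\<close>

lemma kernel_comb_functional_bound:
  assumes "f \<in> H" "snd ` set xs \<subseteq> X"
  shows "(cmod (\<Sum>(c, x)\<leftarrow>xs. cnj c * f x))\<^sup>2 \<le> sqn f * sqn (kernel_comb X K xs)"
  using cauchy_schwarz[OF assms(1) kernel_comb_in[OF assms(2)]] ip_kernel_comb[OF assms] by simp

lemma bounded_functional_rep:
  assumes add: "\<And>f g. f \<in> H \<Longrightarrow> g \<in> H \<Longrightarrow> \<Lambda> (f + g) = \<Lambda> f + \<Lambda> g"
    and scale: "\<And>c f. f \<in> H \<Longrightarrow> \<Lambda> (fun_scale c f) = c * \<Lambda> f"
    and "C \<ge> 0" "\<And>f. f \<in> H \<Longrightarrow> (cmod (\<Lambda> f))\<^sup>2 \<le> C * sqn f"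
  shows "\<exists>v\<in>H. \<forall>f\<in>H. ip f v = \<Lambda> f"
proof -
  have "\<exists>F\<in>H. sqn F \<le> C \<and> (\<forall>f\<in>H. ip ((\<lambda>f. f) f) F = \<Lambda> f)"
    by (rule riesz[where pl = "(+)" and sc = fun_scale]) (use assms in auto)
  thus ?thesis by blast
qed

lemma span_in_H: "S \<subseteq> H \<Longrightarrow> fspace.span S \<subseteq> H"
  using subspace_H fspace.span_minimal by blast

text \<open>Gram-Schmidt: the new vector \<open>s\<close> is replaced by its part \<open>e\<close>
  orthogonal to the old ones, and the projection \<open>u\<close> is corrected along
  \<open>e\<close>.\<close>

lemma orthogonal_projection_finite:
  assumes "finite S" "S \<subseteq> H" "f \<in> H"
  shows "\<exists>u\<in>fspace.span S. \<forall>s\<in>S. ip (f - u) s = 0"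
  using assms
proof (induction S arbitrary: f rule: finite_induct)
  case empty
  thus ?case using fspace.span_zero by auto
next
  case (insert s S)
  have SH: "S \<subseteq> H" "s \<in> H" using insert.prems by auto
  note spH = span_in_H[OF SH(1)]
  obtain u where u: "u \<in> fspace.span S" "\<forall>t\<in>S. ip (f - u) t = 0" using insert by blast
  obtain v where v: "v \<in> fspace.span S" "\<forall>t\<in>S. ip (s - v) t = 0" using insert.IH[of s] SH by blast
  have uH: "u \<in> H" and vH: "v \<in> H" using u v spH by auto
  define e where "e = s - v"
  have eH: "e \<in> H" using SH vH by (auto simp: e_def)
  \<comment> \<open>If \<open>e\<close> has norm 0, then \<open>s\<close> already lies in the span
    and no correction is made.\<close>
  define t where "t = (if sqn e = 0 then 0 else ip (f - u) e / ip e e)"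
  define w where "w = u + fun_scale t e"
  have mono: "fspace.span S \<subseteq> fspace.span (insert s S)" by (rule fspace.span_mono) auto
  have "e \<in> fspace.span (insert s S)" unfolding e_def
    using v mono by (intro fspace.span_diff) (auto intro: fspace.span_base)
  hence w: "w \<in> fspace.span (insert s S)" unfolding w_def
    using u mono by (intro fspace.span_add fspace.span_scale) auto
  have dec: "f - w = (f - u) - fun_scale t e" by (simp add: w_def)
  have fuH: "f - u \<in> H" using insert.prems uH by auto
  have ort: "ip (f - w) x = 0" if "x \<in> S" for x
    unfolding dec using that u v fuH eH SH by (subst ip_diff_left) (auto simp: ip_scale_left e_def scale_in)
  have fwH: "f - w \<in> H" using insert.prems w span_in_H[OF insert.prems(1)] by auto
  have "fspace.span S \<subseteq> {x \<in> H. ip (f - w) x = 0}"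
    by (intro fspace.span_minimal fspace.subspaceI)
       (use SH fwH ort in \<open>auto simp: ip_add_right ip_scale_right intro!: add_in scale_in ip_zero_right\<close>)
  hence ort_sp: "ip (f - w) x = 0" if "x \<in> fspace.span S" for x using that by blast
  have e0: "ip (f - w) e = 0"
  proof (cases "sqn e = 0")
    case True
    hence "e = 0" using ip_definite[OF eH] ip_self[OF eH] by simp
    thus ?thesis using fwH by (metis ip_zero_right)
  next
    case False
    hence "ip e e \<noteq> 0" using ip_self[OF eH] by auto
    thus ?thesis unfolding dec using False fuH eH by (subst ip_diff_left) (auto simp: ip_scale_left t_def scale_in)
  qed
  have "ip (f - w) s = ip (f - w) e + ip (f - w) v"
    using fwH eH vH by (subst ip_add_right[symmetric]) (auto simp: e_def)
  hence "ip (f - w) s = 0" using e0 ort_sp v by simp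
  hence "\<forall>x\<in>insert s S. ip (f - w) x = 0" using ort by blast
  with w show ?case by blast
qed

end

text \<open>Aronszajn's inclusion criterion: the hypothesis says that \<open>C\<close> times the
  second kernel minus the first is positive semidefinite. The functional of \<open>f\<close> on
  kernel combinations, bounded for the first form, is then bounded for the second.\<close>

lemma rkhs_subset_if_dominated:
  assumes "rkhs X K1 H1 ip1" "rkhs X K2 H2 ip2" "C \<ge> 0"
    and "\<And>xs. snd ` set xs \<subseteq> X \<Longrightarrow> Re (ip1 (kernel_comb X K1 xs) (kernel_comb X K1 xs))
      \<le> C * Re (ip2 (kernel_comb X K2 xs) (kernel_comb X K2 xs))"
  shows "H1 \<subseteq> H2"
proof
  interpret r1: rkhs X K1 H1 ip1 by fact
  interpret r2: rkhs X K2 H2 ip2 by fact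
  fix f assume f: "f \<in> H1"
  have pos: "r1.sqn f \<ge> 0" using f r1.ip_nonneg by blast
  show "f \<in> H2"
  proof (rule r2.in_H_if_bounded)
    show "f x = 0" if "x \<notin> X" for x using that f r1.vanishes_off by blast
    show "r1.sqn f * C \<ge> 0" using pos assms by simp
    show "(cmod (\<Sum>(c, x)\<leftarrow>xs. cnj c * f x))\<^sup>2 \<le> r1.sqn f * C * r2.sqn (kernel_comb X K2 xs)"
      if "snd ` set xs \<subseteq> X" for xs
      using r1.kernel_comb_functional_bound[OF f that] mult_left_mono[OF assms(4)[OF that] pos] by simp
  qed
qed

subsection \<open>Circle means and Szego kernels\<close>

text \<open>Taken as a gauge integral over the angle, which fits contour integrals and uniform
  limits of continuous functions; \<open>integral_circle_measure\<close> links it to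
  \<open>circle_measure\<close>.\<close>

definition circ_mean :: "(complex \<Rightarrow> 'b::banach) \<Rightarrow> 'b" where
  "circ_mean F = (1 / (2 * pi)) *\<^sub>R integral {0..2 * pi} (\<lambda>t. F (cis t))"

lemma circ_integrable:
  fixes F :: "complex \<Rightarrow> 'b::banach"
  assumes "continuous_on unit_circle F"
  shows "(\<lambda>t. F (cis t)) integrable_on {0..2 * pi}"
  by (intro integrable_continuous_interval continuous_on_compose2[OF assms] continuous_intros) auto

lemma circ_mean_add:
  fixes F G :: "complex \<Rightarrow> 'b::banach"
  assumes "continuous_on unit_circle F" "continuous_on unit_circle G"
  shows "circ_mean (\<lambda>z. F z + G z) = circ_mean F + circ_mean G"
  using circ_integrable[OF assms(1)] circ_integrable[OF assms(2)]
  by (simp add: circ_mean_def Henstock_Kurzweil_Integration.integral_add scaleR_add_right)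

lemma circ_mean_diff:
  fixes F G :: "complex \<Rightarrow> 'b::banach"
  assumes "continuous_on unit_circle F" "continuous_on unit_circle G"
  shows "circ_mean (\<lambda>z. F z - G z) = circ_mean F - circ_mean G"
  using circ_integrable[OF assms(1)] circ_integrable[OF assms(2)]
  by (simp add: circ_mean_def Henstock_Kurzweil_Integration.integral_diff scaleR_diff_right)

lemma circ_mean_mult_left: "circ_mean (\<lambda>z. c * F z) = c * circ_mean F" for c :: "'b::{real_normed_field, banach}"
  by (simp add: circ_mean_def)

lemma circ_mean_Re:
  assumes "continuous_on unit_circle F"
  shows "circ_mean (\<lambda>z. Re (F z)) = Re (circ_mean F)"
  using integral_linear[OF circ_integrable[OF assms] bounded_linear_Re]
  by (simp add: circ_mean_def o_def)

lemma circ_mean_cnj: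
  assumes "continuous_on unit_circle F"
  shows "circ_mean (\<lambda>z. cnj (F z)) = cnj (circ_mean F)"
  using integral_linear[OF circ_integrable[OF assms] bounded_linear_cnj]
  by (simp add: circ_mean_def o_def)

lemma circ_mean_mono:
  fixes F G :: "complex \<Rightarrow> real"
  assumes "continuous_on unit_circle F" "continuous_on unit_circle G"
    "\<And>z. cmod z = 1 \<Longrightarrow> F z \<le> G z"
  shows "circ_mean F \<le> circ_mean G"
  using integral_le[OF circ_integrable[OF assms(1)] circ_integrable[OF assms(2)]] assms(3)
  by (simp add: circ_mean_def divide_right_mono)

lemma circ_mean_const: "circ_mean (\<lambda>z. c :: real) = c"
  by (simp add: circ_mean_def)

lemma circ_mean_nonneg:
  fixes F :: "complex \<Rightarrow> real"
  assumes "continuous_on unit_circle F" "\<And>z. cmod z = 1 \<Longrightarrow> 0 \<le> F z"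
  shows "0 \<le> circ_mean F"
  using circ_mean_mono[of "\<lambda>_. 0" F] assms by (simp add: circ_mean_const)

abbreviation circ_sqnorm :: "(complex \<Rightarrow> complex) \<Rightarrow> real" where
  "circ_sqnorm F \<equiv> circ_mean (\<lambda>z. (cmod (F z))\<^sup>2)"

lemma circ_mean_norm_add:
  assumes "continuous_on unit_circle A" "continuous_on unit_circle B"
    and "circ_mean (\<lambda>z. A z * cnj (B z)) = 0"
  shows "circ_mean (\<lambda>z. (cmod (A z + B z))\<^sup>2) =
    circ_sqnorm A + circ_sqnorm B"
proof -
  have c: "continuous_on unit_circle (\<lambda>z. A z * cnj (B z))"
    using assms by (intro continuous_intros)
  have "circ_mean (\<lambda>z. (cmod (A z + B z))\<^sup>2) =
    circ_mean (\<lambda>z. ((cmod (A z))\<^sup>2 + (cmod (B z))\<^sup>2) + 2 * Re (A z * cnj (B z)))"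
    unfolding cmod_power2 by (rule arg_cong[of _ _ circ_mean]) (simp add: fun_eq_iff power2_eq_square algebra_simps)
  also have "\<dots> = circ_mean (\<lambda>z. (cmod (A z))\<^sup>2 + (cmod (B z))\<^sup>2) + circ_mean (\<lambda>z. 2 * Re (A z * cnj (B z)))"
    using assms by (intro circ_mean_add continuous_intros)
  also have "circ_mean (\<lambda>z. 2 * Re (A z * cnj (B z))) = 0"
    unfolding circ_mean_mult_left circ_mean_Re[OF c] assms(3) by simp
  also have "circ_mean (\<lambda>z. (cmod (A z))\<^sup>2 + (cmod (B z))\<^sup>2) =
      circ_sqnorm A + circ_sqnorm B"
    using assms by (intro circ_mean_add continuous_intros)
  finally show ?thesis by simp
qed

section \<open>The disk algebra and the Toeplitz action on Szego kernels\<close>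

definition szego :: "complex \<Rightarrow> complex \<Rightarrow> complex" where
  "szego w z = 1 / (1 - cnj w * z)"

text \<open>Values off the closed disk are left free; \<open>extend_by_zero\<close> produces the
  representative lying in \<open>hardy2\<close>.\<close>

definition disk_algebra :: "(complex \<Rightarrow> complex) set" where
  "disk_algebra = {F. continuous_on (cball 0 1) F \<and> F holomorphic_on unit_disk}"

lemma cnj_mult_neq_1:
  assumes "cmod w < 1" "cmod z \<le> 1"
  shows "cnj w * z \<noteq> 1"
proof
  assume "cnj w * z = 1"
  hence "cmod w * cmod z = 1" by (metis complex_mod_cnj norm_mult norm_one)
  moreover have "cmod w * cmod z \<le> cmod w" using assms by (intro mult_left_le) auto
  ultimately show False using assms by simp
qed

lemma szego_disk_algebra: "cmod w < 1 \<Longrightarrow> szego w \<in> disk_algebra"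
  unfolding disk_algebra_def szego_def
  by (intro CollectI conjI continuous_intros holomorphic_intros) (use cnj_mult_neq_1[of w] in auto)

lemma disk_algebra_continuous: "F \<in> disk_algebra \<Longrightarrow> continuous_on unit_circle F"
  by (auto simp: disk_algebra_def intro: continuous_on_subset)

lemma disk_algebra_mult: "F \<in> disk_algebra \<Longrightarrow> G \<in> disk_algebra \<Longrightarrow> (\<lambda>z. F z * G z) \<in> disk_algebra"
  by (auto simp: disk_algebra_def intro!: continuous_intros holomorphic_intros)

lemma disk_algebra_add: "F \<in> disk_algebra \<Longrightarrow> G \<in> disk_algebra \<Longrightarrow> (\<lambda>z. F z + G z) \<in> disk_algebra"
  by (auto simp: disk_algebra_def intro!: continuous_intros holomorphic_intros)

lemma disk_algebra_diff: "F \<in> disk_algebra \<Longrightarrow> G \<in> disk_algebra \<Longrightarrow> (\<lambda>z. F z - G z) \<in> disk_algebra"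
  by (auto simp: disk_algebra_def intro!: continuous_intros holomorphic_intros)

lemma disk_algebra_const: "(\<lambda>z. c) \<in> disk_algebra"
  by (auto simp: disk_algebra_def)

lemma disk_algebra_poly: "poly p \<in> disk_algebra"
  by (auto simp: disk_algebra_def intro!: continuous_intros holomorphic_intros)

lemma disk_algebra_bounded:
  assumes "F \<in> disk_algebra"
  obtains B where "B > 0" "\<And>z. cmod z \<le> 1 \<Longrightarrow> cmod (F z) \<le> B"
proof -
  have "compact (F ` cball 0 1)"
    using assms by (intro compact_continuous_image) (auto simp: disk_algebra_def)
  then obtain B where "B > 0" "\<And>z. z \<in> cball 0 1 \<Longrightarrow> cmod (F z) \<le> B"
    using compact_imp_bounded bounded_pos by (metis imageI)
  thus ?thesis using that by simp
qed

text \<open>Cauchy's integral formula: on the circle \<open>cnj (szego w z)\<close> is z / (z - w),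
  and dz = i z dt supplies the factor z.\<close>

lemma circ_mean_szego:
  assumes F: "F \<in> disk_algebra" and "cmod w < 1"
  shows "circ_mean (\<lambda>z. F z * cnj (szego w z)) = F w"
proof -
  have "((\<lambda>u. F u / (u - w)) has_contour_integral (2 * of_real pi * \<i> * F w)) (circlepath 0 1)"
    using F assms(2) by (intro Cauchy_integral_circlepath) (auto simp: disk_algebra_def)
  hence "((\<lambda>t. F (0 + complex_of_real 1 * cis t) / (0 + complex_of_real 1 * cis t - w) * complex_of_real 1 * \<i> * cis t)
      has_integral (2 * of_real pi * \<i> * F w)) {0..2*pi}"
    unfolding circlepath_def by (subst (asm) has_contour_integral_part_circlepath_iff) auto
  hence "((\<lambda>t. (- \<i> / (2 * of_real pi)) * (F (cis t) / (cis t - w) * \<i> * cis t))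
      has_integral (- \<i> / (2 * of_real pi)) * (2 * of_real pi * \<i> * F w)) {0..2*pi}"
    by (intro has_integral_mult_right) simp
  also have "(- \<i> / (2 * of_real pi)) * (2 * of_real pi * \<i> * F w) = F w" by simp
  also have "(\<lambda>t. (- \<i> / (2 * of_real pi)) * (F (cis t) / (cis t - w) * \<i> * cis t)) =
      (\<lambda>t. (1 / (2 * pi)) *\<^sub>R (F (cis t) * cnj (szego w (cis t))))"
  proof
    fix t
    have gen: "(- \<i> / (2 * of_real pi)) * (u / d * \<i> * c) = (1 / (2 * pi)) *\<^sub>R (u * (c / d))" for u d c :: complex
    proof -
      have "(- \<i> / (2 * of_real pi)) * (u / d * \<i> * c) = - (\<i> * \<i>) * (u * (c / d)) / (2 * of_real pi)"
        unfolding divide_inverse by (simp only: mult_ac mult_minus_left mult_minus_right)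
      thus ?thesis by (simp add: scaleR_conv_of_real)
    qed
    have "cis t - w \<noteq> 0" using assms(2) by (metis eq_iff_diff_eq_0 less_irrefl norm_cis)
    moreover have "cis t * cnj (cis t) = 1" by (simp add: complex_norm_square[symmetric])
    moreover from this have "1 - w * cnj (cis t) \<noteq> 0"
      using calculation(1) by (metis (no_types, lifting) eq_iff_diff_eq_0 mult.assoc mult.commute mult_1)
    ultimately have "cis t / (cis t - w) = cnj (szego w (cis t))"
      by (simp add: szego_def field_simps)
    thus "(- \<i> / (2 * of_real pi)) * (F (cis t) / (cis t - w) * \<i> * cis t) =
      (1 / (2 * pi)) *\<^sub>R (F (cis t) * cnj (szego w (cis t)))"
      by (simp only: gen)
  qed
  finally have "((\<lambda>t. (1 / (2 * pi)) *\<^sub>R (F (cis t) * cnj (szego w (cis t)))) has_integral F w) {0..2*pi}" .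
  thus ?thesis unfolding circ_mean_def integral_cmul[symmetric] by (rule integral_unique)
qed

text \<open>Unlike \<open>kernel_comb unit_disk szego\<close>, not cut off outside the disk, so that
  it can be integrated over the circle.\<close>

definition szego_comb :: "(complex \<times> complex) list \<Rightarrow> complex \<Rightarrow> complex" where
  "szego_comb xs z = (\<Sum>(c, w)\<leftarrow>xs. c * szego w z)"

text \<open>The action of the co-analytic Toeplitz operator with symbol cnj b on Szego kernels.\<close>

definition toeplitz_adj :: "(complex \<Rightarrow> complex) \<Rightarrow> (complex \<times> complex) list \<Rightarrow> (complex \<times> complex) list" where
  "toeplitz_adj b xs = map (\<lambda>(c, w). (c * cnj (b w), w)) xs"

lemma toeplitz_adj_points [simp]: "snd ` set (toeplitz_adj b xs) = snd ` set xs"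
  by (force simp: toeplitz_adj_def)

lemma szego_comb_disk_algebra:
  assumes "snd ` set xs \<subseteq> unit_disk"
  shows "szego_comb xs \<in> disk_algebra"
proof -
  have "(\<lambda>z. \<Sum>(c, w)\<leftarrow>xs. c * szego w z) \<in> disk_algebra" using assms
    by (induction xs) (auto intro!: disk_algebra_add disk_algebra_mult disk_algebra_const szego_disk_algebra)
  thus ?thesis by (simp add: szego_comb_def[abs_def])
qed

lemma circ_mean_szego_comb:
  assumes F: "F \<in> disk_algebra" and "snd ` set xs \<subseteq> unit_disk"
  shows "circ_mean (\<lambda>z. F z * cnj (szego_comb xs z)) = (\<Sum>(c, w)\<leftarrow>xs. cnj c * F w)"
  using assms(2)
proof (induction xs)
  case Nil
  thus ?case by (simp add: szego_comb_def circ_mean_def)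
next
  case (Cons x xs)
  obtain c w where x: "x = (c, w)" by force
  have l: "cmod w < 1" and xs: "snd ` set xs \<subseteq> unit_disk" using Cons.prems x by auto
  have c1: "continuous_on unit_circle (\<lambda>z. cnj c * (F z * cnj (szego w z)))"
    using disk_algebra_continuous[OF F] disk_algebra_continuous[OF szego_disk_algebra[OF l]]
    by (intro continuous_intros)
  have c2: "continuous_on unit_circle (\<lambda>z. F z * cnj (szego_comb xs z))"
    using disk_algebra_continuous[OF F] disk_algebra_continuous[OF szego_comb_disk_algebra[OF xs]]
    by (intro continuous_intros)
  have "circ_mean (\<lambda>z. F z * cnj (szego_comb (x # xs) z)) =
      circ_mean (\<lambda>z. cnj c * (F z * cnj (szego w z)) + F z * cnj (szego_comb xs z))"
    by (rule arg_cong[of _ _ circ_mean]) (simp add: fun_eq_iff x szego_comb_def algebra_simps)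
  also have "\<dots> = cnj c * F w + circ_mean (\<lambda>z. F z * cnj (szego_comb xs z))"
    using circ_mean_add[OF c1 c2] by (simp add: circ_mean_mult_left circ_mean_szego[OF F l])
  finally show ?case using Cons.IH[OF xs] x by simp
qed

locale toeplitz_pair =
  fixes b :: "complex \<Rightarrow> complex" and xs :: "(complex \<times> complex) list"
  assumes symbol: "b \<in> disk_algebra" and points: "snd ` set xs \<subseteq> unit_disk"
begin

abbreviation "g \<equiv> szego_comb xs"
abbreviation "G \<equiv> szego_comb (toeplitz_adj b xs)"

lemma g_alg: "g \<in> disk_algebra" and G_alg: "G \<in> disk_algebra"
  by (rule szego_comb_disk_algebra, simp only: toeplitz_adj_points points)+

lemmas conts = symbol[THEN disk_algebra_continuous] g_alg[THEN disk_algebra_continuous]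
  G_alg[THEN disk_algebra_continuous]

text \<open>Both sides evaluate the analytic factor at the points of \<open>xs\<close> by the Szego
  property. It is the adjoint relation that makes \<open>G\<close> the Toeplitz image of
  \<open>g\<close>.\<close>

lemma circ_mean_G:
  assumes F: "F \<in> disk_algebra"
  shows "circ_mean (\<lambda>z. F z * cnj (G z)) = circ_mean (\<lambda>z. b z * F z * cnj (g z))"
proof -
  have "circ_mean (\<lambda>z. F z * cnj (G z)) = (\<Sum>(c, w)\<leftarrow>toeplitz_adj b xs. cnj c * F w)"
    using points by (intro circ_mean_szego_comb F) simp
  also have "\<dots> = (\<Sum>(c, w)\<leftarrow>xs. cnj c * (b w * F w))"
    by (simp add: toeplitz_adj_def o_def case_prod_unfold mult_ac)
  also have "\<dots> = circ_mean (\<lambda>z. b z * F z * cnj (g z))"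
    using circ_mean_szego_comb[OF disk_algebra_mult[OF symbol F] points] by simp
  finally show ?thesis .
qed

text \<open>Together with \<open>G_alg\<close> this says that \<open>G\<close> is the orthogonal
  projection of \<open>cnj b * g\<close> to the disk algebra.\<close>

lemma orthogonal:
  assumes F: "F \<in> disk_algebra"
  shows "circ_mean (\<lambda>z. F z * cnj (cnj (b z) * g z - G z)) = 0"
proof -
  note c = conts F[THEN disk_algebra_continuous]
  have "circ_mean (\<lambda>z. F z * cnj (cnj (b z) * g z - G z)) =
    circ_mean (\<lambda>z. b z * F z * cnj (g z) - F z * cnj (G z))"
    by (simp add: algebra_simps)
  also have "\<dots> = circ_mean (\<lambda>z. b z * F z * cnj (g z)) - circ_mean (\<lambda>z. F z * cnj (G z))"
    using c by (intro circ_mean_diff continuous_intros)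
  finally show ?thesis using circ_mean_G[OF F] by simp
qed

lemma residual_norm:
  "circ_mean (\<lambda>z. (cmod (b z))\<^sup>2 * (cmod (g z))\<^sup>2) =
    circ_sqnorm G + circ_mean (\<lambda>z. (cmod (cnj (b z) * g z - G z))\<^sup>2)"
proof -
  have "circ_mean (\<lambda>z. (cmod (G z + (cnj (b z) * g z - G z)))\<^sup>2) =
    circ_sqnorm G + circ_mean (\<lambda>z. (cmod (cnj (b z) * g z - G z))\<^sup>2)"
    using conts by (intro circ_mean_norm_add orthogonal G_alg continuous_intros)
  thus ?thesis by (simp add: norm_mult power_mult_distrib)
qed

lemma toeplitz_adj_le:
  "circ_sqnorm G \<le> circ_mean (\<lambda>z. (cmod (b z))\<^sup>2 * (cmod (g z))\<^sup>2)"
  unfolding residual_norm using conts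
  by (simp, intro circ_mean_nonneg continuous_intros) auto

text \<open>The residual is the distance of cnj b * g to the disk algebra, and s * g is a competitor.\<close>

lemma residual_le:
  assumes s: "s \<in> disk_algebra"
  shows "circ_mean (\<lambda>z. (cmod (cnj (b z) * g z - G z))\<^sup>2) \<le>
    circ_mean (\<lambda>z. (cmod (cnj (b z) - s z))\<^sup>2 * (cmod (g z))\<^sup>2)"
proof -
  note c = conts s[THEN disk_algebra_continuous]
  have "circ_mean (\<lambda>z. (cmod ((G z - s z * g z) + (cnj (b z) * g z - G z)))\<^sup>2) =
    circ_mean (\<lambda>z. (cmod (G z - s z * g z))\<^sup>2) + circ_mean (\<lambda>z. (cmod (cnj (b z) * g z - G z))\<^sup>2)"
    using c by (intro circ_mean_norm_add orthogonal disk_algebra_diff disk_algebra_mult G_alg g_alg s continuous_intros)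
  moreover have "0 \<le> circ_mean (\<lambda>z. (cmod (G z - s z * g z))\<^sup>2)"
    using c by (intro circ_mean_nonneg continuous_intros) auto
  moreover have "(\<lambda>z. (cmod ((G z - s z * g z) + (cnj (b z) * g z - G z)))\<^sup>2) =
      (\<lambda>z. (cmod (cnj (b z) - s z))\<^sup>2 * (cmod (g z))\<^sup>2)"
    by (simp add: fun_eq_iff norm_mult[symmetric] power_mult_distrib[symmetric] algebra_simps)
  ultimately show ?thesis by simp
qed

end

section \<open>The form of H(b) on kernel combinations\<close>

context rkhs begin

lemma sqn_kernel_comb:
  assumes "snd ` set xs \<subseteq> X"
  shows "sqn (kernel_comb X K xs) = Re (\<Sum>(c, x)\<leftarrow>xs. cnj c * kernel_comb X K xs x)"
  by (simp add: ip_kernel_comb[OF kernel_comb_in assms] assms)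

end

lemma dBR_kernel_comb_apply:
  assumes "z \<in> unit_disk"
  shows "kernel_comb unit_disk (dBR_kernel b) xs z = szego_comb xs z - b z * szego_comb (toeplitz_adj b xs) z"
  using assms
  by (induction xs) (auto simp: kernel_comb_apply dBR_kernel_def szego_comb_def toeplitz_adj_def szego_def
      diff_divide_distrib algebra_simps)

abbreviation dBR_sqnorm ::
  "((complex \<Rightarrow> complex) \<Rightarrow> (complex \<Rightarrow> complex) \<Rightarrow> complex) \<Rightarrow> (complex \<Rightarrow> complex) \<Rightarrow> (complex \<times> complex) list \<Rightarrow> real" where
  "dBR_sqnorm ip b xs \<equiv> Re (ip (kernel_comb unit_disk (dBR_kernel b) xs) (kernel_comb unit_disk (dBR_kernel b) xs))"

text \<open>The combination is \<open>g - b * G\<close> on the disk. Pairing it with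
  \<open>g\<close> through the Szego property gives the norm of \<open>g\<close> minus the mean of
  \<open>b * G * cnj g\<close>, and the latter is the norm of \<open>G\<close> by
  \<open>circ_mean_G\<close>. The means need boundary values, whereas \<open>b\<close> matters only
  inside the disk, hence the separate \<open>b'\<close>.\<close>

lemma dBR_form:
  assumes H: "rkhs unit_disk (dBR_kernel b) H ip" and b: "b' \<in> disk_algebra" "\<forall>z\<in>unit_disk. b' z = b z"
    and xs: "snd ` set xs \<subseteq> unit_disk"
  shows "dBR_sqnorm ip b xs =
    circ_sqnorm (szego_comb xs) - circ_sqnorm (szego_comb (toeplitz_adj b' xs))"
proof -
  interpret rkhs unit_disk "dBR_kernel b" H ip by fact
  interpret toeplitz_pair b' xs by (intro toeplitz_pair.intro b xs)
  have ta: "toeplitz_adj b xs = toeplitz_adj b' xs" using xs b(2) by (auto simp: toeplitz_adj_def)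
  have mean_sq: "circ_mean (\<lambda>z. complex_of_real ((cmod (F z))\<^sup>2)) = of_real (circ_sqnorm F)"
    if "F \<in> disk_algebra" for F :: "complex \<Rightarrow> complex"
  proof -
    have "continuous_on unit_circle (\<lambda>z. (cmod (F z))\<^sup>2)"
      using that[THEN disk_algebra_continuous] by (intro continuous_intros)
    from integral_linear[OF circ_integrable[OF this] bounded_linear_of_real[where 'a = complex]]
    show ?thesis by (simp add: circ_mean_def o_def scaleR_conv_of_real)
  qed
  have "(\<Sum>(c, x)\<leftarrow>xs. cnj c * kernel_comb unit_disk (dBR_kernel b) xs x) =
      (\<Sum>(c, x)\<leftarrow>xs. cnj c * (g x - b' x * G x))"
    using xs b(2) by (intro arg_cong[of _ _ sum_list] map_cong) (auto simp: dBR_kernel_comb_apply ta)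
  also have "\<dots> = circ_mean (\<lambda>z. (g z - b' z * G z) * cnj (g z))"
    using circ_mean_szego_comb[OF disk_algebra_diff[OF g_alg disk_algebra_mult[OF b(1) G_alg]] xs] by simp
  also have "\<dots> = circ_mean (\<lambda>z. g z * cnj (g z) - b' z * G z * cnj (g z))"
    by (simp add: algebra_simps)
  also have "\<dots> = circ_mean (\<lambda>z. g z * cnj (g z)) - circ_mean (\<lambda>z. b' z * G z * cnj (g z))"
    using conts by (intro circ_mean_diff continuous_intros)
  also have "circ_mean (\<lambda>z. b' z * G z * cnj (g z)) = circ_mean (\<lambda>z. G z * cnj (G z))"
    using circ_mean_G[OF G_alg] by simp
  finally show ?thesis unfolding sqn_kernel_comb[OF xs]
    by (simp add: complex_norm_square[symmetric] mean_sq g_alg G_alg del: of_real_power)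
qed

lemma dBR_form_lower:
  assumes H: "rkhs unit_disk (dBR_kernel b) H ip" and b: "b' \<in> disk_algebra" "\<forall>z\<in>unit_disk. b' z = b z"
    and xs: "snd ` set xs \<subseteq> unit_disk"
  shows "circ_mean (\<lambda>z. (1 - (cmod (b' z))\<^sup>2) * (cmod (szego_comb xs z))\<^sup>2) \<le>
    dBR_sqnorm ip b xs"
proof -
  interpret toeplitz_pair b' xs by (intro toeplitz_pair.intro b xs)
  have "circ_mean (\<lambda>z. (1 - (cmod (b' z))\<^sup>2) * (cmod (g z))\<^sup>2) =
      circ_mean (\<lambda>z. (cmod (g z))\<^sup>2 - (cmod (b' z))\<^sup>2 * (cmod (g z))\<^sup>2)" by (simp add: algebra_simps)
  also have "\<dots> = circ_sqnorm g - circ_mean (\<lambda>z. (cmod (b' z))\<^sup>2 * (cmod (g z))\<^sup>2)"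
    using conts by (intro circ_mean_diff continuous_intros)
  finally show ?thesis using toeplitz_adj_le unfolding dBR_form[OF assms] by simp
qed

lemma dBR_form_upper:
  assumes H: "rkhs unit_disk (dBR_kernel b) H ip" and b: "b' \<in> disk_algebra" "\<forall>z\<in>unit_disk. b' z = b z"
    and xs: "snd ` set xs \<subseteq> unit_disk" and s: "s \<in> disk_algebra"
  shows "dBR_sqnorm ip b xs \<le>
    circ_mean (\<lambda>z. (1 - (cmod (b' z))\<^sup>2 + (cmod (cnj (b' z) - s z))\<^sup>2) * (cmod (szego_comb xs z))\<^sup>2)"
proof -
  interpret toeplitz_pair b' xs by (intro toeplitz_pair.intro b xs)
  note c = conts s[THEN disk_algebra_continuous]
  have "circ_mean (\<lambda>z. (1 - (cmod (b' z))\<^sup>2 + (cmod (cnj (b' z) - s z))\<^sup>2) * (cmod (g z))\<^sup>2) =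
      circ_mean (\<lambda>z. (cmod (g z))\<^sup>2 - (cmod (b' z))\<^sup>2 * (cmod (g z))\<^sup>2 + (cmod (cnj (b' z) - s z))\<^sup>2 * (cmod (g z))\<^sup>2)"
    by (simp add: algebra_simps)
  also have "\<dots> = circ_mean (\<lambda>z. (cmod (g z))\<^sup>2 - (cmod (b' z))\<^sup>2 * (cmod (g z))\<^sup>2) +
      circ_mean (\<lambda>z. (cmod (cnj (b' z) - s z))\<^sup>2 * (cmod (g z))\<^sup>2)"
    using c by (intro circ_mean_add continuous_intros)
  also have "circ_mean (\<lambda>z. (cmod (g z))\<^sup>2 - (cmod (b' z))\<^sup>2 * (cmod (g z))\<^sup>2) =
      circ_sqnorm g - circ_mean (\<lambda>z. (cmod (b' z))\<^sup>2 * (cmod (g z))\<^sup>2)"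
    using c by (intro circ_mean_diff continuous_intros)
  finally show ?thesis using residual_norm residual_le[OF s] unfolding dBR_form[OF H b xs] by simp
qed

subsection \<open>Interpolation on the circle\<close>

text \<open>The local analytic function has to match \<open>f\<close> on the circle only. This weak
  form is what makes the condition stable under conjugation of \<open>f\<close>.\<close>

definition analytic_at_circle_zeros :: "(complex \<Rightarrow> complex) \<Rightarrow> complex poly \<Rightarrow> bool" where
  "analytic_at_circle_zeros f p \<longleftrightarrow> (\<forall>z0. cmod z0 = 1 \<longrightarrow> poly p z0 = 0 \<longrightarrow>
     (\<exists>e>0. \<exists>g. g holomorphic_on ball z0 e \<and> (\<forall>z\<in>ball z0 e \<inter> unit_circle. f z = g z)))"

lemma continuous_on_circle_bounded:
  fixes f :: "complex \<Rightarrow> 'b::real_normed_vector"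
  assumes "continuous_on unit_circle f"
  obtains B where "B > 0" "\<And>z. cmod z = 1 \<Longrightarrow> norm (f z) \<le> B"
proof -
  have "compact (f ` unit_circle)" by (intro compact_continuous_image assms compact_sphere)
  then obtain B where "B > 0" "\<forall>x\<in>f ` unit_circle. norm x \<le> B"
    using compact_imp_bounded bounded_pos by blast
  with that show ?thesis by auto
qed

text \<open>One linear factor is divided out. At \<open>z0\<close> the quotient takes the derivative
  of the local extension as its value; near any other zero the quotient of the extension is analytic
  on a ball shrunk to avoid \<open>z0\<close>.\<close>

lemma divided_difference_analytic:
  assumes cont: "continuous_on unit_circle f" and an: "analytic_at_circle_zeros f ([:-z0, 1:] * p)"
    and z0: "cmod z0 = 1"
  obtains f1 where "continuous_on unit_circle f1" "analytic_at_circle_zeros f1 p"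
    "\<And>z. cmod z = 1 \<Longrightarrow> f z = f z0 + (z - z0) * f1 z"
proof -
  have "poly ([:-z0, 1:] * p) z0 = 0" by simp
  then obtain e g where e: "e > 0" and g: "g holomorphic_on ball z0 e" and fg: "\<forall>z\<in>ball z0 e \<inter> unit_circle. f z = g z"
    using an z0 unfolding analytic_at_circle_zeros_def by blast
  define g1 where "g1 z = (if z = z0 then deriv g z0 else (g z - g z0) / (z - z0))" for z
  define f1 where "f1 z = (if z = z0 then deriv g z0 else (f z - f z0) / (z - z0))" for z
  have g1: "g1 holomorphic_on ball z0 e"
    unfolding g1_def using g by (intro pole_lemma_open) auto
  have fg0: "f z0 = g z0" using fg e z0 by simp
  have fg1: "f1 z = g1 z" if "z \<in> ball z0 e \<inter> unit_circle" for z
    using that fg fg0 by (simp add: f1_def g1_def)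
  have cont1: "continuous_on unit_circle f1"
    unfolding continuous_on_eq_continuous_within
  proof
    fix z assume z: "z \<in> unit_circle"
    show "continuous (at z within unit_circle) f1"
    proof (cases "z = z0")
      case True
      have "continuous (at z within unit_circle) g1"
        using holomorphic_on_imp_continuous_on[OF g1] e True
        by (metis centre_in_ball continuous_at_imp_continuous_within continuous_on_eq_continuous_at open_ball)
      thus ?thesis using e z fg1 True
        by (rule_tac continuous_transform_within[where f = g1 and \<delta> = e]) (auto simp: dist_commute)
    next
      case False
      have "continuous (at z within unit_circle) (\<lambda>z. (f z - f z0) / (z - z0))"
        using cont z False by (intro continuous_intros) (auto simp: continuous_on_eq_continuous_within)
      thus ?thesis
        by (rule continuous_transform_within[where \<delta> = "dist z z0"]) (use z False in \<open>auto simp: f1_def dist_commute\<close>)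
    qed
  qed
  have an1: "analytic_at_circle_zeros f1 p" unfolding analytic_at_circle_zeros_def
  proof (intro allI impI)
    fix w assume w: "cmod w = 1" "poly p w = 0"
    show "\<exists>e>0. \<exists>g. g holomorphic_on ball w e \<and> (\<forall>z\<in>ball w e \<inter> unit_circle. f1 z = g z)"
    proof (cases "w = z0")
      case True
      thus ?thesis using e g1 fg1 by blast
    next
      case False
      have "poly ([:-z0, 1:] * p) w = 0" using w by simp
      then obtain d h where d: "d > 0" and h: "h holomorphic_on ball w d" and fh: "\<forall>z\<in>ball w d \<inter> unit_circle. f z = h z"
        using an w unfolding analytic_at_circle_zeros_def by blast
      define d' where "d' = min d (dist w z0)"
      have d': "d' > 0" "ball w d' \<subseteq> ball w d" "z0 \<notin> ball w d'" using d False by (auto simp: d'_def)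
      have "(\<lambda>z. (h z - f z0) / (z - z0)) holomorphic_on ball w d'"
        using d' by (intro holomorphic_intros holomorphic_on_subset[OF h]) auto
      moreover have "\<forall>z\<in>ball w d' \<inter> unit_circle. f1 z = (h z - f z0) / (z - z0)"
        using d' fh by (auto simp: f1_def)
      ultimately show ?thesis using d' by blast
    qed
  qed
  show ?thesis
    by (rule that[OF cont1 an1]) (auto simp: f1_def)
qed

text \<open>Hermite interpolation in Newton form: each zero of \<open>p\<close> on the circle costs
  one divided difference, until the bounded remainder is left for constant \<open>p\<close>. Zeros
  off the circle only change the constant.\<close>

lemma interpolation_bound:
  assumes "p \<noteq> 0" "continuous_on unit_circle f" "analytic_at_circle_zeros f p"
  shows "\<exists>s C. \<forall>z. cmod z = 1 \<longrightarrow> cmod (f z - poly s z) \<le> C * cmod (poly p z)"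
  using assms
proof (induction "degree p" arbitrary: p f)
  case 0
  then obtain c where c: "p = [:c:]" by (metis degree_eq_zeroE)
  with "0.prems"(1) have "c \<noteq> 0" by simp
  obtain B where B: "B > 0" "\<And>z. cmod z = 1 \<Longrightarrow> norm (f z) \<le> B"
    using continuous_on_circle_bounded[OF "0.prems"(2)] by blast
  show ?case
    by (rule exI[of _ 0], rule exI[of _ "B / cmod c"]) (use B c \<open>c \<noteq> 0\<close> in auto)
next
  case (Suc n)
  obtain z0 where "poly p z0 = 0" using alg_closed_imp_poly_has_root[of p] Suc.hyps(2) by auto
  then obtain p1 where p: "p = [:-z0, 1:] * p1" unfolding poly_eq_0_iff_dvd by (elim dvdE)
  have p1_nz: "p1 \<noteq> 0" using p Suc.prems(1) by (metis mult_zero_right)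
  have "degree p = 1 + degree p1" unfolding p using p1_nz by (subst degree_mult_eq) auto
  hence p1: "p1 \<noteq> 0" "n = degree p1" using p1_nz Suc.hyps(2) by simp_all
  have p_norm: "cmod (poly p z) = cmod (z - z0) * cmod (poly p1 z)" for z
    by (simp add: p norm_mult[symmetric] algebra_simps)
  show ?case
  proof (cases "cmod z0 = 1")
    case True
    obtain f1 where f1: "continuous_on unit_circle f1" "analytic_at_circle_zeros f1 p1"
      "\<And>z. cmod z = 1 \<Longrightarrow> f z = f z0 + (z - z0) * f1 z"
      using divided_difference_analytic[OF Suc.prems(2) _ True] Suc.prems(3) p by blast
    obtain s C where s: "\<forall>z. cmod z = 1 \<longrightarrow> cmod (f1 z - poly s z) \<le> C * cmod (poly p1 z)"
      using Suc.hyps(1)[OF p1(2) p1(1) f1(1,2)] by blast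
    have "cmod (f z - poly ([:f z0:] + [:-z0, 1:] * s) z) \<le> C * cmod (poly p z)" if z: "cmod z = 1" for z
    proof -
      have "f z - poly ([:f z0:] + [:-z0, 1:] * s) z = (z - z0) * (f1 z - poly s z)"
        using f1(3)[OF z] by (simp add: algebra_simps)
      hence "cmod (f z - poly ([:f z0:] + [:-z0, 1:] * s) z) = cmod (z - z0) * cmod (f1 z - poly s z)"
        by (simp only: norm_mult)
      also have "\<dots> \<le> cmod (z - z0) * (C * cmod (poly p1 z))" using s z by (intro mult_left_mono) auto
      also have "\<dots> = C * cmod (poly p z)" by (simp add: p_norm)
      finally show ?thesis .
    qed
    thus ?thesis by blast
  next
    case False
    \<comment> \<open>The distance of \<open>z0\<close> to the circle: the factor z - z0 is at least
      \<open>d\<close> there and is absorbed into the constant.\<close>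
    define d where "d = \<bar>1 - cmod z0\<bar>"
    have d: "d > 0" using False by (auto simp: d_def)
    have "analytic_at_circle_zeros f p1" using Suc.prems(3) unfolding analytic_at_circle_zeros_def p by auto
    then obtain s C where s: "\<forall>z. cmod z = 1 \<longrightarrow> cmod (f z - poly s z) \<le> C * cmod (poly p1 z)"
      using Suc.hyps(1)[OF p1(2) p1(1) Suc.prems(2)] by blast
    have "cmod (f z - poly s z) \<le> (\<bar>C\<bar> / d) * cmod (poly p z)" if z: "cmod z = 1" for z
    proof -
      have "d \<le> cmod (z - z0)" using norm_triangle_ineq3[of z z0] z by (simp add: d_def)
      hence "d * (\<bar>C\<bar> * cmod (poly p1 z)) \<le> cmod (z - z0) * (\<bar>C\<bar> * cmod (poly p1 z))"
        by (intro mult_right_mono) auto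
      moreover have "cmod (f z - poly s z) \<le> \<bar>C\<bar> * cmod (poly p1 z)"
        using s z by (meson abs_ge_self mult_right_mono norm_ge_zero order_trans)
      moreover have "cmod (poly p z) = cmod (z - z0) * cmod (poly p1 z)"
        by (rule p_norm)
      ultimately show ?thesis using d by (simp add: field_simps) (smt (verit) mult_left_mono)
    qed
    thus ?thesis by blast
  qed
qed

text \<open>Schwarz reflection: \<open>cnj (g (cnj y))\<close> is analytic in y, and on the circle
  \<open>cnj (g z)\<close> is its value at y = 1 / z, because 1 / z is \<open>cnj z\<close>
  there.\<close>

lemma analytic_at_circle_zeros_cnj:
  assumes "analytic_at_circle_zeros f p"
  shows "analytic_at_circle_zeros (\<lambda>z. cnj (f z)) p"
  unfolding analytic_at_circle_zeros_def
proof (intro allI impI)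
  fix w assume w: "cmod w = 1" "poly p w = 0"
  obtain e g where e: "e > 0" and g: "g holomorphic_on ball w e" and fg: "\<forall>z\<in>ball w e \<inter> unit_circle. f z = g z"
    using assms w unfolding analytic_at_circle_zeros_def by blast
  have w0: "w \<noteq> 0" using w by auto
  have ww: "1 / w = cnj w" using w w0 complex_norm_square[of w] by (simp add: field_simps)
  have "isCont (\<lambda>z. 1 / z) w" using w0 by (intro continuous_intros) auto
  then obtain d where d: "d > 0" "\<And>z. dist z w < d \<Longrightarrow> dist (1 / z) (1 / w) < e"
    using e unfolding continuous_at_eps_delta by blast
  \<comment> \<open>As \<open>w\<close> has modulus 1, a radius of at most 1 keeps the pole 0 of the
    reflection out of the ball.\<close>
  define d' where "d' = min d 1"
  have d': "d' > 0" "ball w d' \<subseteq> ball w d" "0 \<notin> ball w d'" using d w by (auto simp: d'_def)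
  have maps: "(\<lambda>z. 1 / z) ` ball w d' \<subseteq> cnj ` ball w e"
  proof
    fix y assume "y \<in> (\<lambda>z. 1 / z) ` ball w d'"
    then obtain z where z: "z \<in> ball w d'" "y = 1 / z" by auto
    hence "dist y (cnj w) < e" using d(2)[of z] d' ww by (auto simp: dist_commute)
    hence "dist w (cnj y) < e" by (metis complex_cnj_cnj complex_cnj_diff complex_mod_cnj dist_commute dist_norm)
    hence "cnj y \<in> ball w e" by simp
    thus "y \<in> cnj ` ball w e" by (metis complex_cnj_cnj imageI)
  qed
  have "open (cnj ` ball w e)"
    unfolding image_cnj_conv_vimage_cnj by (intro open_vimage continuous_intros open_ball)
  hence "(cnj \<circ> g \<circ> cnj) holomorphic_on cnj ` ball w e"
    using g by (intro holomorphic_on_compose_cnj_cnj) (auto simp: image_image)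
  hence "((cnj \<circ> g \<circ> cnj) \<circ> (\<lambda>z. 1 / z)) holomorphic_on ball w d'"
    by (intro holomorphic_on_compose_gen[OF _ _ maps] holomorphic_intros) (use d' in auto)
  moreover have "\<forall>z\<in>ball w d' \<inter> unit_circle. cnj (f z) = ((cnj \<circ> g \<circ> cnj) \<circ> (\<lambda>z. 1 / z)) z"
  proof
    fix z assume z: "z \<in> ball w d' \<inter> unit_circle"
    hence "1 / z = cnj z" using complex_norm_square[of z] by (intro divide_eq_imp) (auto simp: mult.commute)
    moreover have "z \<in> ball w e"
    proof -
      have "1 / z \<in> cnj ` ball w e" using maps z by blast
      thus ?thesis unfolding \<open>1 / z = cnj z\<close> by auto
    qed
    ultimately show "cnj (f z) = ((cnj \<circ> g \<circ> cnj) \<circ> (\<lambda>z. 1 / z)) z" using fg z by auto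
  qed
  ultimately show "\<exists>e>0. \<exists>g. g holomorphic_on ball w e \<and> (\<forall>z\<in>ball w e \<inter> unit_circle. cnj (f z) = g z)"
    using d'(1) by blast
qed

text \<open>With \<open>s\<close> interpolating \<open>cnj b'\<close>, the second term of
  \<open>dBR_form_upper\<close> is at most a multiple of |p|^2, so any weight dominating both 1 -
  |b'|^2 and |p|^2 bounds the form. It is applied with 1 - |q|^2 for the equality of the spaces and
  with |p|^2 for the decomposition.\<close>

lemma dBR_form_upper_weight:
  assumes H: "rkhs unit_disk (dBR_kernel b) H ip" and b: "b' \<in> disk_algebra" "\<forall>z\<in>unit_disk. b' z = b z"
    and p: "p \<noteq> 0" "analytic_at_circle_zeros b' p"
    and w: "continuous_on unit_circle w" "\<And>z. cmod z = 1 \<Longrightarrow> w z \<ge> 0"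
      "\<And>z. cmod z = 1 \<Longrightarrow> 1 - (cmod (b' z))\<^sup>2 \<le> A * w z"
      "\<And>z. cmod z = 1 \<Longrightarrow> (cmod (poly p z))\<^sup>2 \<le> B * w z"
  shows "\<exists>C\<ge>0. \<forall>xs. snd ` set xs \<subseteq> unit_disk \<longrightarrow>
    dBR_sqnorm ip b xs \<le>
    C * circ_mean (\<lambda>z. w z * (cmod (szego_comb xs z))\<^sup>2)"
proof -
  have cb: "continuous_on unit_circle (\<lambda>z. cnj (b' z))"
    using disk_algebra_continuous[OF b(1)] by (intro continuous_intros)
  obtain s M where s: "\<And>z. cmod z = 1 \<Longrightarrow> cmod (cnj (b' z) - poly s z) \<le> M * cmod (poly p z)"
    using interpolation_bound[OF p(1) cb analytic_at_circle_zeros_cnj[OF p(2)]] by blast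
  \<comment> \<open>\<open>A\<close> and \<open>B\<close> carry no sign, but a nonnegative constant
    is wanted; as \<open>w\<close> is nonnegative, enlarging it is harmless.\<close>
  define C where "C = max 0 (A + M\<^sup>2 * B)"
  have pointwise: "1 - (cmod (b' z))\<^sup>2 + (cmod (cnj (b' z) - poly s z))\<^sup>2 \<le> C * w z" if z: "cmod z = 1" for z
  proof -
    have "(cmod (cnj (b' z) - poly s z))\<^sup>2 \<le> M\<^sup>2 * (cmod (poly p z))\<^sup>2"
      using power_mono[OF s[OF z], of 2] by (simp add: power_mult_distrib)
    also have "\<dots> \<le> M\<^sup>2 * (B * w z)" by (intro mult_left_mono w(4) z) auto
    finally have "1 - (cmod (b' z))\<^sup>2 + (cmod (cnj (b' z) - poly s z))\<^sup>2 \<le> (A + M\<^sup>2 * B) * w z"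
      using w(3)[OF z] by (simp add: algebra_simps)
    also have "\<dots> \<le> C * w z" by (intro mult_right_mono w(2) z) (simp add: C_def)
    finally show ?thesis .
  qed
  have "dBR_sqnorm ip b xs \<le>
    C * circ_mean (\<lambda>z. w z * (cmod (szego_comb xs z))\<^sup>2)" if xs: "snd ` set xs \<subseteq> unit_disk" for xs
  proof -
    note c = disk_algebra_continuous[OF b(1)] disk_algebra_continuous[OF disk_algebra_poly]
      disk_algebra_continuous[OF szego_comb_disk_algebra[OF xs]] w(1)
    note dBR_form_upper[OF H b xs disk_algebra_poly[of s]]
    also have "circ_mean (\<lambda>z. (1 - (cmod (b' z))\<^sup>2 + (cmod (cnj (b' z) - poly s z))\<^sup>2) * (cmod (szego_comb xs z))\<^sup>2)
        \<le> circ_mean (\<lambda>z. (C * w z) * (cmod (szego_comb xs z))\<^sup>2)"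
      using c by (intro circ_mean_mono continuous_intros mult_right_mono pointwise) auto
    also have "\<dots> = C * circ_mean (\<lambda>z. w z * (cmod (szego_comb xs z))\<^sup>2)"
      by (simp add: circ_mean_mult_left[symmetric] mult_ac)
    finally show ?thesis .
  qed
  moreover have "C \<ge> 0" by (simp add: C_def)
  ultimately show ?thesis by blast
qed

subsection \<open>Boundary behaviour of powers of a rational function\<close>

text \<open>The mean value theorem on [x, 1] gives the bound with the factor \<open>r\<close>, and
  comparing \<open>x powr r\<close> with \<open>x\<close> gives the one with the factor 1; which is
  upper and which is lower depends on whether \<open>r\<close> is at least 1.\<close>

lemma one_minus_powr_bounds:
  fixes x r :: real
  assumes "0 \<le> x" "x \<le> 1" "r > 0"
  shows "min 1 r * (1 - x) \<le> 1 - x powr r" and "1 - x powr r \<le> max 1 r * (1 - x)"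
proof -
  have "min 1 r * (1 - x) \<le> 1 - x powr r \<and> 1 - x powr r \<le> max 1 r * (1 - x)"
  proof (cases "x = 0 \<or> x = 1")
    case True
    thus ?thesis using assms by auto
  next
    case False
    hence x: "0 < x" "x < 1" using assms by auto
    have "\<exists>z>x. z < 1 \<and> 1 powr r - x powr r = (1 - x) * (r * z powr (r - 1))"
      using x by (intro MVT2 has_real_derivative_powr) auto
    then obtain z where z: "x < z" "z < 1" "1 - x powr r = (1 - x) * (r * z powr (r - 1))" by auto
    show ?thesis
    proof (cases "r \<ge> 1")
      case True
      have "z powr (r - 1) \<le> 1" using powr_mono'[of 0 "r - 1" z] True z x by simp
      hence "r * z powr (r - 1) \<le> r" using assms by (intro mult_left_le) auto
      hence "1 - x powr r \<le> r * (1 - x)" using z x by (simp add: mult.commute[of r])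
      moreover have "x powr r \<le> x" using powr_mono'[of 1 r x] True x by simp
      ultimately show ?thesis using True by simp
    next
      case False
      have "1 \<le> z powr (r - 1)" using powr_mono'[of "r - 1" 0 z] False z x by simp
      hence "r \<le> r * z powr (r - 1)" using assms by simp
      hence "r * (1 - x) \<le> 1 - x powr r" using z x by (simp add: mult.commute[of r])
      moreover have "x \<le> x powr r" using powr_mono'[of r 1 x] False x by simp
      ultimately show ?thesis using False by simp
    qed
  qed
  thus "min 1 r * (1 - x) \<le> 1 - x powr r" "1 - x powr r \<le> max 1 r * (1 - x)" by auto
qed

lemma continuous_extension_closure:
  fixes f :: "'a::euclidean_space \<Rightarrow> 'b::real_normed_vector"
  assumes "continuous_on S f" "\<And>x. x \<in> closure S - S \<Longrightarrow> \<exists>l. (f \<longlongrightarrow> l) (at x within S)"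
  obtains g where "continuous_on (closure S) g" "\<And>x. x \<in> S \<Longrightarrow> g x = f x"
proof (rule continuous_map_extension_pointwise_alt[of euclidean S "closure S" euclidean f])
  show "\<exists>l. limitin euclidean f l (atin_within euclidean x S)" if "x \<in> closure S - S" for x
  proof -
    have "atin_within euclidean x S = at x within S"
      by (auto simp: filter_eq_iff eventually_atin_within eventually_at_topological)
    thus ?thesis using assms(2)[OF that] by simp
  qed
qed (use assms(1) that in \<open>auto simp: closure_subset regular_space_euclidean\<close>)

lemma eventually_poly_nonzero:
  fixes p :: "complex poly"
  assumes "p \<noteq> 0"
  shows "eventually (\<lambda>z. poly p z \<noteq> 0) (at a within S)"
proof -
  obtain d where d: "d > 0" "\<forall>x\<in>{z. poly p z = 0}. x \<noteq> a \<longrightarrow> d \<le> dist a x"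
    using finite_set_avoid[OF poly_roots_finite[OF assms], of a] by blast
  show ?thesis unfolding eventually_at
    by (rule exI[of _ d]) (use d in \<open>auto simp: dist_commute\<close>)
qed

lemma at_within_unit_disk_neq_bot: "cmod a \<le> 1 \<Longrightarrow> at a within unit_disk \<noteq> bot"
  by (simp add: trivial_limit_within islimpt_ball)

text \<open>Off its zeros the denominator dominates the numerator in the disk. In the limit a zero
  of the denominator would be a common zero, against coprimality.\<close>

lemma ball_Hinf_no_poles:
  assumes f: "(\<lambda>z. poly u z / poly v z) \<in> ball_Hinf" and "coprime u v" "v \<noteq> 0" and z: "cmod z \<le> 1"
  shows "poly v z \<noteq> 0"
proof
  assume v0: "poly v z = 0"
  have in_disk: "eventually (\<lambda>w. w \<in> unit_disk) (at z within unit_disk)"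
    by (simp add: eventually_at_filter)
  have "eventually (\<lambda>w. cmod (poly u w) \<le> cmod (poly v w)) (at z within unit_disk)"
    using eventually_poly_nonzero[OF \<open>v \<noteq> 0\<close>, of z unit_disk] in_disk
  proof eventually_elim
    case (elim w)
    hence "cmod (poly u w / poly v w) \<le> 1" using f unfolding ball_Hinf_def by blast
    thus ?case using elim by (simp add: norm_divide divide_le_eq_1)
  qed
  moreover have "((\<lambda>w. cmod (poly u w)) \<longlongrightarrow> cmod (poly u z)) (at z within unit_disk)"
    "((\<lambda>w. cmod (poly v w)) \<longlongrightarrow> cmod (poly v z)) (at z within unit_disk)"
    by (intro tendsto_intros)+
  ultimately have "cmod (poly u z) \<le> cmod (poly v z)"
    using at_within_unit_disk_neq_bot[OF z] tendsto_le by blast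
  thus False using v0 coprime_poly_0[OF \<open>coprime u v\<close>, of z] by simp
qed

locale rational_power =
  fixes q Q L :: "complex \<Rightarrow> complex" and r :: real and u v :: "complex poly"
  assumes q_eq: "q = (\<lambda>z. poly u z / poly v z)"
    and v_nz: "\<And>z. cmod z \<le> 1 \<Longrightarrow> poly v z \<noteq> 0"
    and q_ball: "q \<in> ball_Hinf"
    and r_pos: "r > 0"
    and L_holo: "L holomorphic_on unit_disk"
    and exp_L: "\<And>z. z \<in> unit_disk \<Longrightarrow> exp (L z) = q z"
    and Q_eq: "\<And>z. z \<in> unit_disk \<Longrightarrow> Q z = exp (of_real r * L z)"
begin

lemma q_alg: "q \<in> disk_algebra"
  unfolding q_eq disk_algebra_def using v_nz by (auto intro!: continuous_intros holomorphic_intros)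

lemma q_le_1: "cmod z \<le> 1 \<Longrightarrow> cmod (q z) \<le> 1"
proof -
  assume z: "cmod z \<le> 1"
  have "continuous_on (closure unit_disk) (\<lambda>z. cmod (q z))"
    using q_alg by (auto simp: disk_algebra_def intro!: continuous_intros)
  moreover have "cmod (q w) \<le> 1" if "w \<in> unit_disk" for w using q_ball that by (auto simp: ball_Hinf_def)
  ultimately show ?thesis using continuous_le_on_closure[of unit_disk "\<lambda>z. cmod (q z)" z 1] z by simp
qed

lemma q_nz: "z \<in> unit_disk \<Longrightarrow> q z \<noteq> 0"
  using exp_L exp_not_eq_zero by metis

lemma Q_holo: "Q holomorphic_on unit_disk"
  using L_holo by (subst holomorphic_cong[OF refl Q_eq]) (auto intro!: holomorphic_intros)

lemma norm_Q:
  assumes "z \<in> unit_disk"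
  shows "cmod (Q z) = cmod (q z) powr r"
  using Q_eq[OF assms] exp_L[OF assms, symmetric] by (simp add: norm_exp_eq_Re exp_powr_real mult.commute)

text \<open>Near \<open>z0\<close> the logarithmic derivative of \<open>q\<close> has a primitive
  \<open>h\<close>. On the intersection of ball and disk, which is convex, \<open>L\<close> differs
  from \<open>h\<close> by a constant, so \<open>h\<close> continues the logarithm across the
  circle.\<close>

lemma Q_extends:
  assumes z0: "cmod z0 = 1" "q z0 \<noteq> 0"
  obtains e g where "e > 0" "g holomorphic_on ball z0 e" "\<And>z. z \<in> ball z0 e \<inter> unit_disk \<Longrightarrow> g z = Q z"
proof -
  have "open {z. poly u z \<noteq> 0 \<and> poly v z \<noteq> 0}"
    by (intro open_Collect_conj open_Collect_neq continuous_intros)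
  moreover have "z0 \<in> {z. poly u z \<noteq> 0 \<and> poly v z \<noteq> 0}" using z0 by (auto simp: q_eq)
  ultimately obtain e where e: "e > 0" "ball z0 e \<subseteq> {z. poly u z \<noteq> 0 \<and> poly v z \<noteq> 0}"
    using open_contains_ball by blast
  have q_holo: "q holomorphic_on ball z0 e" unfolding q_eq using e(2) by (auto intro!: holomorphic_intros)
  have q0: "q z \<noteq> 0" if "z \<in> ball z0 e" for z using that e(2) by (auto simp: q_eq)
  have dq_holo: "(\<lambda>z. deriv q z / q z) holomorphic_on ball z0 e"
    using q_holo q0 by (intro holomorphic_intros) auto
  obtain h where h: "\<And>z. z \<in> ball z0 e \<Longrightarrow> (h has_field_derivative deriv q z / q z) (at z within ball z0 e)"
    by (rule holomorphic_convex_primitive'[OF convex_ball open_ball dq_holo], rule that) simp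
  have h_at: "(h has_field_derivative deriv q z / q z) (at z)" if "z \<in> ball z0 e" for z
    using h[OF that] by (simp only: at_within_open[OF that open_ball])
  define U where "U = ball z0 e \<inter> unit_disk"
  have U: "convex U" "open U" unfolding U_def by (auto intro: convex_Int)
  have L_at: "(L has_field_derivative deriv q z / q z) (at z)" if "z \<in> U" for z
  proof -
    have z: "z \<in> unit_disk" "z \<in> ball z0 e" using that by (auto simp: U_def)
    obtain l where l: "(L has_field_derivative l) (at z)"
      using L_holo z(1) by (meson holomorphic_on_imp_differentiable_at open_ball field_differentiable_def)
    have "((\<lambda>z. exp (L z)) has_field_derivative exp (L z) * l) (at z)" by (intro derivative_intros l)
    hence "(q has_field_derivative exp (L z) * l) (at z)"
      by (rule has_field_derivative_transform_within_open[OF _ open_ball z(1)]) (simp add: exp_L)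
    hence "deriv q z = q z * l" using exp_L[OF z(1)] by (simp add: DERIV_imp_deriv)
    thus ?thesis using l q0[OF z(2)] by simp
  qed
  have "\<exists>c. \<forall>z\<in>U. L z - h z = c"
  proof (rule has_field_derivative_zero_constant[OF U(1)])
    fix z assume z: "z \<in> U"
    have "((\<lambda>z. L z - h z) has_field_derivative (deriv q z / q z - deriv q z / q z)) (at z)"
      using z by (intro DERIV_diff L_at h_at) (auto simp: U_def)
    thus "((\<lambda>z. L z - h z) has_field_derivative 0) (at z within U)"
      by (simp add: has_field_derivative_at_within)
  qed
  then obtain c where c: "\<And>z. z \<in> U \<Longrightarrow> L z = h z + c" by (metis diff_add_cancel add.commute)
  have h_holo: "h holomorphic_on ball z0 e"
    using h_at unfolding holomorphic_on_open[OF open_ball] by blast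
  show ?thesis
  proof (rule that[OF e(1)])
    show "(\<lambda>z. exp (of_real r * (h z + c))) holomorphic_on ball z0 e"
      using h_holo by (intro holomorphic_intros)
    show "exp (of_real r * (h z + c)) = Q z" if "z \<in> ball z0 e \<inter> unit_disk" for z
      using that c Q_eq by (auto simp: U_def)
  qed
qed

text \<open>\<open>Q\<close> extends analytically across each boundary point where \<open>q\<close>
  is nonzero, and continuously by 0 where \<open>q\<close> vanishes, since |Q| = |q|^r with r > 0.
  The inequalities are \<open>one_minus_powr_bounds\<close> for |q|^2.\<close>

lemma Q_boundary:
  "\<exists>Q'\<in>disk_algebra. (\<forall>z\<in>unit_disk. Q' z = Q z) \<and>
    (\<forall>z. cmod z = 1 \<longrightarrow> min 1 r * (1 - (cmod (q z))\<^sup>2) \<le> 1 - (cmod (Q' z))\<^sup>2 \<and>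
      1 - (cmod (Q' z))\<^sup>2 \<le> max 1 r * (1 - (cmod (q z))\<^sup>2)) \<and>
    (\<forall>p. (\<forall>z. cmod z = 1 \<longrightarrow> poly p z = 0 \<longrightarrow> q z \<noteq> 0) \<longrightarrow> analytic_at_circle_zeros Q' p)"
proof -
  have q_cont: "continuous_on (cball 0 1) q" using q_alg by (auto simp: disk_algebra_def)
  have lim: "\<exists>l. (Q \<longlongrightarrow> l) (at z within unit_disk)" if "z \<in> closure unit_disk - unit_disk" for z
  proof (cases "q z = 0")
    case True
    have "(q \<longlongrightarrow> 0) (at z within unit_disk)"
      using q_cont that True unfolding continuous_on_def
      by (metis Diff_iff ball_subset_cball closure_ball tendsto_within_subset zero_less_one)
    hence "((\<lambda>z. cmod (q z) powr r) \<longlongrightarrow> 0 powr r) (at z within unit_disk)"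
      using r_pos by (intro tendsto_powr' tendsto_norm_zero) auto
    hence "((\<lambda>z. cmod (Q z)) \<longlongrightarrow> 0) (at z within unit_disk)"
      using r_pos by (rule_tac Lim_transform_eventually) (auto simp: eventually_at_filter norm_Q)
    thus ?thesis using tendsto_norm_zero_cancel by blast
  next
    case False
    have "cmod z = 1" using that by auto
    from Q_extends[OF this False] obtain e g where e: "e > 0" and g: "g holomorphic_on ball z e"
      and gQ: "\<And>w. w \<in> ball z e \<inter> unit_disk \<Longrightarrow> g w = Q w" by blast
    have "(g \<longlongrightarrow> g z) (at z within unit_disk)"
      using holomorphic_on_imp_continuous_on[OF g] e
      by (metis centre_in_ball continuous_on_eq_continuous_at open_ball isCont_def tendsto_within_subset subset_UNIV)
    hence "(Q \<longlongrightarrow> g z) (at z within unit_disk)"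
      by (rule Lim_transform_within[OF _ e]) (auto intro: gQ simp: dist_commute)
    thus ?thesis by blast
  qed
  obtain Q' where Q': "continuous_on (cball 0 1) Q'" "\<And>z. z \<in> unit_disk \<Longrightarrow> Q' z = Q z"
    using continuous_extension_closure[OF holomorphic_on_imp_continuous_on[OF Q_holo] lim] by auto
  have Q'_holo: "Q' holomorphic_on unit_disk"
    using Q_holo holomorphic_transform Q'(2) by metis
  have Q'_alg: "Q' \<in> disk_algebra" using Q'(1) Q'_holo by (simp add: disk_algebra_def)
  have Q'_lim: "(Q' \<longlongrightarrow> Q' z) (at z within unit_disk)" if "cmod z \<le> 1" for z
    using Q'(1) that unfolding continuous_on_def
    by (metis ball_subset_cball dist_0_norm mem_cball tendsto_within_subset)
  \<comment> \<open>\<open>norm_Q\<close> extends from the disk to its closure by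
    continuity.\<close>
  have norm_Q': "cmod (Q' z) = cmod (q z) powr r" if z: "cmod z \<le> 1" for z
  proof -
    have "continuous_on (closure unit_disk) (\<lambda>z. cmod (Q' z) - cmod (q z) powr r)"
      using Q'(1) q_cont r_pos by (auto intro!: continuous_intros continuous_on_powr')
    from continuous_constant_on_closure[OF this, of 0 z] show ?thesis
      using z Q'(2) norm_Q by simp
  qed
  have bounds: "min 1 r * (1 - (cmod (q z))\<^sup>2) \<le> 1 - (cmod (Q' z))\<^sup>2 \<and>
      1 - (cmod (Q' z))\<^sup>2 \<le> max 1 r * (1 - (cmod (q z))\<^sup>2)" if z: "cmod z = 1" for z
  proof -
    have "(cmod (Q' z))\<^sup>2 = ((cmod (q z))\<^sup>2) powr r"
      using norm_Q'[of z] z by (simp add: powr_mult power2_eq_square)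
    moreover have "(cmod (q z))\<^sup>2 \<le> 1" using q_le_1[of z] z by (simp add: power_le_one)
    ultimately show ?thesis using one_minus_powr_bounds[OF zero_le_power2 _ r_pos] by simp
  qed
  have an: "analytic_at_circle_zeros Q' p" if p: "\<And>z. cmod z = 1 \<Longrightarrow> poly p z = 0 \<Longrightarrow> q z \<noteq> 0" for p
    unfolding analytic_at_circle_zeros_def
  proof (intro allI impI)
    fix z0 assume z0: "cmod z0 = 1" "poly p z0 = 0"
    from Q_extends[OF z0(1) p[OF z0]] obtain e g where e: "e > 0" and g: "g holomorphic_on ball z0 e"
      and gQ: "\<And>w. w \<in> ball z0 e \<inter> unit_disk \<Longrightarrow> g w = Q w" by blast
    have "Q' z = g z" if z: "z \<in> ball z0 e \<inter> unit_circle" for z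
    proof -
      have "(g \<longlongrightarrow> g z) (at z within unit_disk)"
        using holomorphic_on_imp_continuous_on[OF g] z
        by (metis IntD1 continuous_on_eq_continuous_at open_ball isCont_def tendsto_within_subset subset_UNIV)
      moreover have "eventually (\<lambda>w. w \<in> ball z0 e) (at z within unit_disk)"
        using z unfolding eventually_at_topological by (intro exI[of _ "ball z0 e"]) auto
      hence "eventually (\<lambda>w. g w = Q' w) (at z within unit_disk)"
        using eventually_at_filter[of "\<lambda>w. w \<in> unit_disk" z unit_disk]
        by (auto simp: eventually_at_filter gQ Q'(2) elim!: eventually_mono)
      ultimately have "(Q' \<longlongrightarrow> g z) (at z within unit_disk)"
        by (rule Lim_transform_eventually)
      thus ?thesis using Q'_lim[of z] z at_within_unit_disk_neq_bot[of z] tendsto_unique by auto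
    qed
    thus "\<exists>e>0. \<exists>g. g holomorphic_on ball z0 e \<and> (\<forall>z\<in>ball z0 e \<inter> unit_circle. Q' z = g z)"
      using e g by blast
  qed
  show ?thesis using Q'_alg bounds an Q'(2) by (intro bexI[of _ Q']) auto
qed

end

subsection \<open>Equality of the spaces\<close>

text \<open>By the maximum principle \<open>b\<close> is a unimodular constant, so the kernel is 0
  and every value of an element of \<open>H\<close> vanishes.\<close>

lemma dBR_trivial_if_constant:
  assumes "rkhs unit_disk (dBR_kernel b) H ip" "b holomorphic_on unit_disk"
    and "\<And>z. z \<in> unit_disk \<Longrightarrow> cmod (b z) = 1"
  shows "H = {0}"
proof -
  interpret rkhs unit_disk "dBR_kernel b" H ip by fact
  have "b constant_on unit_disk"
    by (rule maximum_modulus_principle[where U = unit_disk and \<xi> = 0]) (use assms in auto)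
  then obtain c where c: "\<And>z. z \<in> unit_disk \<Longrightarrow> b z = c" by (auto simp: constant_on_def)
  have "cmod c = 1" using c[of 0] assms(3)[of 0] by simp
  hence "cnj c * c = 1" using complex_norm_square[of c] by (simp add: mult.commute)
  hence k0: "extend_by_zero unit_disk (dBR_kernel b x) = 0" if "x \<in> unit_disk" for x
    using that c by (auto simp: extend_by_zero_def dBR_kernel_def fun_eq_iff)
  have "f = 0" if f: "f \<in> H" for f
  proof
    fix x show "f x = 0 x"
      using reproducing[OF f, of x] k0[of x] vanishes_off[OF f, of x] f
      by (cases "x \<in> unit_disk") (auto simp: ip_zero_right)
  qed
  thus ?thesis using zero_in by blast
qed

text \<open>The conjugate reciprocal polynomial. On the circle it replaces
  \<open>cnj (poly p z)\<close>, up to a power of z, by a polynomial.\<close>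

definition conj_reflect :: "complex poly \<Rightarrow> complex poly" where
  "conj_reflect p = reflect_poly (map_poly cnj p)"

lemma inverse_eq_cnj: "cmod z = 1 \<Longrightarrow> inverse z = cnj z"
  using complex_norm_square[of z] by (intro inverse_unique) simp

lemma poly_conj_reflect:
  assumes "cmod z = 1"
  shows "poly (conj_reflect p) z = z ^ degree (map_poly cnj p) * cnj (poly p z)"
proof -
  have "z \<noteq> 0" using assms by auto
  thus ?thesis using inverse_eq_cnj[OF assms]
    by (simp add: conj_reflect_def poly_reflect_poly_nz)
qed

text \<open>On the circle, |v|^2 - |u|^2 becomes a polynomial after multiplication by a power of z.
  The two conjugates need different powers, so each product is given the missing one.\<close>

lemma norm_square_difference_poly:
  obtains G :: "complex poly"
    where "\<And>z. cmod z = 1 \<Longrightarrow> cmod (poly G z) = \<bar>(cmod (poly v z))\<^sup>2 - (cmod (poly u z))\<^sup>2\<bar>"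
proof -
  define m n where "m = degree (map_poly cnj u)" and "n = degree (map_poly cnj v)"
  define G where "G = monom 1 m * (v * conj_reflect v) - monom 1 n * (u * conj_reflect u)"
  have "cmod (poly G z) = \<bar>(cmod (poly v z))\<^sup>2 - (cmod (poly u z))\<^sup>2\<bar>" if z: "cmod z = 1" for z
  proof -
    have "poly G z = z ^ (m + n) * (poly v z * cnj (poly v z) - poly u z * cnj (poly u z))"
      by (simp add: G_def poly_conj_reflect[OF z] poly_monom m_def n_def algebra_simps power_add)
    also have "\<dots> = z ^ (m + n) * of_real ((cmod (poly v z))\<^sup>2 - (cmod (poly u z))\<^sup>2)"
      by (simp add: complex_norm_square[symmetric])
    finally show ?thesis using z by (simp add: norm_mult norm_power flip: of_real_power of_real_diff)
  qed
  thus ?thesis by (rule that)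
qed

context rational_power
begin

text \<open>\<open>q\<close> is an exponential in the disk, hence 1 / q is analytic and the maximum
  principle applies to it as well as to \<open>q\<close>.\<close>

lemma norm_1_imp_trivial:
  assumes "\<And>z. cmod z = 1 \<Longrightarrow> cmod (q z) = 1" and z: "z \<in> unit_disk"
  shows "cmod (q z) = 1 \<and> cmod (Q z) = 1"
proof -
  have q0: "q z \<noteq> 0" if "cmod z \<le> 1" for z
    using that assms(1)[of z] q_nz[of z] by (cases "cmod z = 1") auto
  have "cmod (1 / q z) \<le> 1"
  proof (rule maximum_modulus_frontier[where S = "cball 0 1" and f = "\<lambda>z. 1 / q z" and \<xi> = z])
    show "(\<lambda>z. 1 / q z) holomorphic_on interior (cball 0 1)"
      using q_alg q0 by (auto simp: disk_algebra_def intro!: holomorphic_intros)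
    show "continuous_on (closure (cball 0 1)) (\<lambda>z. 1 / q z)"
      using q_alg q0 by (auto simp: disk_algebra_def intro!: continuous_intros)
  qed (use assms z in \<open>auto simp: norm_divide\<close>)
  moreover have "cmod (q z) \<le> 1" using q_le_1 z by simp
  ultimately have "cmod (q z) = 1" using q0[of z] z by (simp add: norm_divide divide_le_eq_1)
  thus ?thesis using norm_Q[OF z] by simp
qed

text \<open>Both forms are comparable to the mean of \<open>w z * (cmod (szego_comb xs z))^2\<close>
  with \<open>w\<close> = 1 - |q|^2; each inclusion combines the upper bound of one form with the
  lower bound of the other.\<close>

lemma spaces_equal:
  assumes Hq: "rkhs unit_disk (dBR_kernel q) Hq ipq" and HQ: "rkhs unit_disk (dBR_kernel Q) HQ ipQ"
  shows "HQ = Hq"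
proof -
  obtain G where G: "\<And>z. cmod z = 1 \<Longrightarrow> cmod (poly G z) = \<bar>(cmod (poly v z))\<^sup>2 - (cmod (poly u z))\<^sup>2\<bar>"
    using norm_square_difference_poly[where u = u and v = v] by blast
  have q_circle: "(cmod (poly u z))\<^sup>2 = (cmod (q z))\<^sup>2 * (cmod (poly v z))\<^sup>2" if "cmod z = 1" for z
    using v_nz[of z] that by (simp add: q_eq norm_divide power_divide)
  show ?thesis
  proof (cases "G = 0")
    \<comment> \<open>The weight vanishes identically: |q| = 1 on the whole circle, and both spaces
      are zero.\<close>
    case True
    have "cmod (q z) = 1" if z: "cmod z = 1" for z
    proof -
      have "(cmod (q z))\<^sup>2 * (cmod (poly v z))\<^sup>2 = 1 * (cmod (poly v z))\<^sup>2"
        using G[OF z] q_circle[OF z] True by simp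
      hence "(cmod (q z))\<^sup>2 = 1" using v_nz[of z] z by simp
      thus ?thesis using power2_eq_1_iff[of "cmod (q z)"] norm_ge_zero[of "q z"] by linarith
    qed
    note triv = norm_1_imp_trivial[OF this]
    have "Hq = {0}" by (rule dBR_trivial_if_constant[OF Hq]) (use triv q_alg in \<open>auto simp: disk_algebra_def\<close>)
    moreover have "HQ = {0}" by (rule dBR_trivial_if_constant[OF HQ Q_holo]) (use triv in auto)
    ultimately show ?thesis by simp
  next
    case False
    define w where "w z = 1 - (cmod (q z))\<^sup>2" for z
    have w_cont: "continuous_on unit_circle w"
      unfolding w_def using disk_algebra_continuous[OF q_alg] by (intro continuous_intros)
    have w_nn: "0 \<le> w z" and w_le: "w z \<le> 1" if "cmod z = 1" for z
      using q_le_1[of z] that by (auto simp: w_def power_le_one)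
    have G_w: "cmod (poly G z) = (cmod (poly v z))\<^sup>2 * w z" if z: "cmod z = 1" for z
    proof -
      have "(cmod (poly v z))\<^sup>2 - (cmod (poly u z))\<^sup>2 = (cmod (poly v z))\<^sup>2 * w z"
        unfolding q_circle[OF z] w_def by (simp add: algebra_simps)
      thus ?thesis unfolding G[OF z] using w_nn[OF z] by simp
    qed
    obtain M where M: "M > 0" "\<And>z. cmod z = 1 \<Longrightarrow> cmod (poly v z) \<le> M"
      using continuous_on_circle_bounded[OF disk_algebra_continuous[OF disk_algebra_poly[of v]]] by blast
    \<comment> \<open>The modulus of \<open>G\<close> is itself |v|^2 times \<open>w\<close>; as
      \<open>w\<close> is at most 1, its square is again dominated by \<open>w\<close>.\<close>
    have G_le: "(cmod (poly G z))\<^sup>2 \<le> M ^ 4 * w z" if z: "cmod z = 1" for z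
    proof -
      have "(cmod (poly G z))\<^sup>2 = cmod (poly v z) ^ 4 * (w z * w z)"
        unfolding G_w[OF z] by (simp add: power2_eq_square power4_eq_xxxx mult_ac)
      also have "\<dots> \<le> M ^ 4 * (w z * 1)"
        using M z w_nn[OF z] w_le[OF z] by (intro mult_mono power_mono mult_left_mono) auto
      finally show ?thesis by simp
    qed
    \<comment> \<open>At a zero of \<open>G\<close> the weight is 0, that is, |q| = 1; hence
      \<open>Q'\<close> is analytic there.\<close>
    have q_G: "q z \<noteq> 0" if "cmod z = 1" "poly G z = 0" for z
      using G_w[OF that(1)] that v_nz[of z] by (auto simp: w_def)
    obtain Q' where Q': "Q' \<in> disk_algebra" "\<forall>z\<in>unit_disk. Q' z = Q z"
      "\<forall>z. cmod z = 1 \<longrightarrow> min 1 r * (1 - (cmod (q z))\<^sup>2) \<le> 1 - (cmod (Q' z))\<^sup>2 \<and>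
        1 - (cmod (Q' z))\<^sup>2 \<le> max 1 r * (1 - (cmod (q z))\<^sup>2)"
      "\<forall>p. (\<forall>z. cmod z = 1 \<longrightarrow> poly p z = 0 \<longrightarrow> q z \<noteq> 0) \<longrightarrow> analytic_at_circle_zeros Q' p"
      using Q_boundary by blast
    have Q'_bounds: "min 1 r * w z \<le> 1 - (cmod (Q' z))\<^sup>2" "1 - (cmod (Q' z))\<^sup>2 \<le> max 1 r * w z" if "cmod z = 1" for z
      using Q'(3) that unfolding w_def by blast+
    have q_an: "analytic_at_circle_zeros q G" unfolding analytic_at_circle_zeros_def
    proof (intro allI impI)
      fix z0 assume z0: "cmod z0 = 1"
      have "open {z. poly v z \<noteq> 0}" by (intro open_Collect_neq continuous_intros)
      moreover have "z0 \<in> {z. poly v z \<noteq> 0}" using v_nz[of z0] z0 by simp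
      ultimately obtain e where e: "e > 0" "ball z0 e \<subseteq> {z. poly v z \<noteq> 0}" using open_contains_ball by blast
      have "q holomorphic_on ball z0 e" unfolding q_eq using e(2) by (auto intro!: holomorphic_intros)
      thus "\<exists>e>0. \<exists>g. g holomorphic_on ball z0 e \<and> (\<forall>z\<in>ball z0 e \<inter> unit_circle. q z = g z)"
        using e by blast
    qed
    have Q'_an: "analytic_at_circle_zeros Q' G" using Q'(4) q_G by blast
    have w_q: "1 - (cmod (q z))\<^sup>2 \<le> 1 * w z" for z by (simp add: w_def)
    have q_eq_q: "\<forall>z\<in>unit_disk. q z = q z" by simp
    obtain C1 where C1: "C1 \<ge> 0" "\<And>xs. snd ` set xs \<subseteq> unit_disk \<Longrightarrow>
      dBR_sqnorm ipq q xs \<le>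
      C1 * circ_mean (\<lambda>z. w z * (cmod (szego_comb xs z))\<^sup>2)"
      using dBR_form_upper_weight[OF Hq q_alg q_eq_q False q_an w_cont w_nn w_q G_le] by blast
    obtain C2 where C2: "C2 \<ge> 0" "\<And>xs. snd ` set xs \<subseteq> unit_disk \<Longrightarrow>
      dBR_sqnorm ipQ Q xs \<le>
      C2 * circ_mean (\<lambda>z. w z * (cmod (szego_comb xs z))\<^sup>2)"
      using dBR_form_upper_weight[OF HQ Q'(1,2) False Q'_an w_cont w_nn Q'_bounds(2) G_le] by blast
    show ?thesis
    proof
      show "HQ \<subseteq> Hq"
      proof (rule rkhs_subset_if_dominated[OF HQ Hq C2(1)])
        fix xs :: "(complex \<times> complex) list" assume xs: "snd ` set xs \<subseteq> unit_disk"
        note C2(2)[OF xs]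
        also have "C2 * circ_mean (\<lambda>z. w z * (cmod (szego_comb xs z))\<^sup>2) \<le>
          C2 * dBR_sqnorm ipq q xs"
          using dBR_form_lower[OF Hq q_alg q_eq_q xs] C2(1) unfolding w_def by (intro mult_left_mono)
        finally show "dBR_sqnorm ipQ Q xs \<le>
          C2 * dBR_sqnorm ipq q xs" .
      qed
      \<comment> \<open>The lower constant of \<open>Q'_bounds\<close>: it passes from the weight
        \<open>w\<close> to 1 - |Q'|^2.\<close>
      define c where "c = min 1 r"
      have c: "c > 0" using r_pos by (simp add: c_def)
      show "Hq \<subseteq> HQ"
      proof (rule rkhs_subset_if_dominated[OF Hq HQ])
        show "C1 / c \<ge> 0" using C1 c by simp
        fix xs :: "(complex \<times> complex) list" assume xs: "snd ` set xs \<subseteq> unit_disk"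
        note cont = w_cont disk_algebra_continuous[OF Q'(1)] disk_algebra_continuous[OF szego_comb_disk_algebra[OF xs]]
        have "c * circ_mean (\<lambda>z. w z * (cmod (szego_comb xs z))\<^sup>2) =
            circ_mean (\<lambda>z. (c * w z) * (cmod (szego_comb xs z))\<^sup>2)"
          by (simp add: circ_mean_mult_left[symmetric] mult_ac)
        also have "\<dots> \<le> circ_mean (\<lambda>z. (1 - (cmod (Q' z))\<^sup>2) * (cmod (szego_comb xs z))\<^sup>2)"
          using cont Q'_bounds(1) unfolding c_def
          by (intro circ_mean_mono continuous_intros mult_right_mono) auto
        also note dBR_form_lower[OF HQ Q'(1,2) xs]
        finally have "circ_mean (\<lambda>z. w z * (cmod (szego_comb xs z))\<^sup>2) \<le>
            dBR_sqnorm ipQ Q xs / c"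
          using c by (simp add: field_simps)
        from mult_left_mono[OF this C1(1)] C1(2)[OF xs]
        show "dBR_sqnorm ipq q xs \<le>
          C1 / c * dBR_sqnorm ipQ Q xs"
          by simp
      qed
    qed
  qed
qed

end

subsection \<open>The Hardy space as a reproducing kernel Hilbert space\<close>

lemma integral_circle_measure:
  fixes F :: "complex \<Rightarrow> real"
  assumes "F \<in> borel_measurable borel" "continuous_on unit_circle F"
  shows "(LINT z|circle_measure. F z) = circ_mean F"
proof -
  have dens: "uniform_measure lborel {0..2 * pi} = density lborel (\<lambda>x. ennreal (indicator {0..2 * pi} x / (2 * pi)))"
    unfolding uniform_measure_def
  proof (rule arg_cong[of _ _ "density lborel"], rule ext)
    fix x :: real
    show "indicator {0..2 * pi} x / emeasure lborel {0..2 * pi} = ennreal (indicator {0..2 * pi} x / (2 * pi))"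
      by (cases "x \<in> {0..2 * pi}") (simp_all add: divide_ennreal flip: ennreal_1)
  qed
  have "cis \<in> borel_measurable borel"
    by (intro borel_measurable_continuous_onI continuous_intros)
  hence cis_m: "cis \<in> borel_measurable lborel" by simp
  have Fc: "(\<lambda>t. F (cis t)) \<in> borel_measurable lborel"
    using assms(1) cis_m by (rule measurable_compose[rotated])
  have "continuous_on {0..2 * pi} (\<lambda>t. F (cis t))"
    by (intro continuous_on_compose2[OF assms(2)] continuous_intros) auto
  hence si: "set_integrable lborel {0..2 * pi} (\<lambda>t. F (cis t))"
    by (rule borel_integrable_atLeastAtMost')
  have "(LINT z|circle_measure. F z) = (LINT t|uniform_measure lborel {0..2 * pi}. F (cis t))"
    unfolding circle_measure_def using cis_m assms(1) by (intro integral_distr) auto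
  also have "\<dots> = (LINT t|lborel. (indicator {0..2 * pi} t / (2 * pi)) *\<^sub>R F (cis t))"
    unfolding dens using Fc by (intro integral_density) auto
  also have "\<dots> = (LINT t|lborel. (1 / (2 * pi)) * (indicator {0..2 * pi} t *\<^sub>R F (cis t)))"
    by (simp add: mult_ac)
  also have "\<dots> = (1 / (2 * pi)) * (LINT t:{0..2 * pi}|lborel. F (cis t))"
    unfolding set_lebesgue_integral_def by (rule integral_mult_right_zero)
  also have "\<dots> = circ_mean F"
    using set_borel_integral_eq_integral(2)[OF si] by (simp add: circ_mean_def)
  finally show ?thesis .
qed

lemma circ_mean_cong:
  assumes "\<And>z. cmod z = 1 \<Longrightarrow> F z = G z"
  shows "circ_mean F = circ_mean G"
  unfolding circ_mean_def using assms by simp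

text \<open>Induction by Pythagoras: on the circle the partial sum times the conjugate of the next
  monomial is the conjugate of a polynomial vanishing at 0, and such a polynomial has mean
  0.\<close>

lemma parseval_poly:
  "circ_mean (\<lambda>z. (cmod (\<Sum>n<M. a n * z ^ n))\<^sup>2) = (\<Sum>n<M. (cmod (a n))\<^sup>2)"
proof (induction M)
  case 0
  show ?case by (simp add: circ_mean_const)
next
  case (Suc M)
  define A where "A z = (\<Sum>n<M. a n * z ^ n)" for z
  define B where "B z = a M * z ^ M" for z
  define G where "G z = a M * (\<Sum>n<M. cnj (a n) * z ^ (M - n))" for z
  have A_cont: "continuous_on unit_circle A" and B_cont: "continuous_on unit_circle B"
    unfolding A_def B_def by (intro continuous_intros)+
  have G_alg: "G \<in> disk_algebra"
    unfolding G_def disk_algebra_def by (auto intro!: continuous_intros holomorphic_intros)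
  have AB: "A z * cnj (B z) = cnj (G z)" if z: "cmod z = 1" for z
  proof -
    have "z ^ n * cnj z ^ M = cnj z ^ (M - n)" if "n < M" for n
    proof -
      have "z ^ n * cnj z ^ M = (z * cnj z) ^ n * cnj z ^ (M - n)"
        using that by (simp add: power_mult_distrib flip: power_add)
      thus ?thesis using z complex_norm_square[of z] by simp
    qed
    thus ?thesis by (simp add: A_def B_def G_def sum_distrib_left sum_distrib_right mult_ac)
  qed
  have "circ_mean (\<lambda>z. A z * cnj (B z)) = circ_mean (\<lambda>z. cnj (G z))"
    by (rule circ_mean_cong) (rule AB)
  also have "\<dots> = cnj (circ_mean G)" by (rule circ_mean_cnj[OF disk_algebra_continuous[OF G_alg]])
  \<comment> \<open>\<open>szego 0\<close> is the constant 1, so the reproducing property at 0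
    computes a plain mean.\<close>
  also have "circ_mean G = circ_mean (\<lambda>z. G z * cnj (szego 0 z))" by (simp add: szego_def)
  also have "\<dots> = G 0" by (rule circ_mean_szego[OF G_alg]) simp
  also have "G 0 = 0" by (auto simp: G_def power_0_left intro!: sum.neutral)
  finally have orth: "circ_mean (\<lambda>z. A z * cnj (B z)) = 0" by simp
  have B_norm: "circ_sqnorm B = (cmod (a M))\<^sup>2"
    using circ_mean_cong[of "\<lambda>z. (cmod (B z))\<^sup>2" "\<lambda>_. (cmod (a M))\<^sup>2"]
    by (simp add: B_def norm_mult norm_power circ_mean_const)
  have "circ_mean (\<lambda>z. (cmod (A z + B z))\<^sup>2) = (\<Sum>n<Suc M. (cmod (a n))\<^sup>2)"
    unfolding circ_mean_norm_add[OF A_cont B_cont orth] B_norm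
    using Suc.IH by (simp add: A_def[abs_def])
  thus ?case by (simp add: A_def B_def)
qed

lemma circ_mean_uniform_limit:
  fixes f :: "nat \<Rightarrow> complex \<Rightarrow> real"
  assumes "uniform_limit unit_circle f g sequentially" "\<And>n. continuous_on unit_circle (f n)"
  shows "(\<lambda>n. circ_mean (f n)) \<longlonglongrightarrow> circ_mean g"
proof -
  have u: "uniform_limit {0..2 * pi} (\<lambda>n t. f n (cis t)) (\<lambda>t. g (cis t)) sequentially"
    using assms(1) by (rule uniform_limit_compose') auto
  have c: "continuous_on {0..2 * pi} (\<lambda>t. f n (cis t))" for n
    by (intro continuous_on_compose2[OF assms(2)] continuous_intros) auto
  obtain I J where IJ: "\<And>n. ((\<lambda>t. f n (cis t)) has_integral I n) {0..2 * pi}"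
    "((\<lambda>t. g (cis t)) has_integral J) {0..2 * pi}" "I \<longlonglongrightarrow> J"
    using uniform_limit_integral[OF u c sequentially_bot] by metis
  thus ?thesis unfolding circ_mean_def
    by (simp add: integral_unique[OF IJ(1)] integral_unique[OF IJ(2)] tendsto_divide)
qed

lemma eventually_between_at_left:
  fixes a b :: real
  assumes "a < b"
  shows "eventually (\<lambda>x. a < x \<and> x < b) (at_left b)"
  using assms by (auto simp: eventually_at_left_field)

section \<open>Taylor coefficients and square summability\<close>

definition tcoeff :: "(complex \<Rightarrow> complex) \<Rightarrow> nat \<Rightarrow> complex" where
  "tcoeff f n = (deriv ^^ n) f 0 / fact n"

lemma tcoeff_sums:
  assumes "f holomorphic_on unit_disk" "cmod z < 1"
  shows "(\<lambda>n. tcoeff f n * z ^ n) sums f z"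
  using holomorphic_power_series[OF assms(1), of z] assms(2) by (simp add: tcoeff_def)

lemma tcoeff_unique:
  assumes "\<And>z. cmod z < 1 \<Longrightarrow> (\<lambda>n. a n * z ^ n) sums f z"
  shows "tcoeff f = a" and "f holomorphic_on unit_disk"
proof -
  have "eventually (\<lambda>u. u \<in> unit_disk) (nhds (0 :: complex))"
    by (intro eventually_nhds_in_open) auto
  hence "eventually (\<lambda>u. (\<lambda>n. fps_nth (Abs_fps a) n * u ^ n) sums f u) (nhds 0)"
    by (rule eventually_mono) (use assms in auto)
  from fps_nth_fps_expansion[OF has_fps_expansionI[OF this]] show "tcoeff f = a"
    by (auto simp: tcoeff_def fun_eq_iff)
  show "f holomorphic_on unit_disk"
    by (rule power_series_holomorphic[of 0 1 a]) (use assms in simp)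
qed

lemma parseval_radius:
  assumes f: "f holomorphic_on unit_disk" and \<rho>: "0 < \<rho>" "\<rho> < 1"
  shows "(\<lambda>n. (cmod (tcoeff f n))\<^sup>2 * \<rho> ^ (2 * n)) sums circ_mean (\<lambda>z. (cmod (f (of_real \<rho> * z)))\<^sup>2)"
proof -
  define c where "c n = tcoeff f n * of_real \<rho> ^ n" for n
  define S where "S M z = (\<Sum>n<M. c n * z ^ n)" for M z
  define g where "g z = f (of_real \<rho> * z)" for z
  \<comment> \<open>Convergence at a slightly larger radius gives absolute convergence at radius
    \<open>\<rho>\<close>, as the Weierstrass test demands.\<close>
  obtain \<rho>' where \<rho>': "\<rho> < \<rho>'" "\<rho>' < 1" using \<rho>(2) dense by blast
  have "summable (\<lambda>n. tcoeff f n * of_real \<rho>' ^ n)"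
    by (rule sums_summable[OF tcoeff_sums[OF f]]) (use \<rho> \<rho>' in simp)
  hence summ: "summable (\<lambda>n. norm (tcoeff f n * of_real \<rho> ^ n))"
    by (rule powser_insidea) (use \<rho> \<rho>' in simp)
  have "uniform_limit unit_circle (\<lambda>M z. \<Sum>n<M. c n * z ^ n) (\<lambda>z. suminf (\<lambda>n. c n * z ^ n)) sequentially"
    by (rule Weierstrass_m_test[OF _ summ]) (auto simp: c_def norm_mult norm_power)
  moreover have "suminf (\<lambda>n. c n * z ^ n) = g z" if "z \<in> unit_circle" for z
  proof -
    have "(\<lambda>n. tcoeff f n * (of_real \<rho> * z) ^ n) sums g z"
      unfolding g_def by (rule tcoeff_sums[OF f]) (use that \<rho> in \<open>simp add: norm_mult\<close>)
    thus ?thesis by (simp add: c_def power_mult_distrib mult_ac sums_iff)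
  qed
  ultimately have ul: "uniform_limit unit_circle S g sequentially"
    by (subst (asm) uniform_limit_cong'[where g = S and i = g]) (auto simp: S_def)
  have g_cont: "continuous_on unit_circle g"
    unfolding g_def using f \<rho>
    by (intro continuous_on_compose2[OF holomorphic_on_imp_continuous_on[OF f]] continuous_intros) (auto simp: norm_mult)
  have S_cont: "continuous_on unit_circle (S M)" for M unfolding S_def by (intro continuous_intros)
  have "bounded ((\<lambda>z. cmod (g z)) ` unit_circle)"
    by (intro compact_imp_bounded compact_continuous_image continuous_intros g_cont compact_sphere)
  hence "uniform_limit unit_circle (\<lambda>M z. cmod (S M z) * cmod (S M z)) (\<lambda>z. cmod (g z) * cmod (g z)) sequentially"
    by (intro uniform_lim_mult uniform_limit_intros ul)
  hence "(\<lambda>M. circ_mean (\<lambda>z. cmod (S M z) * cmod (S M z))) \<longlonglongrightarrow> circ_mean (\<lambda>z. cmod (g z) * cmod (g z))"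
    by (rule circ_mean_uniform_limit) (intro continuous_intros S_cont)
  hence "(\<lambda>M. \<Sum>n<M. (cmod (c n))\<^sup>2) \<longlonglongrightarrow> circ_sqnorm g"
    using parseval_poly[where a = c] by (simp add: S_def power2_eq_square)
  thus ?thesis using \<rho> unfolding sums_def g_def
    by (simp add: c_def norm_mult norm_power power_mult_distrib power_mult[symmetric] mult.commute)
qed

lemma hardy2_measurable:
  assumes "f holomorphic_on unit_disk" "\<And>z. z \<notin> unit_disk \<Longrightarrow> f z = 0"
  shows "(\<lambda>z. (cmod (f (of_real \<rho> * z)))\<^sup>2) \<in> borel_measurable borel"
proof -
  have "(\<lambda>z. indicator unit_disk z *\<^sub>R f z) \<in> borel_measurable borel"
    by (intro borel_measurable_continuous_on_indicator holomorphic_on_imp_continuous_on assms) auto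
  also have "(\<lambda>z. indicator unit_disk z *\<^sub>R f z) = f"
    using assms(2) by (auto simp: fun_eq_iff indicator_def)
  finally have [measurable]: "f \<in> borel_measurable borel" .
  show ?thesis by measurable
qed

lemma hardy2_mean:
  assumes "f holomorphic_on unit_disk" "\<And>z. z \<notin> unit_disk \<Longrightarrow> f z = 0" "0 < \<rho>" "\<rho> < 1"
  shows "(LINT z|circle_measure. (cmod (f (of_real \<rho> * z)))\<^sup>2) = circ_mean (\<lambda>z. (cmod (f (of_real \<rho> * z)))\<^sup>2)"
proof (rule integral_circle_measure[OF hardy2_measurable])
  show "continuous_on unit_circle (\<lambda>z. (cmod (f (of_real \<rho> * z)))\<^sup>2)"
    using assms(3,4)
    by (intro continuous_intros continuous_on_compose2[OF holomorphic_on_imp_continuous_on[OF assms(1)]])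
       (auto simp: norm_mult)
qed (use assms in auto)

text \<open>By Parseval at radius \<open>\<rho>\<close> the means are sums of nonnegative terms: a
  uniform bound passes to each finite sum as \<open>\<rho>\<close> tends to 1, and conversely the
  full sum dominates every mean. This identifies H^2 with the square summable sequences.\<close>

lemma hardy2_iff_summable:
  "f \<in> hardy2 \<longleftrightarrow> f holomorphic_on unit_disk \<and> (\<forall>z. z \<notin> unit_disk \<longrightarrow> f z = 0) \<and>
    summable (\<lambda>n. (cmod (tcoeff f n))\<^sup>2)"
proof (cases "f holomorphic_on unit_disk \<and> (\<forall>z. z \<notin> unit_disk \<longrightarrow> f z = 0)")
  case True
  define I where "I \<rho> = circ_mean (\<lambda>z. (cmod (f (of_real \<rho> * z)))\<^sup>2)" for \<rho>
  have sums: "(\<lambda>n. (cmod (tcoeff f n))\<^sup>2 * \<rho> ^ (2 * n)) sums I \<rho>" if "\<rho> \<in> {0<..<1}" for \<rho>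
    unfolding I_def using True that by (intro parseval_radius) auto
  have "(\<exists>C. \<forall>\<rho>\<in>{0<..<1}. I \<rho> \<le> C) \<longleftrightarrow> summable (\<lambda>n. (cmod (tcoeff f n))\<^sup>2)"
  proof
    assume "\<exists>C. \<forall>\<rho>\<in>{0<..<1}. I \<rho> \<le> C"
    then obtain C where C: "\<And>\<rho>. \<rho> \<in> {0<..<1} \<Longrightarrow> I \<rho> \<le> C" by blast
    have "(\<Sum>n<M. (cmod (tcoeff f n))\<^sup>2) \<le> C" for M
    proof (rule tendsto_upperbound)
      show "((\<lambda>\<rho>. \<Sum>n<M. (cmod (tcoeff f n))\<^sup>2 * \<rho> ^ (2 * n)) \<longlongrightarrow> (\<Sum>n<M. (cmod (tcoeff f n))\<^sup>2)) (at_left (1::real))"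
        by (rule tendsto_eq_intros refl | simp)+
      have "eventually (\<lambda>\<rho>. \<rho> \<in> {0<..<1}) (at_left (1::real))"
        using eventually_between_at_left[of 0 1] by simp
      thus "eventually (\<lambda>\<rho>. (\<Sum>n<M. (cmod (tcoeff f n))\<^sup>2 * \<rho> ^ (2 * n)) \<le> C) (at_left (1::real))"
      proof eventually_elim
        case (elim \<rho>)
        have "(\<Sum>n<M. (cmod (tcoeff f n))\<^sup>2 * \<rho> ^ (2 * n)) \<le> I \<rho>"
          using sums[OF elim] elim by (intro sum_le_suminf[of _ "{..<M}", THEN order_trans]) (auto simp: sums_iff)
        thus ?case using C[OF elim] by simp
      qed
    qed simp
    thus "summable (\<lambda>n. (cmod (tcoeff f n))\<^sup>2)"
      by (intro summableI_nonneg_bounded[of _ C]) auto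
  next
    assume summ: "summable (\<lambda>n. (cmod (tcoeff f n))\<^sup>2)"
    have "I \<rho> \<le> (\<Sum>n. (cmod (tcoeff f n))\<^sup>2)" if "\<rho> \<in> {0<..<1}" for \<rho>
    proof -
      have "(cmod (tcoeff f n))\<^sup>2 * \<rho> ^ (2 * n) \<le> (cmod (tcoeff f n))\<^sup>2" for n
        using that by (intro mult_left_le power_le_one) auto
      thus ?thesis using sums[OF that] summ by (intro sums_le[OF _ sums[OF that] summable_sums]) auto
    qed
    thus "\<exists>C. \<forall>\<rho>\<in>{0<..<1}. I \<rho> \<le> C" by blast
  qed
  moreover have "(LINT z|circle_measure. (cmod (f (of_real \<rho> * z)))\<^sup>2) = I \<rho>" if "\<rho> \<in> {0<..<1}" for \<rho>
    unfolding I_def using True that by (intro hardy2_mean) auto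
  ultimately show ?thesis using True by (simp add: hardy2_def)
next
  case False
  thus ?thesis by (auto simp: hardy2_def)
qed

text \<open>Defined on coefficients instead of boundary values, so that completeness and the
  reproducing property are statements about sequences.\<close>

definition hardy2_ip :: "(complex \<Rightarrow> complex) \<Rightarrow> (complex \<Rightarrow> complex) \<Rightarrow> complex" where
  "hardy2_ip f g = (\<Sum>n. tcoeff f n * cnj (tcoeff g n))"

definition hardy_series :: "(nat \<Rightarrow> complex) \<Rightarrow> complex \<Rightarrow> complex" where
  "hardy_series a z = (if cmod z < 1 then \<Sum>n. a n * z ^ n else 0)"

lemma square_summable_add:
  assumes "summable (\<lambda>n. (cmod (a n))\<^sup>2)" "summable (\<lambda>n. (cmod (b n))\<^sup>2)"
  shows "summable (\<lambda>n. (cmod (a n + b n))\<^sup>2)"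
proof (rule summable_comparison_test')
  show "summable (\<lambda>n. 2 * (cmod (a n))\<^sup>2 + 2 * (cmod (b n))\<^sup>2)"
    using assms by (intro summable_add summable_mult)
  show "norm ((cmod (a n + b n))\<^sup>2) \<le> 2 * (cmod (a n))\<^sup>2 + 2 * (cmod (b n))\<^sup>2" for n
  proof -
    have "(cmod (a n + b n))\<^sup>2 \<le> (cmod (a n) + cmod (b n))\<^sup>2"
      by (intro power_mono norm_triangle_ineq) auto
    also have "\<dots> \<le> 2 * (cmod (a n))\<^sup>2 + 2 * (cmod (b n))\<^sup>2"
      using zero_le_power2[of "cmod (a n) - cmod (b n)"] by (simp add: power2_eq_square algebra_simps)
    finally show ?thesis by simp
  qed
qed

lemma square_summable_mult:
  assumes "summable (\<lambda>n. (cmod (a n))\<^sup>2)" "summable (\<lambda>n. (cmod (b n))\<^sup>2)"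
  shows "summable (\<lambda>n. a n * b n)"
proof (rule summable_comparison_test')
  show "summable (\<lambda>n. (cmod (a n))\<^sup>2 + (cmod (b n))\<^sup>2)"
    using assms by (intro summable_add)
  show "norm (a n * b n) \<le> (cmod (a n))\<^sup>2 + (cmod (b n))\<^sup>2" for n
    using sum_squares_bound[of "cmod (a n)" "cmod (b n)"]
      mult_nonneg_nonneg[OF norm_ge_zero[of "a n"] norm_ge_zero[of "b n"]]
    unfolding norm_mult real_norm_def mult.assoc by linarith
qed

lemma square_summable_power:
  assumes "cmod z < 1"
  shows "summable (\<lambda>n. (cmod (z ^ n))\<^sup>2)"
proof -
  have "(cmod z)\<^sup>2 < 1" using assms by (simp add: power_less_one_iff)
  hence "summable (\<lambda>n. ((cmod z)\<^sup>2) ^ n)" by (intro summable_geometric) simp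
  thus ?thesis by (simp add: norm_power power_mult[symmetric] mult.commute)
qed

lemma hardy_series_sums:
  assumes "summable (\<lambda>n. (cmod (a n))\<^sup>2)" "cmod z < 1"
  shows "(\<lambda>n. a n * z ^ n) sums hardy_series a z"
  using square_summable_mult[OF assms(1) square_summable_power[OF assms(2)]] assms(2)
  by (simp add: hardy_series_def summable_sums)

lemma tcoeff_hardy_series: "summable (\<lambda>n. (cmod (a n))\<^sup>2) \<Longrightarrow> tcoeff (hardy_series a) = a"
  by (rule tcoeff_unique(1)) (rule hardy_series_sums)

lemma hardy_series_in:
  assumes "summable (\<lambda>n. (cmod (a n))\<^sup>2)"
  shows "hardy_series a \<in> hardy2"
proof -
  have "hardy_series a holomorphic_on unit_disk"
    by (rule tcoeff_unique(2)) (rule hardy_series_sums[OF assms])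
  thus ?thesis unfolding hardy2_iff_summable
    using assms by (simp add: tcoeff_hardy_series) (simp add: hardy_series_def)
qed

lemma hardy2_holo: "f \<in> hardy2 \<Longrightarrow> f holomorphic_on unit_disk"
  and hardy2_off: "f \<in> hardy2 \<Longrightarrow> z \<notin> unit_disk \<Longrightarrow> f z = 0"
  and hardy2_summable: "f \<in> hardy2 \<Longrightarrow> summable (\<lambda>n. (cmod (tcoeff f n))\<^sup>2)"
  unfolding hardy2_iff_summable by blast+

lemma hardy2_sums: "f \<in> hardy2 \<Longrightarrow> cmod z < 1 \<Longrightarrow> (\<lambda>n. tcoeff f n * z ^ n) sums f z"
  using tcoeff_sums hardy2_holo by blast

lemma hardy2_eqI:
  assumes "f \<in> hardy2" "g \<in> hardy2" "tcoeff f = tcoeff g"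
  shows "f = g"
proof
  fix z show "f z = g z"
    using hardy2_sums[OF assms(1), of z] hardy2_sums[OF assms(2), of z] hardy2_off[OF assms(1), of z]
      hardy2_off[OF assms(2), of z] assms(3) sums_unique2
    by (cases "cmod z < 1") auto
qed

lemma tcoeff_add: "f \<in> hardy2 \<Longrightarrow> g \<in> hardy2 \<Longrightarrow> tcoeff (f + g) n = tcoeff f n + tcoeff g n"
  using higher_deriv_add[of f unit_disk g 0 n] hardy2_holo
  by (simp add: tcoeff_def add_divide_distrib plus_fun_def)

lemma tcoeff_scale: "f \<in> hardy2 \<Longrightarrow> tcoeff (fun_scale c f) n = c * tcoeff f n"
  using higher_deriv_cmult[of f unit_disk 0 n c] hardy2_holo
  by (simp add: tcoeff_def fun_scale_def)

lemma hardy2_add: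
  assumes "f \<in> hardy2" "g \<in> hardy2"
  shows "f + g \<in> hardy2"
  unfolding hardy2_iff_summable[of "f + g"]
proof (intro conjI allI impI)
  show "f + g holomorphic_on unit_disk"
    unfolding plus_fun_def using assms by (intro holomorphic_intros hardy2_holo)
  show "(f + g) z = 0" if "z \<notin> unit_disk" for z
    using hardy2_off[OF assms(1) that] hardy2_off[OF assms(2) that] by simp
  show "summable (\<lambda>n. (cmod (tcoeff (f + g) n))\<^sup>2)"
    using square_summable_add[OF hardy2_summable hardy2_summable, OF assms]
    by (simp add: tcoeff_add assms)
qed

lemma hardy2_scale:
  assumes "f \<in> hardy2"
  shows "fun_scale c f \<in> hardy2"
  unfolding hardy2_iff_summable[of "fun_scale c f"]
proof (intro conjI allI impI)
  show "fun_scale c f holomorphic_on unit_disk"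
    unfolding fun_scale_def using assms by (intro holomorphic_intros hardy2_holo)
  show "fun_scale c f z = 0" if "z \<notin> unit_disk" for z
    using hardy2_off[OF assms that] by (simp add: fun_scale_def)
  show "summable (\<lambda>n. (cmod (tcoeff (fun_scale c f) n))\<^sup>2)"
    using summable_mult[OF hardy2_summable[OF assms], of "(cmod c)\<^sup>2"]
    by (simp add: tcoeff_scale assms norm_mult power_mult_distrib)
qed

lemma hardy2_subspace: "fspace.subspace hardy2"
proof (rule fspace.subspaceI)
  have "hardy_series (\<lambda>_. 0) \<in> hardy2" by (rule hardy_series_in) simp
  moreover have "hardy_series (\<lambda>_. 0) = 0" by (auto simp: hardy_series_def fun_eq_iff)
  ultimately show "0 \<in> hardy2" by simp
qed (auto intro: hardy2_add hardy2_scale)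

lemma tcoeff_diff: "f \<in> hardy2 \<Longrightarrow> g \<in> hardy2 \<Longrightarrow> tcoeff (f - g) n = tcoeff f n - tcoeff g n"
  using higher_deriv_diff[of f unit_disk g 0 n] hardy2_holo
  by (simp add: tcoeff_def diff_divide_distrib fun_diff_def)

lemma hardy2_ip_sums:
  assumes "f \<in> hardy2" "g \<in> hardy2"
  shows "(\<lambda>n. tcoeff f n * cnj (tcoeff g n)) sums hardy2_ip f g"
  unfolding hardy2_ip_def using assms
  by (intro summable_sums square_summable_mult) (auto simp: hardy2_summable)

lemma hardy2_norm_sums:
  assumes "f \<in> hardy2"
  shows "(\<lambda>n. (cmod (tcoeff f n))\<^sup>2) sums Re (hardy2_ip f f)"
  using sums_Re[OF hardy2_ip_sums[OF assms assms]] unfolding cmod_power2 by (simp add: power2_eq_square)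

lemma hardy2_coeff_le:
  assumes "f \<in> hardy2"
  shows "(cmod (tcoeff f n))\<^sup>2 \<le> Re (hardy2_ip f f)"
  using hardy2_norm_sums[OF assms] sum_le_suminf[of "\<lambda>n. (cmod (tcoeff f n))\<^sup>2" "{n}"]
  by (auto simp: sums_iff)

text \<open>Completeness of the square summable sequences: the coefficients converge one by one, and
  the Cauchy bound survives the limit on every finite partial sum.\<close>

lemma hardy2_complete:
  fixes F :: "nat \<Rightarrow> complex \<Rightarrow> complex"
  assumes F: "\<And>n. F n \<in> hardy2"
    and cauchy: "\<And>e. e > 0 \<Longrightarrow> \<exists>N. \<forall>m\<ge>N. \<forall>n\<ge>N. sqrt (Re (hardy2_ip (F m - F n) (F m - F n))) < e"
  shows "\<exists>f\<in>hardy2. (\<lambda>n. sqrt (Re (hardy2_ip (F n - f) (F n - f)))) \<longlonglongrightarrow> 0"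
proof -
  define N where "N f = Re (hardy2_ip f f)" for f
  have d: "F m - F n \<in> hardy2" for m n
    using F fspace.subspace_diff[OF hardy2_subspace] by blast
  have N_nn: "N f \<ge> 0" if "f \<in> hardy2" for f
    using hardy2_coeff_le[OF that, of 0] unfolding N_def by (meson order_trans zero_le_power2)
  have "Cauchy (\<lambda>m. tcoeff (F m) k)" for k
  proof (rule metric_CauchyI)
    fix e :: real assume "e > 0"
    from cauchy[OF this] obtain M where M: "\<And>m n. m \<ge> M \<Longrightarrow> n \<ge> M \<Longrightarrow> sqrt (N (F m - F n)) < e"
      unfolding N_def by blast
    have "dist (tcoeff (F m) k) (tcoeff (F n) k) < e" if "m \<ge> M" "n \<ge> M" for m n
    proof -
      have "cmod (tcoeff (F m - F n) k) \<le> sqrt (N (F m - F n))"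
        using hardy2_coeff_le[OF d, of m n k] unfolding N_def by (intro real_le_rsqrt)
      thus ?thesis using M[OF that] by (simp add: tcoeff_diff F dist_norm)
    qed
    thus "\<exists>M. \<forall>m\<ge>M. \<forall>n\<ge>M. dist (tcoeff (F m) k) (tcoeff (F n) k) < e" by blast
  qed
  hence "\<exists>l. (\<lambda>m. tcoeff (F m) k) \<longlonglongrightarrow> l" for k using Cauchy_convergent convergent_def by blast
  then obtain a where a: "\<And>k. (\<lambda>m. tcoeff (F m) k) \<longlonglongrightarrow> a k" by metis
  \<comment> \<open>For a fixed number \<open>K\<close> of terms \<open>n\<close> tends to infinity,
    and only then \<open>K\<close> does.\<close>
  have tail: "summable (\<lambda>k. (cmod (tcoeff (F m) k - a k))\<^sup>2) \<and> (\<Sum>k. (cmod (tcoeff (F m) k - a k))\<^sup>2) \<le> e\<^sup>2"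
    if e: "e > 0" and M: "\<And>m n. m \<ge> M \<Longrightarrow> n \<ge> M \<Longrightarrow> sqrt (N (F m - F n)) < e" and m: "m \<ge> M" for e M m
  proof -
    have part: "(\<Sum>k<K. (cmod (tcoeff (F m) k - a k))\<^sup>2) \<le> e\<^sup>2" for K
    proof (rule tendsto_upperbound)
      show "(\<lambda>n. \<Sum>k<K. (cmod (tcoeff (F m) k - tcoeff (F n) k))\<^sup>2) \<longlonglongrightarrow> (\<Sum>k<K. (cmod (tcoeff (F m) k - a k))\<^sup>2)"
        by (intro tendsto_intros a)
      have "(\<Sum>k<K. (cmod (tcoeff (F m) k - tcoeff (F n) k))\<^sup>2) \<le> e\<^sup>2" if n: "n \<ge> M" for n
      proof -
        have "(\<Sum>k<K. (cmod (tcoeff (F m - F n) k))\<^sup>2) \<le> N (F m - F n)"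
          using hardy2_norm_sums[OF d, of m n] sum_le_suminf[of "\<lambda>k. (cmod (tcoeff (F m - F n) k))\<^sup>2" "{..<K}"]
          by (auto simp: sums_iff N_def)
        also have "\<dots> \<le> e\<^sup>2"
          using M[OF m n] N_nn[OF d, of m n] e by (metis less_imp_le real_sqrt_le_iff real_sqrt_unique)
        finally show ?thesis by (simp add: tcoeff_diff F)
      qed
      thus "eventually (\<lambda>n. (\<Sum>k<K. (cmod (tcoeff (F m) k - tcoeff (F n) k))\<^sup>2) \<le> e\<^sup>2) sequentially"
        using eventually_sequentially by blast
    qed simp
    have summ: "summable (\<lambda>k. (cmod (tcoeff (F m) k - a k))\<^sup>2)"
      by (rule summableI_nonneg_bounded[of _ "e\<^sup>2"]) (use part in auto)
    thus ?thesis using suminf_le_const[OF summ part] by blast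
  qed
  obtain M1 where M1: "\<And>m n. m \<ge> M1 \<Longrightarrow> n \<ge> M1 \<Longrightarrow> sqrt (N (F m - F n)) < 1"
    using cauchy[of 1] unfolding N_def by auto
  \<comment> \<open>The case e = 1 of \<open>tail\<close>: the limit sequence differs from a square
    summable one by a square summable one.\<close>
  have "summable (\<lambda>k. (cmod (a k - tcoeff (F M1) k))\<^sup>2)"
    using tail[OF zero_less_one M1 order_refl] by (simp add: norm_minus_commute)
  from square_summable_add[OF hardy2_summable[OF F[of M1]] this]
  have a_summ: "summable (\<lambda>k. (cmod (a k))\<^sup>2)" by simp
  define f where "f = hardy_series a"
  have f: "f \<in> hardy2" "tcoeff f = a"
    unfolding f_def using a_summ by (auto intro: hardy_series_in tcoeff_hardy_series)
  have df: "F m - f \<in> hardy2" for m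
    using F f fspace.subspace_diff[OF hardy2_subspace] by blast
  have N_eq: "N (F m - f) = (\<Sum>k. (cmod (tcoeff (F m) k - a k))\<^sup>2)" for m
    using hardy2_norm_sums[OF df, of m] by (simp add: N_def tcoeff_diff F f sums_iff)
  have "(\<lambda>n. sqrt (N (F n - f))) \<longlonglongrightarrow> 0"
  proof (rule LIMSEQ_I)
    fix e :: real assume e: "e > 0"
    hence "e / 2 > 0" by simp
    from cauchy[OF this] obtain M where M: "\<And>m n. m \<ge> M \<Longrightarrow> n \<ge> M \<Longrightarrow> sqrt (N (F m - F n)) < e / 2"
      unfolding N_def by blast
    have "norm (sqrt (N (F n - f)) - 0) < e" if n: "n \<ge> M" for n
    proof -
      have "N (F n - f) \<le> (e / 2)\<^sup>2" unfolding N_eq using tail[OF \<open>e / 2 > 0\<close> M n] by blast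
      hence "sqrt (N (F n - f)) \<le> e / 2" using e by (intro real_le_lsqrt) auto
      thus ?thesis using e N_nn[OF df, of n] by simp
    qed
    thus "\<exists>M. \<forall>n\<ge>M. norm (sqrt (N (F n - f)) - 0) < e" by blast
  qed
  thus ?thesis using f unfolding N_def by blast
qed

lemma extend_szego_series:
  assumes "cmod w < 1"
  shows "extend_by_zero unit_disk (szego w) = hardy_series (\<lambda>n. cnj w ^ n)"
proof
  fix z
  show "extend_by_zero unit_disk (szego w) z = hardy_series (\<lambda>n. cnj w ^ n) z"
  proof (cases "cmod z < 1")
    case True
    hence "cmod (cnj w * z) < 1" using assms mult_strict_mono'[of "cmod w" 1 "cmod z" 1]
      by (simp add: norm_mult)
    from suminf_geometric[OF this] show ?thesis using True
      by (simp add: extend_by_zero_def szego_def hardy_series_def power_mult_distrib)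
  qed (auto simp: extend_by_zero_def hardy_series_def)
qed

theorem hardy2_rkhs: "rkhs unit_disk szego hardy2 hardy2_ip"
proof
  fix f g h :: "complex \<Rightarrow> complex" and c x :: complex
  show "f x = 0" if "f \<in> hardy2" "x \<notin> unit_disk" using that hardy2_off by blast
  show "fspace.subspace hardy2" by (rule hardy2_subspace)
  show "hardy2_ip (f + g) h = hardy2_ip f h + hardy2_ip g h" if "f \<in> hardy2" "g \<in> hardy2" "h \<in> hardy2"
  proof -
    have "(\<lambda>n. tcoeff (f + g) n * cnj (tcoeff h n)) sums (hardy2_ip f h + hardy2_ip g h)"
      using sums_add[OF hardy2_ip_sums[OF that(1,3)] hardy2_ip_sums[OF that(2,3)]] that
      by (simp add: tcoeff_add ring_distribs)
    thus ?thesis using hardy2_ip_sums[OF hardy2_add[OF that(1,2)] that(3)] sums_unique2 by blast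
  qed
  show "hardy2_ip (fun_scale c f) g = c * hardy2_ip f g" if "f \<in> hardy2" "g \<in> hardy2"
  proof -
    have "(\<lambda>n. tcoeff (fun_scale c f) n * cnj (tcoeff g n)) sums (c * hardy2_ip f g)"
      using sums_mult[OF hardy2_ip_sums[OF that], of c] that by (simp add: tcoeff_scale mult.assoc)
    thus ?thesis using hardy2_ip_sums[OF hardy2_scale[OF that(1)] that(2)] sums_unique2 by blast
  qed
  show "hardy2_ip g f = cnj (hardy2_ip f g)" if "f \<in> hardy2" "g \<in> hardy2"
  proof -
    have "(\<lambda>n. tcoeff g n * cnj (tcoeff f n)) sums cnj (hardy2_ip f g)"
      using sums_cnj[THEN iffD2, OF hardy2_ip_sums[OF that]] by (simp add: mult.commute)
    thus ?thesis using hardy2_ip_sums[OF that(2,1)] sums_unique2 by blast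
  qed
  show "0 \<le> Re (hardy2_ip f f)" if "f \<in> hardy2"
    using hardy2_coeff_le[OF that, of 0] by (meson order_trans zero_le_power2)
  show "f = 0" if "f \<in> hardy2" "hardy2_ip f f = 0"
  proof (rule hardy2_eqI[OF that(1)])
    show "0 \<in> hardy2" by (rule fspace.subspace_0[OF hardy2_subspace])
    have "(cmod (tcoeff f n))\<^sup>2 \<le> 0" for n using hardy2_coeff_le[OF that(1), of n] that(2) by simp
    moreover have "tcoeff (0 :: complex \<Rightarrow> complex) n = 0" for n
      using tcoeff_scale[OF that(1), of 0] by (simp add: fspace.scale_zero_left)
    ultimately show "tcoeff f = tcoeff 0" by (auto simp: fun_eq_iff)
  qed
  show "extend_by_zero unit_disk (szego x) \<in> hardy2" if "x \<in> unit_disk"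
    using that square_summable_power[of "cnj x"] by (simp add: extend_szego_series hardy_series_in)
  show "hardy2_ip f (extend_by_zero unit_disk (szego x)) = f x" if f: "f \<in> hardy2" and x: "x \<in> unit_disk"
  proof -
    have x1: "cmod x < 1" using x by simp
    have "tcoeff (extend_by_zero unit_disk (szego x)) = (\<lambda>n. cnj x ^ n)"
      using square_summable_power[of "cnj x"] x1 by (simp add: extend_szego_series tcoeff_hardy_series)
    thus ?thesis using hardy2_sums[OF f x1] by (simp add: hardy2_ip_def sums_iff)
  qed
qed (rule hardy2_complete)

interpretation H2: rkhs unit_disk szego hardy2 hardy2_ip
  by (rule hardy2_rkhs)

section \<open>Bounded multipliers and the disk algebra inside H^2\<close>

lemma hardy2_mean_le:
  assumes f: "f \<in> hardy2" and \<rho>: "0 < \<rho>" "\<rho> < 1"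
  shows "circ_mean (\<lambda>z. (cmod (f (of_real \<rho> * z)))\<^sup>2) \<le> Re (hardy2_ip f f)"
proof (rule sums_le[OF _ parseval_radius[OF hardy2_holo[OF f] \<rho>] hardy2_norm_sums[OF f]])
  show "(cmod (tcoeff f n))\<^sup>2 * \<rho> ^ (2 * n) \<le> (cmod (tcoeff f n))\<^sup>2" for n
    using \<rho> by (intro mult_left_le power_le_one) auto
qed

text \<open>Multiplication is pointwise, so here the integral means are the convenient description
  of H^2.\<close>

lemma hardy2_mult_bounded:
  assumes h: "h \<in> hardy2" and e: "e holomorphic_on unit_disk" "\<And>z. z \<in> unit_disk \<Longrightarrow> cmod (e z) \<le> B"
  shows "(\<lambda>z. e z * h z) \<in> hardy2"
proof -
  have holo: "(\<lambda>z. e z * h z) holomorphic_on unit_disk"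
    using e(1) hardy2_holo[OF h] by (intro holomorphic_intros)
  have off: "e z * h z = 0" if "z \<notin> unit_disk" for z using hardy2_off[OF h that] by simp
  have "(LINT z|circle_measure. (cmod (e (of_real \<rho> * z) * h (of_real \<rho> * z)))\<^sup>2) \<le> B\<^sup>2 * Re (hardy2_ip h h)"
    if \<rho>: "\<rho> \<in> {0<..<1}" for \<rho>
  proof -
    have in_disk: "of_real \<rho> * z \<in> unit_disk" if "cmod z = 1" for z :: complex
      using that \<rho> by (simp add: norm_mult)
    have cont: "continuous_on unit_circle (\<lambda>z. g (of_real \<rho> * z))" if "g holomorphic_on unit_disk" for g
      using in_disk
      by (intro continuous_on_compose2[OF holomorphic_on_imp_continuous_on[OF that]] continuous_intros) auto
    have "(LINT z|circle_measure. (cmod (e (of_real \<rho> * z) * h (of_real \<rho> * z)))\<^sup>2) =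
        circ_mean (\<lambda>z. (cmod (e (of_real \<rho> * z) * h (of_real \<rho> * z)))\<^sup>2)"
      using hardy2_mean[OF holo off] \<rho> by simp
    also have "\<dots> \<le> circ_mean (\<lambda>z. B\<^sup>2 * (cmod (h (of_real \<rho> * z)))\<^sup>2)"
    proof (rule circ_mean_mono)
      show "continuous_on unit_circle (\<lambda>z. (cmod (e (of_real \<rho> * z) * h (of_real \<rho> * z)))\<^sup>2)"
        by (intro continuous_intros cont[OF e(1)] cont[OF hardy2_holo[OF h]])
      show "continuous_on unit_circle (\<lambda>z. B\<^sup>2 * (cmod (h (of_real \<rho> * z)))\<^sup>2)"
        by (intro continuous_intros cont[OF hardy2_holo[OF h]])
      show "(cmod (e (of_real \<rho> * z) * h (of_real \<rho> * z)))\<^sup>2 \<le> B\<^sup>2 * (cmod (h (of_real \<rho> * z)))\<^sup>2" if "cmod z = 1" for z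
        unfolding norm_mult power_mult_distrib
        using e(2)[OF in_disk[OF that]] by (intro mult_right_mono power_mono) auto
    qed
    also have "\<dots> \<le> B\<^sup>2 * Re (hardy2_ip h h)"
      unfolding circ_mean_mult_left using hardy2_mean_le[OF h] \<rho> by (intro mult_left_mono) auto
    finally show ?thesis .
  qed
  thus ?thesis using holo off unfolding hardy2_def by blast
qed

lemma disk_algebra_hardy2:
  assumes F: "F \<in> disk_algebra"
  shows "extend_by_zero unit_disk F \<in> hardy2"
proof -
  obtain B where B: "\<And>z. cmod z \<le> 1 \<Longrightarrow> cmod (F z) \<le> B"
    using disk_algebra_bounded[OF F] by blast
  \<comment> \<open>\<open>szego 0\<close> is the constant 1, here as an element of H^2 to be
    multiplied by \<open>F\<close>.\<close>
  have "(\<lambda>z. F z * extend_by_zero unit_disk (szego 0) z) \<in> hardy2"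
    by (rule hardy2_mult_bounded[OF H2.kernel_in, of 0 F B]) (use F B in \<open>auto simp: disk_algebra_def\<close>)
  also have "(\<lambda>z. F z * extend_by_zero unit_disk (szego 0) z) = extend_by_zero unit_disk F"
    by (auto simp: extend_by_zero_def szego_def fun_eq_iff)
  finally show ?thesis .
qed

text \<open>The means at radii below 1 are bounded by the H^2 norm, and they converge to the
  boundary mean because \<open>F\<close> is uniformly continuous on the closed disk.\<close>

lemma disk_algebra_mean_le:
  assumes F: "F \<in> disk_algebra"
  shows "circ_sqnorm F \<le>
    Re (hardy2_ip (extend_by_zero unit_disk F) (extend_by_zero unit_disk F))"
proof -
  \<comment> \<open>The offset 2 keeps also the first radius positive.\<close>
  define \<rho> where "\<rho> n = 1 - 1 / real (n + 2)" for n
  have \<rho>: "0 < \<rho> n" "\<rho> n < 1" for n by (auto simp: \<rho>_def)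
  have \<rho>_lim: "\<rho> \<longlonglongrightarrow> 1"
    unfolding \<rho>_def using tendsto_diff[OF tendsto_const LIMSEQ_ignore_initial_segment[OF lim_1_over_n, of 2], of "1 :: real"]
    by simp
  have F_cont: "continuous_on (cball 0 1) F" using F by (simp add: disk_algebra_def)
  hence "uniformly_continuous_on (cball 0 1) (\<lambda>z. (cmod (F z))\<^sup>2)"
    by (intro compact_uniformly_continuous continuous_intros) auto
  note uc = this[unfolded uniformly_continuous_on_def, rule_format]
  have ul: "uniform_limit unit_circle (\<lambda>n z. (cmod (F (of_real (\<rho> n) * z)))\<^sup>2) (\<lambda>z. (cmod (F z))\<^sup>2) sequentially"
  proof (rule uniform_limitI)
    fix e :: real assume "e > 0"
    then obtain d where d: "d > 0" "\<And>x x'. x \<in> cball 0 1 \<Longrightarrow> x' \<in> cball 0 1 \<Longrightarrow> dist x' x < d \<Longrightarrow>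
        dist ((cmod (F x'))\<^sup>2) ((cmod (F x))\<^sup>2) < e"
      using uc by metis
    have "eventually (\<lambda>n. dist (\<rho> n) 1 < d) sequentially" using \<rho>_lim d(1) by (rule tendstoD)
    thus "eventually (\<lambda>n. \<forall>z\<in>unit_circle. dist ((cmod (F (of_real (\<rho> n) * z)))\<^sup>2) ((cmod (F z))\<^sup>2) < e) sequentially"
    proof eventually_elim
      case (elim n)
      show ?case
      proof
        fix z :: complex assume z: "z \<in> unit_circle"
        have "dist (of_real (\<rho> n) * z) z = cmod ((of_real (\<rho> n) - 1) * z)" by (simp add: dist_norm algebra_simps)
        also have "\<dots> = cmod (of_real (\<rho> n - 1))" using z by (simp add: norm_mult)
        also have "\<dots> = dist (\<rho> n) 1" by (simp only: norm_of_real dist_real_def)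
        finally show "dist ((cmod (F (of_real (\<rho> n) * z)))\<^sup>2) ((cmod (F z))\<^sup>2) < e"
          using elim z \<rho>[of n] by (intro d(2)) (auto simp: norm_mult)
      qed
    qed
  qed
  have cont: "continuous_on unit_circle (\<lambda>z. (cmod (F (of_real (\<rho> n) * z)))\<^sup>2)" for n
    using \<rho>[of n] by (intro continuous_intros continuous_on_compose2[OF F_cont]) (auto simp: norm_mult)
  have "circ_mean (\<lambda>z. (cmod (F (of_real (\<rho> n) * z)))\<^sup>2) \<le>
    Re (hardy2_ip (extend_by_zero unit_disk F) (extend_by_zero unit_disk F))" for n
  proof -
    have "circ_mean (\<lambda>z. (cmod (F (of_real (\<rho> n) * z)))\<^sup>2) =
        circ_mean (\<lambda>z. (cmod (extend_by_zero unit_disk F (of_real (\<rho> n) * z)))\<^sup>2)"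
      by (rule circ_mean_cong) (use \<rho>[of n] in \<open>auto simp: extend_by_zero_def norm_mult\<close>)
    thus ?thesis using hardy2_mean_le[OF disk_algebra_hardy2[OF F] \<rho>] by simp
  qed
  thus ?thesis by (intro LIMSEQ_le_const2[OF circ_mean_uniform_limit[OF ul cont]]) auto
qed

subsection \<open>The space as a range of a co-analytic Toeplitz operator\<close>

lemma szego_comb_append: "szego_comb (xs @ ys) z = szego_comb xs z + szego_comb ys z"
  by (simp add: szego_comb_def)

lemma szego_comb_scale: "szego_comb (map (\<lambda>(c, x). (d * c, x)) xs) z = d * szego_comb xs z"
  by (induction xs) (auto simp: szego_comb_def algebra_simps)

lemma hardy2_norm_szego_comb:
  assumes ys: "snd ` set ys \<subseteq> unit_disk"
  shows "Re (hardy2_ip (kernel_comb unit_disk szego ys) (kernel_comb unit_disk szego ys)) =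
    circ_sqnorm (szego_comb ys)"
proof -
  have g: "szego_comb ys \<in> disk_algebra" by (rule szego_comb_disk_algebra[OF ys])
  have "(\<Sum>(c, x)\<leftarrow>ys. cnj c * kernel_comb unit_disk szego ys x) = (\<Sum>(c, x)\<leftarrow>ys. cnj c * szego_comb ys x)"
    using ys by (intro arg_cong[of _ _ sum_list] map_cong) (auto simp: kernel_comb_apply szego_comb_def)
  also have "\<dots> = circ_mean (\<lambda>z. szego_comb ys z * cnj (szego_comb ys z))"
    by (rule circ_mean_szego_comb[OF g ys, symmetric])
  finally have "Re (hardy2_ip (kernel_comb unit_disk szego ys) (kernel_comb unit_disk szego ys)) =
      Re (circ_mean (\<lambda>z. szego_comb ys z * cnj (szego_comb ys z)))"
    using H2.sqn_kernel_comb[OF ys] by simp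
  also have "\<dots> = circ_mean (\<lambda>z. Re (szego_comb ys z * cnj (szego_comb ys z)))"
    using disk_algebra_continuous[OF g] by (intro circ_mean_Re[symmetric] continuous_intros)
  also have "\<dots> = circ_sqnorm (szego_comb ys)"
    unfolding cmod_power2 by (simp add: power2_eq_square)
  finally show ?thesis .
qed

lemma infinite_unit_circle: "infinite unit_circle"
proof
  assume "finite unit_circle"
  moreover have "connected unit_circle" by (rule connected_sphere) simp
  ultimately have "unit_circle = {} \<or> (\<exists>x. unit_circle = {x})" using connected_finite_iff_sing by blast
  moreover have "1 \<in> unit_circle" "-1 \<in> unit_circle" by auto
  moreover have "(1 :: complex) \<noteq> -1" by simp
  ultimately show False by (metis empty_iff singletonD)
qed

text \<open>The \<open>k\<close>-th power of the backward shift, that is, the adjoint of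
  multiplication by z^k on H^2.\<close>

definition shift_coeff :: "nat \<Rightarrow> (complex \<Rightarrow> complex) \<Rightarrow> complex \<Rightarrow> complex" where
  "shift_coeff k h = hardy_series (\<lambda>n. tcoeff h (n + k))"

lemma shift_coeff_summable: "h \<in> hardy2 \<Longrightarrow> summable (\<lambda>n. (cmod (tcoeff h (n + k)))\<^sup>2)"
  using summable_ignore_initial_segment[OF hardy2_summable] by blast

lemma power_shift_coeff:
  assumes h: "h \<in> hardy2" and z: "cmod z < 1"
  shows "z ^ k * shift_coeff k h z = h z - (\<Sum>n<k. tcoeff h n * z ^ n)"
proof -
  have "(\<lambda>n. tcoeff h (n + k) * z ^ n) sums shift_coeff k h z"
    unfolding shift_coeff_def by (rule hardy_series_sums[OF shift_coeff_summable[OF h] z])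
  from sums_mult[OF this, of "z ^ k"]
  have "(\<lambda>n. tcoeff h (n + k) * z ^ (n + k)) sums (z ^ k * shift_coeff k h z)"
    by (simp add: power_add mult_ac)
  moreover have "(\<lambda>n. tcoeff h (n + k) * z ^ (n + k)) sums (h z - (\<Sum>n<k. tcoeff h n * z ^ n))"
    by (rule sums_split_initial_segment[OF hardy2_sums[OF h z]])
  ultimately show ?thesis by (rule sums_unique2)
qed

text \<open>Multiplying the kernel by w^k shifts its coefficients up by \<open>k\<close>; in the
  pairing this shifts those of \<open>h\<close> down.\<close>

lemma ip_power_szego:
  assumes h: "h \<in> hardy2" and z: "cmod z < 1"
  shows "hardy2_ip h (extend_by_zero unit_disk (\<lambda>w. w ^ k * szego z w)) = shift_coeff k h z"
proof -
  define a where "a n = (if k \<le> n then cnj z ^ (n - k) else 0)" for n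
  let ?F = "extend_by_zero unit_disk (\<lambda>w. w ^ k * szego z w)"
  have cz: "cmod (cnj z) < 1" using z by simp
  have "(\<lambda>n. a n * w ^ n) sums ?F w" if w: "cmod w < 1" for w
  proof -
    have sz: "extend_by_zero unit_disk (szego z) w = szego z w" using w by (simp add: extend_by_zero_def)
    have "(\<lambda>n. cnj z ^ n * w ^ n) sums szego z w"
      using hardy_series_sums[OF square_summable_power[OF cz] w] unfolding extend_szego_series[OF z, symmetric] sz .
    from sums_mult[OF this, of "w ^ k"]
    have "(\<lambda>n. a (n + k) * w ^ (n + k)) sums ?F w"
      using w by (simp add: a_def extend_by_zero_def power_add mult_ac)
    moreover have "(\<Sum>n<k. a n * w ^ n) = 0" by (simp add: a_def)
    ultimately show ?thesis using sums_iff_shift[of "\<lambda>n. a n * w ^ n" k "?F w"] by simp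
  qed
  hence coeff: "tcoeff ?F = a" by (rule tcoeff_unique(1))
  have alg: "(\<lambda>w. w ^ k * szego z w) \<in> disk_algebra"
    using disk_algebra_mult[OF disk_algebra_poly[of "monom 1 k"] szego_disk_algebra[OF z]]
    by (simp add: poly_monom)
  have "(\<lambda>n. tcoeff h n * cnj (a n)) sums hardy2_ip h ?F"
    using hardy2_ip_sums[OF h disk_algebra_hardy2[OF alg]] unfolding coeff .
  moreover have "(\<Sum>n<k. tcoeff h n * cnj (a n)) = 0" by (simp add: a_def)
  ultimately have "(\<lambda>n. tcoeff h (n + k) * cnj (a (n + k))) sums hardy2_ip h ?F"
    using sums_iff_shift[of "\<lambda>n. tcoeff h n * cnj (a n)" k "hardy2_ip h ?F"] by simp
  hence "(\<lambda>n. tcoeff h (n + k) * z ^ n) sums hardy2_ip h ?F" by (simp add: a_def)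
  moreover have "(\<lambda>n. tcoeff h (n + k) * z ^ n) sums shift_coeff k h z"
    unfolding shift_coeff_def by (rule hardy_series_sums[OF shift_coeff_summable[OF h] z])
  ultimately show ?thesis by (rule sums_unique2)
qed

text \<open>The right-hand side is the co-analytic Toeplitz operator with symbol
  \<open>cnj p\<close>, applied to \<open>h\<close> and evaluated at \<open>z\<close>.\<close>

lemma ip_poly_szego:
  assumes h: "h \<in> hardy2" and z: "cmod z < 1"
  shows "hardy2_ip h (extend_by_zero unit_disk (\<lambda>w. poly p w * szego z w)) =
    (\<Sum>k\<le>degree p. cnj (coeff p k) * shift_coeff k h z)"
proof -
  let ?e = "\<lambda>k. extend_by_zero unit_disk (\<lambda>w. w ^ k * szego z w)"
  have e_in: "?e k \<in> hardy2" for k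
    using disk_algebra_hardy2[OF disk_algebra_mult[OF disk_algebra_poly[of "monom 1 k"] szego_disk_algebra[OF z]]]
    by (simp add: poly_monom)
  \<comment> \<open>Membership is carried through the induction, since the inner product is additive
    only on \<open>hardy2\<close>.\<close>
  have "hardy2_ip h (extend_by_zero unit_disk (\<lambda>w. (\<Sum>k\<in>A. coeff p k * w ^ k) * szego z w)) =
      (\<Sum>k\<in>A. cnj (coeff p k) * shift_coeff k h z) \<and>
      extend_by_zero unit_disk (\<lambda>w. (\<Sum>k\<in>A. coeff p k * w ^ k) * szego z w) \<in> hardy2" if "finite A" for A
    using that
  proof induction
    case empty
    have eq: "extend_by_zero unit_disk (\<lambda>w. (\<Sum>k\<in>{}. coeff p k * w ^ k) * szego z w) = 0"
      by (simp add: extend_by_zero_def fun_eq_iff)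
    show ?case unfolding eq by (subst sum.empty) (rule conjI[OF H2.ip_zero_right[OF h] H2.zero_in])
  next
    case (insert k A)
    have "extend_by_zero unit_disk (\<lambda>w. (\<Sum>k\<in>insert k A. coeff p k * w ^ k) * szego z w) =
        fun_scale (coeff p k) (?e k) + extend_by_zero unit_disk (\<lambda>w. (\<Sum>k\<in>A. coeff p k * w ^ k) * szego z w)"
      using insert.hyps by (auto simp: extend_by_zero_def fun_scale_def fun_eq_iff algebra_simps)
    moreover note IH = insert.IH
    ultimately show ?case using insert.hyps e_in[of k] h ip_power_szego[OF h z, of k]
      by (simp only: sum.insert H2.ip_add_right H2.ip_scale_right H2.scale_in H2.add_in simp_thms)
  qed
  from this[of "{..degree p}"] show ?thesis by (simp add: poly_altdef)
qed

text \<open>What the decomposition uses of the mate. \<open>self_inversive\<close> is how the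
  position of all zeros of \<open>p\<close> on the circle enters.\<close>

locale mate_space = rkhs unit_disk "dBR_kernel b" H ip
  for b :: "complex \<Rightarrow> complex" and H and ip +
  fixes p :: "complex poly" and c0 :: complex and c1 C2 :: real
  assumes p_nz: "\<And>z. z \<in> unit_disk \<Longrightarrow> poly p z \<noteq> 0"
    and self_inversive: "\<And>z. cmod z = 1 \<Longrightarrow> z ^ degree p * cnj (poly p z) = c0 * poly p z"
    and c0_nz: "c0 \<noteq> 0" and c1_pos: "c1 > 0" and C2_nonneg: "C2 \<ge> 0"
    and form_lower: "\<And>xs. snd ` set xs \<subseteq> unit_disk \<Longrightarrow>
      c1 * circ_mean (\<lambda>z. (cmod (poly p z))\<^sup>2 * (cmod (szego_comb xs z))\<^sup>2) \<le>
      dBR_sqnorm ip b xs"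
    and form_upper: "\<And>xs. snd ` set xs \<subseteq> unit_disk \<Longrightarrow>
      dBR_sqnorm ip b xs \<le>
      C2 * circ_mean (\<lambda>z. (cmod (poly p z))\<^sup>2 * (cmod (szego_comb xs z))\<^sup>2)"
begin

abbreviation "N \<equiv> degree p"

text \<open>Testing \<open>p * h\<close> on kernels of H(b) amounts to testing \<open>h\<close> on
  the Toeplitz image, with symbol \<open>cnj p\<close>, of the Szego combination. A Toeplitz image
  is no longer than the product with \<open>p\<close>, which \<open>form_lower\<close>
  controls.\<close>

lemma p_hardy2_in_H:
  assumes h: "h \<in> hardy2"
  shows "(\<lambda>z. poly p z * h z) \<in> H"
proof (rule in_H_if_bounded[where C = "H2.sqn h / c1"])
  show "poly p z * h z = 0" if "z \<notin> unit_disk" for z using hardy2_off[OF h that] by simp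
  show "H2.sqn h / c1 \<ge> 0" using H2.ip_nonneg[OF h] c1_pos by simp
  fix xs :: "(complex \<times> complex) list" assume xs: "snd ` set xs \<subseteq> unit_disk"
  define ys where "ys = toeplitz_adj (poly p) xs"
  have ys: "snd ` set ys \<subseteq> unit_disk" unfolding ys_def toeplitz_adj_points by (rule xs)
  interpret toeplitz_pair "poly p" xs by (intro toeplitz_pair.intro disk_algebra_poly xs)
  have "(\<Sum>(c, x)\<leftarrow>xs. cnj c * (poly p x * h x)) = (\<Sum>(c, x)\<leftarrow>ys. cnj c * h x)"
    by (simp add: ys_def toeplitz_adj_def o_def case_prod_unfold mult_ac)
  hence "(cmod (\<Sum>(c, x)\<leftarrow>xs. cnj c * (poly p x * h x)))\<^sup>2 \<le> H2.sqn h * H2.sqn (kernel_comb unit_disk szego ys)"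
    using H2.kernel_comb_functional_bound[OF h ys] by simp
  also have "H2.sqn (kernel_comb unit_disk szego ys) = circ_sqnorm (szego_comb ys)"
    by (rule hardy2_norm_szego_comb[OF ys])
  also have "H2.sqn h * circ_sqnorm (szego_comb ys) \<le>
      H2.sqn h * (sqn (kernel_comb unit_disk (dBR_kernel b) xs) / c1)"
  proof (rule mult_left_mono[OF _ H2.ip_nonneg[OF h]])
    have "circ_sqnorm (szego_comb ys) \<le>
        circ_mean (\<lambda>z. (cmod (poly p z))\<^sup>2 * (cmod (szego_comb xs z))\<^sup>2)"
      unfolding ys_def by (rule toeplitz_adj_le)
    also have "\<dots> \<le> sqn (kernel_comb unit_disk (dBR_kernel b) xs) / c1"
      using form_lower[OF xs] c1_pos by (simp add: field_simps)
    finally show "circ_sqnorm (szego_comb ys) \<le> sqn (kernel_comb unit_disk (dBR_kernel b) xs) / c1" .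
  qed
  finally show "(cmod (\<Sum>(c, x)\<leftarrow>xs. cnj c * (poly p x * h x)))\<^sup>2 \<le>
      H2.sqn h / c1 * sqn (kernel_comb unit_disk (dBR_kernel b) xs)" by simp
qed

text \<open>By \<open>form_upper\<close> the values of \<open>f\<close> on kernels form a functional
  bounded by the H^2 norm of p times the Szego combination, and Riesz in H^2 yields
  \<open>h\<close>. The norm bound is kept for the continuity of the boundary functionals.\<close>

lemma toeplitz_representation:
  assumes f: "f \<in> H"
  obtains h where "h \<in> hardy2" "H2.sqn h \<le> C2 * sqn f"
    "\<And>z. cmod z < 1 \<Longrightarrow> f z = (\<Sum>k\<le>N. cnj (coeff p k) * shift_coeff k h z)"
proof -
  define D where "D = {xs :: (complex \<times> complex) list. snd ` set xs \<subseteq> unit_disk}"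
  define E where "E xs = extend_by_zero unit_disk (\<lambda>z. poly p z * szego_comb xs z)" for xs
  define \<phi> where "\<phi> xs = (\<Sum>(c, x)\<leftarrow>xs. c * cnj (f x))" for xs
  have cnj_\<phi>: "\<phi> xs = cnj (\<Sum>(c, x)\<leftarrow>xs. cnj c * f x)" for xs
    unfolding \<phi>_def by (induction xs) auto
  have alg: "(\<lambda>z. poly p z * szego_comb xs z) \<in> disk_algebra" if "xs \<in> D" for xs
    using that by (intro disk_algebra_mult disk_algebra_poly szego_comb_disk_algebra) (simp add: D_def)
  have E_in: "E xs \<in> hardy2" if "xs \<in> D" for xs
    unfolding E_def by (rule disk_algebra_hardy2[OF alg[OF that]])
  have pos: "0 \<le> sqn f" by (rule ip_nonneg[OF f])
  have "\<exists>h\<in>hardy2. H2.sqn h \<le> C2 * sqn f \<and> (\<forall>xs\<in>D. hardy2_ip (E xs) h = \<phi> xs)"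
  proof (rule H2.riesz[where pl = "(@)" and sc = "\<lambda>d. map (\<lambda>(c, x). (d * c, x))"])
    show "D \<noteq> {}" by (auto simp: D_def intro!: exI[of _ "[]"])
    show "0 \<le> C2 * sqn f" using pos C2_nonneg by simp
    show "E xs \<in> hardy2" if "xs \<in> D" for xs by (rule E_in[OF that])
    show "(cmod (\<phi> xs))\<^sup>2 \<le> C2 * sqn f * H2.sqn (E xs)" if xs: "xs \<in> D" for xs
    proof -
      have xs': "snd ` set xs \<subseteq> unit_disk" using xs by (simp add: D_def)
      have "(cmod (\<phi> xs))\<^sup>2 \<le> sqn f * sqn (kernel_comb unit_disk (dBR_kernel b) xs)"
        unfolding cnj_\<phi> complex_mod_cnj by (rule kernel_comb_functional_bound[OF f xs'])
      also have "\<dots> \<le> sqn f * (C2 * circ_mean (\<lambda>z. (cmod (poly p z * szego_comb xs z))\<^sup>2))"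
        using form_upper[OF xs'] pos by (intro mult_left_mono) (simp_all add: norm_mult power_mult_distrib)
      also have "\<dots> \<le> sqn f * (C2 * H2.sqn (E xs))"
        unfolding E_def using pos C2_nonneg by (intro mult_left_mono disk_algebra_mean_le alg xs)
      finally show ?thesis by (simp add: mult_ac)
    qed
    show "E (map (\<lambda>(c, x). (d * c, x)) xs) = fun_scale d (E xs)" for d xs
      by (auto simp: E_def szego_comb_scale extend_by_zero_def fun_scale_def fun_eq_iff)
    show "E (xs @ ys) = E xs + E ys" for xs ys
      by (auto simp: E_def szego_comb_append extend_by_zero_def fun_eq_iff algebra_simps)
    show "\<phi> (map (\<lambda>(c, x). (d * c, x)) xs) = d * \<phi> xs" for d xs
      by (induction xs) (auto simp: \<phi>_def algebra_simps)
  qed (auto simp: D_def \<phi>_def)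
  then obtain h where h: "h \<in> hardy2" "H2.sqn h \<le> C2 * sqn f" and rep: "\<forall>xs\<in>D. hardy2_ip (E xs) h = \<phi> xs"
    by blast
  show ?thesis
  proof (rule that[OF h])
    fix z :: complex assume z: "cmod z < 1"
    have zD: "[(1, z)] \<in> D" using z by (simp add: D_def)
    have "hardy2_ip (E [(1, z)]) h = cnj (f z)" using rep zD by (simp add: \<phi>_def)
    hence "f z = hardy2_ip h (E [(1, z)])" using H2.ip_commute[OF E_in[OF zD] h(1)] by simp
    also have "E [(1, z)] = extend_by_zero unit_disk (\<lambda>w. poly p w * szego z w)"
      by (simp add: E_def szego_comb_def)
    finally show "f z = (\<Sum>k\<le>N. cnj (coeff p k) * shift_coeff k h z)"
      using ip_poly_szego[OF h(1) z] by simp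
  qed
qed

text \<open>On the circle it is \<open>self_inversive\<close>; two polynomials agreeing on that
  infinite set are equal.\<close>

lemma self_inversive_coeffs: "(\<Sum>k\<le>N. cnj (coeff p k) * z ^ (N - k)) = c0 * poly p z"
proof -
  define q where "q = (\<Sum>k\<le>N. monom (cnj (coeff p k)) (N - k)) - smult c0 p"
  have poly_q: "poly q z = (\<Sum>k\<le>N. cnj (coeff p k) * z ^ (N - k)) - c0 * poly p z" for z
    by (simp add: q_def poly_sum poly_monom)
  have "poly q z = 0" if z: "cmod z = 1" for z
  proof -
    have "cnj (coeff p k) * z ^ (N - k) = z ^ N * cnj (coeff p k * z ^ k)" if "k \<le> N" for k
    proof -
      have "z ^ N * cnj z ^ k = z ^ (N - k) * (z * cnj z) ^ k"
        using that by (simp add: power_mult_distrib flip: power_add)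
      thus ?thesis using z complex_norm_square[of z] by simp
    qed
    hence "(\<Sum>k\<le>N. cnj (coeff p k) * z ^ (N - k)) = (\<Sum>k\<le>N. z ^ N * cnj (coeff p k * z ^ k))"
      by (intro sum.cong refl) simp
    also have "\<dots> = z ^ N * cnj (poly p z)" by (simp add: poly_altdef sum_distrib_left)
    finally have "(\<Sum>k\<le>N. cnj (coeff p k) * z ^ (N - k)) = z ^ N * cnj (poly p z)" .
    thus ?thesis using self_inversive[OF z] poly_q by simp
  qed
  hence "unit_circle \<subseteq> {z. poly q z = 0}" by auto
  moreover have "infinite unit_circle" by (rule infinite_unit_circle)
  ultimately have "q = 0" using poly_roots_finite finite_subset by blast
  thus ?thesis using poly_q[of z] by simp
qed

text \<open>The polynomial W of the overview: the first \<open>k\<close> Taylor terms of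
  \<open>h\<close>, dropped by the \<open>k\<close>-th shift, reappear with weight z^(N -
  k).\<close>

definition remainder :: "(complex \<Rightarrow> complex) \<Rightarrow> complex poly" where
  "remainder h = (\<Sum>k\<le>N. \<Sum>n<k. monom (cnj (coeff p k) * tcoeff h n) (N - k + n))"

text \<open>Every exponent N - k + n has n < k <= N. For N = 0 the sum is empty, which accounts for
  the alternative.\<close>

lemma degree_remainder: "remainder h = 0 \<or> degree (remainder h) < N"
proof (cases "N = 0")
  case True
  thus ?thesis by (simp add: remainder_def)
next
  case False
  have "degree (remainder h) \<le> N - 1" unfolding remainder_def
    by (intro degree_sum_le finite_atMost finite_lessThan order_trans[OF degree_monom_le]) auto
  thus ?thesis using False by linarith
qed

lemma poly_remainder:
  "poly (remainder h) z = (\<Sum>k\<le>N. \<Sum>n<k. cnj (coeff p k) * tcoeff h n * z ^ (N - k + n))"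
  by (simp add: remainder_def poly_sum poly_monom)

text \<open>Splitting z^N into z^(N - k) and z^k undoes each backward shift up to its dropped terms;
  the remaining sum over \<open>k\<close> is \<open>c0\<close> times \<open>p\<close>.\<close>

lemma toeplitz_decomposition:
  assumes "h \<in> hardy2" "\<And>z. cmod z < 1 \<Longrightarrow> f z = (\<Sum>k\<le>N. cnj (coeff p k) * shift_coeff k h z)"
    and z: "cmod z < 1"
  shows "z ^ N * f z = c0 * poly p z * h z - poly (remainder h) z"
proof -
  have "z ^ N * f z = (\<Sum>k\<le>N. cnj (coeff p k) * z ^ (N - k) * (z ^ k * shift_coeff k h z))"
    unfolding assms(2)[OF z] sum_distrib_left
  proof (intro sum.cong refl)
    fix k assume "k \<in> {..N}"
    hence "z ^ N = z ^ (N - k) * z ^ k" by (simp flip: power_add)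
    thus "z ^ N * (cnj (coeff p k) * shift_coeff k h z) = cnj (coeff p k) * z ^ (N - k) * (z ^ k * shift_coeff k h z)"
      by simp
  qed
  also have "\<dots> = (\<Sum>k\<le>N. cnj (coeff p k) * z ^ (N - k)) * h z - poly (remainder h) z"
  proof -
    have "poly (remainder h) z = (\<Sum>k\<le>N. cnj (coeff p k) * z ^ (N - k) * (\<Sum>n<k. tcoeff h n * z ^ n))"
      unfolding poly_remainder sum_distrib_left power_add by (intro sum.cong refl) (simp only: mult_ac)
    thus ?thesis
      unfolding power_shift_coeff[OF assms(1) z] right_diff_distrib sum_subtractf sum_distrib_right by simp
  qed
  finally show ?thesis unfolding self_inversive_coeffs .
qed

end

subsection \<open>Boundary derivatives\<close>

text \<open>Needed because \<open>kernel_deriv\<close> differentiates in the conjugate of the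
  parameter.\<close>

lemma higher_deriv_cnj:
  assumes F: "F holomorphic_on S" and S: "open S" and w: "cnj w \<in> S"
  shows "(deriv ^^ l) (\<lambda>w. cnj (F (cnj w))) w = cnj ((deriv ^^ l) F (cnj w))"
  using w
proof (induction l arbitrary: w)
  case 0
  thus ?case by simp
next
  case (Suc l)
  define T where "T = cnj -` S"
  have T: "open T" unfolding T_def by (intro open_vimage S continuous_intros)
  have wT: "w \<in> T" using Suc.prems by (simp add: T_def)
  have "(deriv ^^ l) F holomorphic_on S" using F S by (intro holomorphic_intros)
  hence "((deriv ^^ l) F has_field_derivative deriv ((deriv ^^ l) F) (cnj w)) (at (cnj w))"
    using Suc.prems S holomorphic_derivI by blast
  hence "((cnj \<circ> (deriv ^^ l) F \<circ> cnj) has_field_derivative cnj (deriv ((deriv ^^ l) F) (cnj w))) (at w)"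
    by (rule has_field_derivative_cnj_cnj)
  hence "((deriv ^^ l) (\<lambda>w. cnj (F (cnj w))) has_field_derivative cnj (deriv ((deriv ^^ l) F) (cnj w))) (at w)"
    by (rule has_field_derivative_transform_within_open[OF _ T wT]) (auto simp: T_def Suc.IH)
  thus ?case by (simp add: DERIV_imp_deriv)
qed

text \<open>The reproducing bound, with szego x x = 1 / (1 - |x|^2) and 1 - |x|^2 >= 1 - |x| >=
  d.\<close>

lemma hardy2_growth:
  assumes h: "h \<in> hardy2" and x: "cmod x \<le> 1 - d" and d: "d > 0"
  shows "cmod (h x) \<le> sqrt (H2.sqn h) / sqrt d"
proof -
  have x1: "cmod x < 1" using x d by simp
  have "szego x x = of_real (1 / (1 - (cmod x)\<^sup>2))"
    using complex_norm_square[of x] by (simp add: szego_def mult.commute)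
  hence "Re (szego x x) = 1 / (1 - (cmod x)\<^sup>2)" by simp
  hence "(cmod (h x))\<^sup>2 \<le> 1 / (1 - (cmod x)\<^sup>2) * H2.sqn h"
    using H2.reproducing_bound[OF h, of x] x1 by simp
  also have "\<dots> \<le> 1 / d * H2.sqn h"
  proof (intro mult_right_mono H2.ip_nonneg[OF h] divide_left_mono)
    have "(cmod x)\<^sup>2 \<le> cmod x" using x1 by (simp add: power2_eq_square mult_left_le)
    thus "d \<le> 1 - (cmod x)\<^sup>2" using x by simp
    thus "0 < (1 - (cmod x)\<^sup>2) * d" using d by simp
  qed simp
  finally have "cmod (h x) \<le> sqrt (1 / d * H2.sqn h)" by (rule real_le_rsqrt)
  thus ?thesis by (simp add: real_sqrt_mult real_sqrt_divide)
qed

text \<open>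
  The growth of h near the circle is of order -1/2, so a factor vanishing to order m > l at the
  boundary point makes the l-th derivative of the product tend to 0 (Cauchy estimate on a disk of
  radius half the distance to the circle).
\<close>

lemma radial_deriv_bound:
  assumes h: "h \<in> hardy2" and z0: "cmod z0 = 1" and s: "s holomorphic_on unit_disk - {0}"
    and bound: "\<And>x. cmod x < 1 \<Longrightarrow> 1/4 \<le> cmod x \<Longrightarrow> cmod (s x) \<le> M * cmod (x - z0) ^ m"
    and l: "l < m" and \<rho>: "1/2 < \<rho>" "\<rho> < 1"
  shows "cmod ((deriv ^^ l) (\<lambda>x. s x * h x) (of_real \<rho> * z0)) \<le>
    fact l * \<bar>M\<bar> * 3 ^ m * sqrt (H2.sqn h) * sqrt ((1 - \<rho>) / 2)"
proof -
  \<comment> \<open>Half the distance of the point to the circle. Since \<open>\<rho>\<close>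
    exceeds 1/2, \<open>d\<close> is below 1/4, and the disk of radius \<open>d\<close> keeps away
    from the singularity 0 of \<open>s\<close>.\<close>
  define d where "d = (1 - \<rho>) / 2"
  have d: "d > 0" "d < 1/4" "\<rho> = 1 - 2 * d" using \<rho> by (auto simp: d_def field_simps)
  define y where "y = of_real \<rho> * z0"
  have y: "cmod y = \<rho>" using z0 \<rho> by (simp add: y_def norm_mult)
  have yz0: "cmod (y - z0) = 2 * d"
  proof -
    have "y - z0 = of_real (\<rho> - 1) * z0" by (simp add: y_def algebra_simps)
    hence "cmod (y - z0) = \<bar>\<rho> - 1\<bar>" using z0 by (simp only: norm_mult norm_of_real mult_1_right)
    thus ?thesis using d by simp
  qed
  have in_ball: "cmod x \<le> 1 - d \<and> 1/4 \<le> cmod x \<and> cmod (x - z0) \<le> 3 * d" if "x \<in> cball y d" for x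
  proof -
    have yx: "cmod (y - x) \<le> d" using that by (simp add: dist_norm)
    have "cmod x \<le> cmod y + cmod (y - x)" using norm_triangle_ineq[of y "x - y"] by (simp add: norm_minus_commute)
    moreover have "cmod y \<le> cmod x + cmod (y - x)" using norm_triangle_ineq[of x "y - x"] by simp
    moreover have "cmod (x - z0) \<le> cmod (y - z0) + cmod (y - x)"
      using norm_triangle_ineq[of "y - z0" "x - y"] by (simp add: norm_minus_commute)
    ultimately show ?thesis using yx y yz0 d by simp
  qed
  have sub: "cball y d \<subseteq> unit_disk - {0}"
  proof
    fix x assume "x \<in> cball y d"
    from in_ball[OF this] show "x \<in> unit_disk - {0}" using d by auto
  qed
  have holo: "(\<lambda>x. s x * h x) holomorphic_on unit_disk - {0}"
    using s hardy2_holo[OF h] by (intro holomorphic_intros) (auto intro: holomorphic_on_subset)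
  define B where "B = \<bar>M\<bar> * (3 * d) ^ m * (sqrt (H2.sqn h) / sqrt d)"
  have "cmod ((deriv ^^ l) (\<lambda>x. s x * h x) y) \<le> fact l * B / d ^ l"
  proof (rule Cauchy_inequality[OF _ _ d(1)])
    show "(\<lambda>x. s x * h x) holomorphic_on ball y d"
      using holo sub by (meson ball_subset_cball holomorphic_on_subset order_trans)
    show "continuous_on (cball y d) (\<lambda>x. s x * h x)"
      using holo sub by (meson holomorphic_on_imp_continuous_on holomorphic_on_subset)
    fix x assume "cmod (y - x) = d"
    hence "x \<in> cball y d" by (simp add: dist_norm)
    note x = in_ball[OF this]
    have "cmod (s x) \<le> \<bar>M\<bar> * (3 * d) ^ m"
    proof -
      have "cmod (s x) \<le> M * cmod (x - z0) ^ m" using x d by (intro bound) auto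
      also have "\<dots> \<le> \<bar>M\<bar> * (3 * d) ^ m" using x by (intro mult_mono power_mono) auto
      finally show ?thesis .
    qed
    moreover have "cmod (h x) \<le> sqrt (H2.sqn h) / sqrt d" using x d by (intro hardy2_growth h) auto
    ultimately show "cmod (s x * h x) \<le> B"
      unfolding B_def norm_mult using d by (intro mult_mono) auto
  qed
  also have "fact l * B / d ^ l = fact l * \<bar>M\<bar> * 3 ^ m * sqrt (H2.sqn h) * (d ^ (m - l) / sqrt d)"
  proof -
    have "d ^ (m - l) = d ^ m / d ^ l" using l d by (simp add: power_diff)
    thus ?thesis by (simp add: B_def power_mult_distrib mult_ac)
  qed
  also have "\<dots> \<le> fact l * \<bar>M\<bar> * 3 ^ m * sqrt (H2.sqn h) * sqrt d"
  proof (rule mult_left_mono)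
    \<comment> \<open>Here \<open>l < m\<close> enters: one spare power of \<open>d\<close> beats
      the growth 1 / sqrt d and leaves sqrt d.\<close>
    have "d ^ (m - l) \<le> d ^ 1" using l d by (intro power_decreasing) auto
    hence "d ^ (m - l) / sqrt d \<le> d / sqrt d" using d by (intro divide_right_mono) auto
    thus "d ^ (m - l) / sqrt d \<le> sqrt d" using d by (simp add: real_div_sqrt)
    show "0 \<le> fact l * \<bar>M\<bar> * 3 ^ m * sqrt (H2.sqn h)" using H2.ip_nonneg[OF h] by simp
  qed
  finally show ?thesis unfolding y_def d_def .
qed

abbreviation radial_deriv_limit :: "nat \<Rightarrow> (complex \<Rightarrow> complex) \<Rightarrow> complex \<Rightarrow> complex \<Rightarrow> bool" where
  "radial_deriv_limit l f z0 y \<equiv>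
    ((\<lambda>\<rho>. (deriv ^^ l) f (of_real \<rho> * z0)) \<longlongrightarrow> y) (at_left (1 :: real))"

lemma radial_deriv_tendsto_0:
  assumes h: "h \<in> hardy2" and z0: "cmod z0 = 1" and s: "s holomorphic_on unit_disk - {0}"
    and bound: "\<And>x. cmod x < 1 \<Longrightarrow> 1/4 \<le> cmod x \<Longrightarrow> cmod (s x) \<le> M * cmod (x - z0) ^ m"
    and l: "l < m"
  shows "radial_deriv_limit l (\<lambda>x. s x * h x) z0 0"
proof (rule Lim_null_comparison)
  have "eventually (\<lambda>\<rho>. 1/2 < \<rho> \<and> \<rho> < 1) (at_left (1 :: real))"
    by (rule eventually_between_at_left) simp
  thus "eventually (\<lambda>\<rho>. norm ((deriv ^^ l) (\<lambda>x. s x * h x) (of_real \<rho> * z0)) \<le>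
      fact l * \<bar>M\<bar> * 3 ^ m * sqrt (H2.sqn h) * sqrt ((1 - \<rho>) / 2)) (at_left (1 :: real))"
    by (rule eventually_mono) (intro radial_deriv_bound[OF h z0 s bound l]; simp)
  have "((\<lambda>\<rho>. fact l * \<bar>M\<bar> * 3 ^ m * sqrt (H2.sqn h) * sqrt ((1 - \<rho>) / 2)) \<longlongrightarrow>
      fact l * \<bar>M\<bar> * 3 ^ m * sqrt (H2.sqn h) * sqrt ((1 - 1) / 2)) (at_left (1 :: real))"
    by (intro tendsto_intros) auto
  thus "((\<lambda>\<rho>. fact l * \<bar>M\<bar> * 3 ^ m * sqrt (H2.sqn h) * sqrt ((1 - \<rho>) / 2)) \<longlongrightarrow> 0) (at_left (1 :: real))"
    by simp
qed

lemma radial_tendsto: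
  fixes F :: "complex \<Rightarrow> complex"
  assumes "isCont F z0"
  shows "((\<lambda>\<rho>. F (of_real \<rho> * z0)) \<longlongrightarrow> F z0) (at_left (1 :: real))"
proof -
  have "((\<lambda>\<rho>. of_real \<rho> * z0) \<longlongrightarrow> of_real 1 * z0) (at_left (1 :: real))"
    by (intro tendsto_mult tendsto_of_real tendsto_ident_at tendsto_const)
  hence "((\<lambda>\<rho>. of_real \<rho> * z0) \<longlongrightarrow> z0) (at_left (1 :: real))" by simp
  thus ?thesis using assms isCont_tendsto_compose by blast
qed

lemma eventually_radial:
  assumes "cmod z0 = 1" "open U" "z0 \<in> U"
  shows "eventually (\<lambda>\<rho>. of_real \<rho> * z0 \<in> U \<inter> (unit_disk - {0})) (at_left (1 :: real))"
proof -
  have "((\<lambda>\<rho>. of_real \<rho> * z0) \<longlongrightarrow> z0) (at_left (1 :: real))" using radial_tendsto[where F = "\<lambda>x. x" and ?z0.0 = z0] by simp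
  hence "eventually (\<lambda>\<rho>. of_real \<rho> * z0 \<in> U) (at_left (1 :: real))"
    using assms(2,3) by (rule topological_tendstoD)
  moreover have "eventually (\<lambda>\<rho>. 0 < \<rho> \<and> \<rho> < 1) (at_left (1 :: real))"
    by (rule eventually_between_at_left) simp
  ultimately show ?thesis
  proof eventually_elim
    case (elim \<rho>)
    thus ?case using assms(1) by (auto simp: norm_mult)
  qed
qed

context mate_space
begin

text \<open>The part of \<open>f\<close> whose derivatives survive at the zeros of \<open>p\<close>;
  the other part is \<open>c0 * p * h\<close> divided by z^N.\<close>

definition laurent_part :: "(complex \<Rightarrow> complex) \<Rightarrow> complex \<Rightarrow> complex" where
  "laurent_part h z = - poly (remainder h) z / z ^ N"

lemma laurent_part_holo: "laurent_part h holomorphic_on - {0}"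
  unfolding laurent_part_def by (intro holomorphic_intros) auto

text \<open>Elements of \<open>H\<close> are known only through the reproducing property;
  analyticity is read off the representation by shifts.\<close>

lemma H_holo:
  assumes "f \<in> H"
  shows "f holomorphic_on unit_disk"
proof -
  from toeplitz_representation[OF assms] obtain h where h: "h \<in> hardy2"
    and f: "\<And>z. cmod z < 1 \<Longrightarrow> f z = (\<Sum>k\<le>N. cnj (coeff p k) * shift_coeff k h z)" by blast
  have "shift_coeff k h holomorphic_on unit_disk" for k
    unfolding shift_coeff_def by (intro hardy2_holo hardy_series_in shift_coeff_summable h)
  hence "(\<lambda>z. \<Sum>k\<le>N. cnj (coeff p k) * shift_coeff k h z) holomorphic_on unit_disk"
    by (intro holomorphic_intros)
  thus ?thesis by (rule holomorphic_transform) (simp add: f)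
qed

lemma p_vanishing_bound:
  assumes "p = [:- z0, 1:] ^ m * p1"
  obtains M where "\<And>x. cmod x \<le> 1 \<Longrightarrow> cmod (poly p x) \<le> M * cmod (x - z0) ^ m"
proof -
  obtain M where M: "\<And>x. cmod x \<le> 1 \<Longrightarrow> cmod (poly p1 x) \<le> M"
    using disk_algebra_bounded[OF disk_algebra_poly] by blast
  have "cmod (poly p x) \<le> M * cmod (x - z0) ^ m" if "cmod x \<le> 1" for x
  proof -
    have "cmod (poly p x) = cmod (poly p1 x) * cmod (x - z0) ^ m"
      by (simp add: assms norm_mult norm_power poly_power)
    thus ?thesis using M[of x] that by (simp add: mult_right_mono)
  qed
  thus ?thesis by (rule that)
qed

text \<open>\<open>f\<close> is \<open>s * h\<close> plus the Laurent part. The factor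
  \<open>s\<close> vanishes to order \<open>m > l\<close> at \<open>z0\<close>, so the first term
  contributes 0 in the limit, while the second is analytic near \<open>z0\<close>.\<close>

lemma deriv_tendsto:
  assumes h: "h \<in> hardy2" and f: "f holomorphic_on unit_disk"
    and dec: "\<And>z. cmod z < 1 \<Longrightarrow> z ^ N * f z = c0 * poly p z * h z - poly (remainder h) z"
    and z0: "cmod z0 = 1" and p: "p = [:- z0, 1:] ^ m * p1" and l: "l < m"
  shows "radial_deriv_limit l f z0 ((deriv ^^ l) (laurent_part h) z0)"
proof -
  define s where "s z = c0 * poly p z / z ^ N" for z
  define U where "U = unit_disk - {0 :: complex}"
  have U: "open U" by (auto simp: U_def)
  obtain M where M: "\<And>x. cmod x \<le> 1 \<Longrightarrow> cmod (poly p x) \<le> M * cmod (x - z0) ^ m"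
    using p_vanishing_bound[OF p] by blast
  have s_holo: "s holomorphic_on U" unfolding s_def U_def by (intro holomorphic_intros) auto
  have sh_holo: "(\<lambda>x. s x * h x) holomorphic_on U"
    using s_holo hardy2_holo[OF h] by (intro holomorphic_intros) (auto simp: U_def intro: holomorphic_on_subset)
  have lp_holo: "laurent_part h holomorphic_on U"
    by (rule holomorphic_on_subset[OF laurent_part_holo]) (auto simp: U_def)
  \<comment> \<open>The factor 4^N comes from |x| >= 1/4 in the denominator z^N.\<close>
  have s_bound: "cmod (s x) \<le> (cmod c0 * M * 4 ^ N) * cmod (x - z0) ^ m" if x: "cmod x < 1" "1/4 \<le> cmod x" for x
  proof -
    have "(1/4) ^ N \<le> cmod x ^ N" using x by (intro power_mono) auto
    moreover have "0 < cmod x" using x by linarith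
    ultimately have "1 / cmod x ^ N \<le> 1 / (1/4) ^ N"
      by (intro divide_left_mono mult_pos_pos zero_less_power) auto
    hence inv: "1 / cmod x ^ N \<le> 4 ^ N" by (simp add: power_one_over)
    have "cmod (s x) = cmod c0 * cmod (poly p x) * (1 / cmod x ^ N)"
      by (simp add: s_def norm_mult norm_divide norm_power)
    also have "\<dots> \<le> cmod c0 * (M * cmod (x - z0) ^ m) * 4 ^ N"
      using M[of x] x inv order_trans[OF norm_ge_zero M[of x]] by (intro mult_mono) auto
    finally show ?thesis by (simp add: mult_ac)
  qed
  have T0: "radial_deriv_limit l (\<lambda>x. s x * h x) z0 0"
    using s_holo unfolding U_def by (rule radial_deriv_tendsto_0[OF h z0 _ s_bound l])
  have z0nz: "z0 \<in> - {0}" using z0 by auto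
  have "open (- {0 :: complex})" by auto
  hence "(deriv ^^ l) (laurent_part h) holomorphic_on - {0}"
    by (intro holomorphic_higher_deriv laurent_part_holo)
  hence "isCont ((deriv ^^ l) (laurent_part h)) z0"
    using holomorphic_on_imp_continuous_on continuous_on_eq_continuous_at[OF \<open>open (- {0})\<close>] z0nz by blast
  from tendsto_add[OF T0 radial_tendsto[OF this]]
  have lim: "((\<lambda>\<rho>. (deriv ^^ l) (\<lambda>x. s x * h x) (of_real \<rho> * z0) + (deriv ^^ l) (laurent_part h) (of_real \<rho> * z0))
      \<longlongrightarrow> (deriv ^^ l) (laurent_part h) z0) (at_left (1 :: real))" by simp
  have eq: "(deriv ^^ l) (\<lambda>x. s x * h x) x + (deriv ^^ l) (laurent_part h) x = (deriv ^^ l) f x" if x: "x \<in> U" for x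
  proof -
    have "(deriv ^^ l) (\<lambda>x. s x * h x) x + (deriv ^^ l) (laurent_part h) x =
        (deriv ^^ l) (\<lambda>x. s x * h x + laurent_part h x) x"
      by (rule higher_deriv_add[symmetric, OF sh_holo lp_holo U x])
    also have "\<dots> = (deriv ^^ l) f x"
    proof (rule higher_deriv_transform_within_open[OF _ _ U x])
      show "(\<lambda>x. s x * h x + laurent_part h x) holomorphic_on U" by (intro holomorphic_intros sh_holo lp_holo)
      show "f holomorphic_on U" using f by (rule holomorphic_on_subset) (auto simp: U_def)
      show "s y * h y + laurent_part h y = f y" if "y \<in> U" for y
        using dec[of y] that by (auto simp: s_def laurent_part_def U_def field_simps)
    qed
    finally show ?thesis .
  qed
  have ev: "eventually (\<lambda>\<rho>. of_real \<rho> * z0 \<in> UNIV \<inter> (unit_disk - {0})) (at_left (1 :: real))"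
    by (rule eventually_radial[OF z0]) auto
  show ?thesis
    by (rule Lim_transform_eventually[OF lim]) (rule eventually_mono[OF ev], simp add: eq U_def)
qed

text \<open>The Cauchy estimate on the circle of radius 1/2 about \<open>z0\<close>; the remainder
  depends on finitely many Taylor coefficients of \<open>h\<close>, each bounded by its
  norm.\<close>

lemma laurent_part_deriv_bound:
  assumes z0: "cmod z0 = 1"
  obtains K where "K \<ge> 0" "\<And>h. h \<in> hardy2 \<Longrightarrow> (cmod ((deriv ^^ l) (laurent_part h) z0))\<^sup>2 \<le> K * H2.sqn h"
proof -
  \<comment> \<open>On that circle 1/2 <= |x| <= 2: the inner powers of 2 bound the monomials, and
    the last one bounds 1 / |x|^N.\<close>
  define A where "A = (\<Sum>k\<le>N. \<Sum>n<k. cmod (coeff p k) * 2 ^ (N - k + n)) * 2 ^ N"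
  have A: "A \<ge> 0" unfolding A_def by (intro mult_nonneg_nonneg sum_nonneg) auto
  define K where "K = (fact l * A / (1/2) ^ l)\<^sup>2"
  have "(cmod ((deriv ^^ l) (laurent_part h) z0))\<^sup>2 \<le> K * H2.sqn h" if h: "h \<in> hardy2" for h
  proof -
    have "cmod ((deriv ^^ l) (laurent_part h) z0) \<le> fact l * (A * sqrt (H2.sqn h)) / (1/2) ^ l"
    proof (rule Cauchy_inequality)
      have "0 \<notin> cball z0 (1/2)" using z0 by simp
      hence "cball z0 (1/2) \<subseteq> - {0}" by blast
      thus "laurent_part h holomorphic_on ball z0 (1/2)" "continuous_on (cball z0 (1/2)) (laurent_part h)"
        using laurent_part_holo[of h]
        by (meson ball_subset_cball holomorphic_on_subset order_trans holomorphic_on_imp_continuous_on)+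
      fix x assume x: "cmod (z0 - x) = 1/2"
      have x_up: "cmod x \<le> 2" using norm_triangle_ineq[of z0 "x - z0"] z0 x by (simp add: norm_minus_commute)
      have x_lo: "1/2 \<le> cmod x" using norm_triangle_ineq[of x "z0 - x"] z0 x by simp
      have "cmod (poly (remainder h) x) \<le> (\<Sum>k\<le>N. \<Sum>n<k. cmod (coeff p k) * sqrt (H2.sqn h) * 2 ^ (N - k + n))"
        unfolding poly_remainder
      proof (intro sum_norm_le)
        fix k n
        have "cmod (tcoeff h n) \<le> sqrt (H2.sqn h)" by (rule real_le_rsqrt[OF hardy2_coeff_le[OF h]])
        thus "cmod (cnj (coeff p k) * tcoeff h n * x ^ (N - k + n)) \<le>
            cmod (coeff p k) * sqrt (H2.sqn h) * 2 ^ (N - k + n)"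
          unfolding norm_mult norm_power complex_mod_cnj using x_up
          by (intro mult_mono power_mono mult_left_mono) (auto simp: H2.ip_nonneg[OF h])
      qed
      also have "\<dots> = (\<Sum>k\<le>N. \<Sum>n<k. cmod (coeff p k) * 2 ^ (N - k + n)) * sqrt (H2.sqn h)"
        unfolding sum_distrib_right by (intro sum.cong refl) (simp only: mult_ac)
      finally have W: "cmod (poly (remainder h) x) \<le> (\<Sum>k\<le>N. \<Sum>n<k. cmod (coeff p k) * 2 ^ (N - k + n)) * sqrt (H2.sqn h)" .
      have "(1/2) ^ N \<le> cmod x ^ N" using x_lo by (intro power_mono) auto
      moreover have "0 < cmod x" using x_lo by linarith
      ultimately have "1 / cmod x ^ N \<le> 1 / (1/2) ^ N"
        by (intro divide_left_mono mult_pos_pos zero_less_power) auto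
      hence inv: "1 / cmod x ^ N \<le> 2 ^ N" by (simp add: power_one_over)
      have "cmod (laurent_part h x) = cmod (poly (remainder h) x) * (1 / cmod x ^ N)"
        by (simp add: laurent_part_def norm_divide norm_power)
      also have "\<dots> \<le> ((\<Sum>k\<le>N. \<Sum>n<k. cmod (coeff p k) * 2 ^ (N - k + n)) * sqrt (H2.sqn h)) * 2 ^ N"
        using W inv order_trans[OF norm_ge_zero W] by (intro mult_mono) auto
      also have "\<dots> = A * sqrt (H2.sqn h)" by (simp add: A_def)
      finally show "cmod (laurent_part h x) \<le> A * sqrt (H2.sqn h)" .
    qed simp
    hence "(cmod ((deriv ^^ l) (laurent_part h) z0))\<^sup>2 \<le> (fact l * A / (1/2) ^ l * sqrt (H2.sqn h))\<^sup>2"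
      by (intro power_mono) (simp_all add: mult_ac)
    also have "\<dots> = K * H2.sqn h"
      unfolding K_def power_mult_distrib using H2.ip_nonneg[OF h] by simp
    finally show ?thesis .
  qed
  moreover have "K \<ge> 0" by (simp add: K_def)
  ultimately show ?thesis using that by blast
qed

lemma boundary_functional:
  assumes z0: "cmod z0 = 1" and p: "p = [:- z0, 1:] ^ m * p1" and l: "l < m"
  obtains v where "v \<in> H"
    "\<And>f. f \<in> H \<Longrightarrow> radial_deriv_limit l f z0 (ip f v)"
proof -
  \<comment> \<open>Defined as a limit and not through \<open>h\<close>, which is merely chosen for
    each \<open>f\<close>; linearity then follows from uniqueness of limits.\<close>
  define \<Lambda> where "\<Lambda> f = Lim (at_left (1 :: real)) (\<lambda>\<rho>. (deriv ^^ l) f (of_real \<rho> * z0))" for f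
  obtain K where K: "K \<ge> 0" "\<And>h. h \<in> hardy2 \<Longrightarrow> (cmod ((deriv ^^ l) (laurent_part h) z0))\<^sup>2 \<le> K * H2.sqn h"
    using laurent_part_deriv_bound[OF z0] by blast
  have main: "radial_deriv_limit l f z0 (\<Lambda> f) \<and>
      (cmod (\<Lambda> f))\<^sup>2 \<le> K * C2 * sqn f" if f: "f \<in> H" for f
  proof -
    from toeplitz_representation[OF f] obtain h where h: "h \<in> hardy2" "H2.sqn h \<le> C2 * sqn f"
      and rep: "\<And>z. cmod z < 1 \<Longrightarrow> f z = (\<Sum>k\<le>N. cnj (coeff p k) * shift_coeff k h z)" by blast
    have lim: "radial_deriv_limit l f z0 ((deriv ^^ l) (laurent_part h) z0)"
      by (rule deriv_tendsto[OF h(1) H_holo[OF f] toeplitz_decomposition[OF h(1) rep] z0 p l])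
    hence "\<Lambda> f = (deriv ^^ l) (laurent_part h) z0" unfolding \<Lambda>_def by (intro tendsto_Lim) auto
    moreover have "K * H2.sqn h \<le> K * (C2 * sqn f)" using h(2) K(1) by (intro mult_left_mono)
    ultimately show ?thesis using lim K(2)[OF h(1)] by simp
  qed
  have ev: "eventually (\<lambda>\<rho>. of_real \<rho> * z0 \<in> UNIV \<inter> (unit_disk - {0})) (at_left (1 :: real))"
    by (rule eventually_radial[OF z0]) auto
  have "\<exists>v\<in>H. \<forall>f\<in>H. ip f v = \<Lambda> f"
  proof (rule bounded_functional_rep)
    show "\<Lambda> (f + g) = \<Lambda> f + \<Lambda> g" if "f \<in> H" "g \<in> H" for f g
    proof (rule tendsto_unique[OF trivial_limit_at_left_real])
      show "radial_deriv_limit l (f + g) z0 (\<Lambda> (f + g))"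
        using main[OF add_in[OF that]] by blast
      have "((\<lambda>\<rho>. (deriv ^^ l) f (of_real \<rho> * z0) + (deriv ^^ l) g (of_real \<rho> * z0)) \<longlongrightarrow> \<Lambda> f + \<Lambda> g) (at_left (1 :: real))"
        using main that by (intro tendsto_add) auto
      thus "radial_deriv_limit l (f + g) z0 (\<Lambda> f + \<Lambda> g)"
      proof (rule Lim_transform_eventually)
        show "eventually (\<lambda>\<rho>. (deriv ^^ l) f (of_real \<rho> * z0) + (deriv ^^ l) g (of_real \<rho> * z0) =
            (deriv ^^ l) (f + g) (of_real \<rho> * z0)) (at_left (1 :: real))"
          using ev
        proof eventually_elim
          case (elim \<rho>)
          thus ?case using higher_deriv_add[OF H_holo H_holo open_ball, OF that, of "of_real \<rho> * z0" l]
            by (simp add: plus_fun_def)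
        qed
      qed
    qed
    show "\<Lambda> (fun_scale c f) = c * \<Lambda> f" if "f \<in> H" for c f
    proof (rule tendsto_unique[OF trivial_limit_at_left_real])
      show "radial_deriv_limit l (fun_scale c f) z0 (\<Lambda> (fun_scale c f))"
        using main[OF scale_in[OF that]] by blast
      have "((\<lambda>\<rho>. c * (deriv ^^ l) f (of_real \<rho> * z0)) \<longlongrightarrow> c * \<Lambda> f) (at_left (1 :: real))"
        using main that by (intro tendsto_mult_left) auto
      thus "radial_deriv_limit l (fun_scale c f) z0 (c * \<Lambda> f)"
      proof (rule Lim_transform_eventually)
        show "eventually (\<lambda>\<rho>. c * (deriv ^^ l) f (of_real \<rho> * z0) =
            (deriv ^^ l) (fun_scale c f) (of_real \<rho> * z0)) (at_left (1 :: real))"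
          using ev
        proof eventually_elim
          case (elim \<rho>)
          thus ?case using higher_deriv_cmult[OF H_holo[OF that] _ open_ball, of "of_real \<rho> * z0" l c]
            by (simp add: fun_scale_def)
        qed
      qed
    qed
    show "0 \<le> K * C2" using K(1) C2_nonneg by simp
    show "(cmod (\<Lambda> f))\<^sup>2 \<le> K * C2 * sqn f" if "f \<in> H" for f using main[OF that] by blast
  qed
  then obtain v where "v \<in> H" "\<forall>f\<in>H. ip f v = \<Lambda> f" by blast
  with main that show ?thesis by simp
qed

text \<open>The value of \<open>v\<close> at \<open>z\<close> is the conjugate of the functional at
  the kernel function of \<open>z\<close>. This function continues analytically across
  \<open>z0\<close>, so the functional is an honest derivative there, and conjugation turns it into
  the derivative of \<open>kernel_deriv\<close>.\<close>

lemma boundary_functional_eq_kernel_deriv: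
  assumes z0: "cmod z0 = 1" and v: "v \<in> H"
    and lim: "\<And>f. f \<in> H \<Longrightarrow> radial_deriv_limit l f z0 (ip f v)"
    and ext: "\<exists>g. analytic_extension_at b z0 g"
  shows "v = kernel_deriv b z0 l"
proof
  fix z
  define g where "g = analytic_extension b z0"
  have "analytic_extension_at b z0 g" unfolding g_def analytic_extension_def using ext by (rule someI_ex)
  then obtain e where e: "e > 0" and g: "g holomorphic_on ball z0 e" and gb: "\<And>w. w \<in> ball z0 e \<inter> unit_disk \<Longrightarrow> g w = b w"
    unfolding analytic_extension_at_def by blast
  show "v z = kernel_deriv b z0 l z"
  proof (cases "z \<in> unit_disk")
    case False
    thus ?thesis using vanishes_off[OF v False] by (simp add: kernel_deriv_def extend_by_zero_def)
  next
    case True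
    \<comment> \<open>The kernel function at \<open>z\<close>, continued past the circle by the
      local extension of \<open>b\<close>; \<open>S\<close> removes the zeros of the
      denominator.\<close>
    define F where "F x = (1 - cnj (b z) * g x) / (1 - cnj z * x)" for x
    define S where "S = ball z0 e \<inter> {x. cnj z * x \<noteq> 1}"
    have S: "open S" unfolding S_def by (intro open_Int open_ball open_Collect_neq continuous_intros)
    have z0S: "z0 \<in> S" using e z0 True cnj_mult_neq_1[of z z0] by (auto simp: S_def)
    have F: "F holomorphic_on S" unfolding F_def S_def
      by (intro holomorphic_intros holomorphic_on_subset[OF g]) auto
    define k where "k = extend_by_zero unit_disk (dBR_kernel b z)"
    have k: "k \<in> H" unfolding k_def by (rule kernel_in[OF True])
    have "isCont ((deriv ^^ l) F) z0"
      using holomorphic_on_imp_continuous_on[OF holomorphic_higher_deriv[OF F S]] S z0S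
      by (simp add: continuous_on_eq_continuous_at)
    hence "radial_deriv_limit l F z0 ((deriv ^^ l) F z0)"
      by (rule radial_tendsto)
    moreover have "eventually (\<lambda>\<rho>. (deriv ^^ l) F (of_real \<rho> * z0) = (deriv ^^ l) k (of_real \<rho> * z0)) (at_left (1 :: real))"
      using eventually_radial[OF z0 S z0S]
    proof eventually_elim
      case (elim \<rho>)
      have U: "open (S \<inter> unit_disk)" using S by auto
      show ?case
      proof (rule higher_deriv_transform_within_open[OF _ _ U])
        show "F holomorphic_on S \<inter> unit_disk" using F by (rule holomorphic_on_subset) auto
        show "k holomorphic_on S \<inter> unit_disk" using H_holo[OF k] by (rule holomorphic_on_subset) auto
        show "F w = k w" if "w \<in> S \<inter> unit_disk" for w
          using that gb by (auto simp: F_def k_def S_def extend_by_zero_def dBR_kernel_def)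
      qed (use elim in auto)
    qed
    ultimately have "radial_deriv_limit l k z0 ((deriv ^^ l) F z0)"
      by (rule Lim_transform_eventually)
    hence ipk: "ip k v = (deriv ^^ l) F z0"
      using lim[OF k] tendsto_unique[OF trivial_limit_at_left_real] by blast
    have "v z = ip v k" unfolding k_def by (rule reproducing[OF v True, symmetric])
    also have "\<dots> = cnj (ip k v)" by (rule ip_commute[OF k v])
    also have "\<dots> = (deriv ^^ l) (\<lambda>w. cnj (F (cnj w))) (cnj z0)"
      unfolding ipk using higher_deriv_cnj[OF F S, of "cnj z0" l] z0S by simp
    also have "(\<lambda>w. cnj (F (cnj w))) = (\<lambda>w. (1 - cnj (g (cnj w)) * b z) / (1 - w * z))"
      by (simp add: F_def fun_eq_iff mult.commute)
    finally show ?thesis using True by (simp add: kernel_deriv_def extend_by_zero_def g_def)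
  qed
qed

text \<open>The zero of order \<open>m > l\<close> of \<open>p\<close> makes the limit that computes
  the inner product equal to 0.\<close>

lemma p_hardy2_orthogonal:
  assumes z0: "cmod z0 = 1" and p: "p = [:- z0, 1:] ^ m * p1" and l: "l < m" and h: "h \<in> hardy2"
    and lim: "\<And>f. f \<in> H \<Longrightarrow> radial_deriv_limit l f z0 (ip f v)"
  shows "ip (\<lambda>z. poly p z * h z) v = 0"
proof -
  obtain M where M: "\<And>x. cmod x \<le> 1 \<Longrightarrow> cmod (poly p x) \<le> M * cmod (x - z0) ^ m"
    using p_vanishing_bound[OF p] by blast
  have "radial_deriv_limit l (\<lambda>x. poly p x * h x) z0 0"
  proof (rule radial_deriv_tendsto_0[OF h z0 _ _ l])
    show "poly p holomorphic_on unit_disk - {0}" by (intro holomorphic_intros)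
    show "cmod (poly p x) \<le> M * cmod (x - z0) ^ m" if "cmod x < 1" for x using M[of x] that by simp
  qed
  thus ?thesis using lim[OF p_hardy2_in_H[OF h]] tendsto_unique[OF trivial_limit_at_left_real] by blast
qed

end

subsection \<open>The orthogonal decomposition\<close>

lemma deriv_poly: "deriv (poly p) = poly (pderiv p)" for p :: "complex poly"
  by (rule ext) (rule DERIV_imp_deriv[OF poly_DERIV])

lemma higher_deriv_poly: "(deriv ^^ l) (poly p) = poly ((pderiv ^^ l) p)" for p :: "complex poly"
  by (induction l) (simp_all add: deriv_poly)

text \<open>In characteristic 0 each derivative lowers the order of a root by exactly one.\<close>

lemma pderiv_order_nonzero:
  fixes W :: "complex poly"
  assumes "W \<noteq> 0"
  shows "poly ((pderiv ^^ order z0 W) W) z0 \<noteq> 0"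
  using assms
proof (induction "order z0 W" arbitrary: W)
  case 0
  thus ?case using order_root[of W z0] by simp
next
  case (Suc n)
  hence root: "poly W z0 = 0" using order_root[of W z0] by simp
  have ord: "order z0 W = Suc (order z0 (pderiv W))" by (rule order_pderiv[OF Suc.prems root])
  have "pderiv W \<noteq> 0"
  proof
    assume "pderiv W = 0"
    hence "degree W = 0" by (simp add: pderiv_eq_0_iff)
    then obtain c where "W = [:c:]" by (metis degree_eq_zeroE)
    thus False using root Suc.prems by simp
  qed
  moreover have "n = order z0 (pderiv W)" using Suc.hyps(2) ord by simp
  ultimately have "poly ((pderiv ^^ order z0 (pderiv W)) (pderiv W)) z0 \<noteq> 0" using Suc.hyps(1) by blast
  thus ?case by (simp add: ord funpow_Suc_right del: funpow.simps)
qed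

lemma linear_power_dvd_if_derivs_0:
  fixes W :: "complex poly"
  assumes "\<And>l. l < m \<Longrightarrow> (deriv ^^ l) (poly W) z0 = 0"
  shows "[:- z0, 1:] ^ m dvd W"
proof (cases "W = 0")
  case False
  have "\<not> order z0 W < m"
    using pderiv_order_nonzero[OF False, of z0] assms by (auto simp: higher_deriv_poly)
  thus ?thesis by (simp add: order_divides)
qed simp

text \<open>The product over the other points does not vanish at the new one, so the order of
  \<open>W\<close> there is carried by the cofactor.\<close>

lemma prod_linear_powers_dvd:
  fixes W :: "'a :: idom poly"
  assumes "finite J" "inj_on \<zeta> J" "\<And>j. j \<in> J \<Longrightarrow> [:- \<zeta> j, 1:] ^ m j dvd W"
  shows "(\<Prod>j\<in>J. [:- \<zeta> j, 1:] ^ m j) dvd W"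
  using assms
proof (induction J rule: finite_induct)
  case (insert j J)
  define P where "P = (\<Prod>j\<in>J. [:- \<zeta> j, 1:] ^ m j)"
  have "P dvd W" unfolding P_def using insert by (intro insert.IH) auto
  then obtain V where V: "W = P * V" by (elim dvdE)
  have "[:- \<zeta> j, 1:] ^ m j dvd V"
  proof (cases "W = 0")
    case True
    have "P \<noteq> 0" unfolding P_def using insert.hyps by simp
    thus ?thesis using True V by simp
  next
    case False
    have "\<zeta> j \<noteq> \<zeta> i" if "i \<in> J" for i using insert.prems(1) insert.hyps that by (auto simp: inj_on_def)
    hence "poly P (\<zeta> j) \<noteq> 0" unfolding P_def using insert.hyps
      by (auto simp: poly_prod poly_power)
    hence "order (\<zeta> j) P = 0" by (rule order_0I)
    moreover have "m j \<le> order (\<zeta> j) W" using insert.prems(2)[of j] False by (simp add: order_divides)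
    ultimately have "m j \<le> order (\<zeta> j) V" using order_mult[of P V "\<zeta> j"] False V by simp
    thus ?thesis by (simp add: order_divides)
  qed
  hence "P * [:- \<zeta> j, 1:] ^ m j dvd W" unfolding V by (rule mult_dvd_mono[OF dvd_refl])
  thus ?case using insert.hyps by (simp add: P_def mult.commute)
qed simp

context mate_space
begin

lemma remainder_eq_0:
  assumes J: "finite J" "inj_on \<zeta> J" "p = (\<Prod>j\<in>J. [:- \<zeta> j, 1:] ^ m j)" "\<And>j. j \<in> J \<Longrightarrow> cmod (\<zeta> j) = 1"
    and zero: "\<And>j l. j \<in> J \<Longrightarrow> l < m j \<Longrightarrow> (deriv ^^ l) (laurent_part h) (\<zeta> j) = 0"
  shows "remainder h = 0"
proof -
  have "[:- \<zeta> j, 1:] ^ m j dvd remainder h" if j: "j \<in> J" for j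
  proof (rule linear_power_dvd_if_derivs_0)
    fix l assume l: "l < m j"
    have U: "open (- {0 :: complex})" by auto
    have z0: "\<zeta> j \<in> - {0}" using J(4)[OF j] by auto
    have pow: "(\<lambda>x. - (x ^ N)) holomorphic_on - {0 :: complex}" by (intro holomorphic_intros)
    have "(deriv ^^ l) (poly (remainder h)) (\<zeta> j) = (deriv ^^ l) (\<lambda>x. - (x ^ N) * laurent_part h x) (\<zeta> j)"
    proof (rule higher_deriv_transform_within_open[OF _ _ U z0])
      show "(\<lambda>x. - (x ^ N) * laurent_part h x) holomorphic_on - {0}"
        by (intro holomorphic_on_mult pow laurent_part_holo)
    qed (auto simp: laurent_part_def intro!: holomorphic_intros)
    \<comment> \<open>By Leibniz the vanishing derivatives of the Laurent part pass to the
      polynomial \<open>remainder h\<close>.\<close>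
    also have "\<dots> = (\<Sum>i = 0..l. of_nat (l choose i) * (deriv ^^ i) (\<lambda>x. - (x ^ N)) (\<zeta> j) *
        (deriv ^^ (l - i)) (laurent_part h) (\<zeta> j))"
      by (rule higher_deriv_mult[OF pow laurent_part_holo U z0])
    also have "\<dots> = 0" using zero[OF j] l by (intro sum.neutral) auto
    finally show "(deriv ^^ l) (poly (remainder h)) (\<zeta> j) = 0" .
  qed
  hence "p dvd remainder h" unfolding J(3) by (intro prod_linear_powers_dvd J)
  thus ?thesis using degree_remainder[of h] dvd_imp_degree_le by (metis linorder_not_less)
qed

text \<open>With k = f / p the decomposition reads z^N k = c0 h. Hence the coefficients of
  \<open>k\<close> are \<open>c0\<close> times those of \<open>h\<close> moved down by N, and square
  summability is inherited.\<close>

lemma in_p_hardy2_if_remainder_0: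
  assumes f: "f \<in> H" and h: "h \<in> hardy2"
    and dec: "\<And>z. cmod z < 1 \<Longrightarrow> z ^ N * f z = c0 * poly p z * h z - poly (remainder h) z"
    and rem: "remainder h = 0"
  shows "\<exists>k\<in>hardy2. f = (\<lambda>z. poly p z * k z)"
proof -
  define k where "k z = f z / poly p z" for z
  have k_holo: "k holomorphic_on unit_disk"
    unfolding k_def using H_holo[OF f] p_nz by (intro holomorphic_intros) auto
  have k_off: "k z = 0" if "z \<notin> unit_disk" for z using vanishes_off[OF f that] by (simp add: k_def)
  define a where "a n = (if N \<le> n then tcoeff k (n - N) / c0 else 0)" for n
  have "(\<lambda>n. a n * z ^ n) sums h z" if z: "cmod z < 1" for z
  proof -
    have "(\<lambda>n. tcoeff k n * z ^ n) sums k z" by (rule tcoeff_sums[OF k_holo z])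
    from sums_mult[OF this, of "z ^ N / c0"]
    have "(\<lambda>n. a (n + N) * z ^ (n + N)) sums (z ^ N / c0 * k z)"
      by (simp add: a_def power_add mult_ac)
    also have "z ^ N / c0 * k z = h z"
      using dec[OF z] rem p_nz[of z] z c0_nz by (simp add: k_def field_simps)
    finally have "(\<lambda>n. a (n + N) * z ^ (n + N)) sums h z" .
    moreover have "(\<Sum>n<N. a n * z ^ n) = 0" by (simp add: a_def)
    ultimately show ?thesis using sums_iff_shift[of "\<lambda>n. a n * z ^ n" N "h z"] by simp
  qed
  hence coeff: "tcoeff h = a" by (rule tcoeff_unique(1))
  have "summable (\<lambda>n. (cmod c0)\<^sup>2 * (cmod (tcoeff h (n + N)))\<^sup>2)"
    by (intro summable_mult shift_coeff_summable h)
  hence "summable (\<lambda>n. (cmod (tcoeff k n))\<^sup>2)"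
    using c0_nz by (simp add: coeff a_def norm_divide power_divide)
  hence "k \<in> hardy2" unfolding hardy2_iff_summable using k_holo k_off by blast
  moreover have "f = (\<lambda>z. poly p z * k z)"
  proof
    fix z show "f z = poly p z * k z"
      using p_nz[of z] vanishes_off[OF f, of z] by (cases "z \<in> unit_disk") (auto simp: k_def)
  qed
  ultimately show ?thesis by blast
qed

lemma decomposition:
  assumes J: "finite J" "inj_on \<zeta> J" "p = (\<Prod>j\<in>J. [:- \<zeta> j, 1:] ^ m j)" "\<And>j. j \<in> J \<Longrightarrow> cmod (\<zeta> j) = 1"
    and ext: "\<And>j. j \<in> J \<Longrightarrow> \<exists>g. analytic_extension_at b (\<zeta> j) g"
  shows "\<forall>j\<in>J. \<forall>l<m j. kernel_deriv b (\<zeta> j) l \<in> H"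
    and "\<forall>j\<in>J. \<forall>l<m j. \<forall>f\<in>mult_hardy2 (poly p). ip f (kernel_deriv b (\<zeta> j) l) = 0"
    and "orthogonal_sum H ip (mult_hardy2 (poly p))
      (module.span fun_scale {kernel_deriv b (\<zeta> j) l | j l. j \<in> J \<and> l < m j})"
proof -
  define v where "v j l = kernel_deriv b (\<zeta> j) l" for j l
  have p_factor: "p = [:- \<zeta> j, 1:] ^ m j * (\<Prod>i\<in>J - {j}. [:- \<zeta> i, 1:] ^ m i)" if "j \<in> J" for j
    unfolding J(3) using J(1) that by (rule prod.remove)
  have v: "v j l \<in> H \<and> (\<forall>f\<in>H. radial_deriv_limit l f (\<zeta> j) (ip f (v j l)))"
    if j: "j \<in> J" and l: "l < m j" for j l
  proof -
    from boundary_functional[OF J(4)[OF j] p_factor[OF j] l] obtain w where w: "w \<in> H"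
      and lim: "\<And>f. f \<in> H \<Longrightarrow> radial_deriv_limit l f (\<zeta> j) (ip f w)"
      by blast
    have "w = v j l" unfolding v_def
      by (rule boundary_functional_eq_kernel_deriv[OF J(4)[OF j] w lim ext[OF j]])
    thus ?thesis using w lim by blast
  qed
  have v_orth: "ip f (v j l) = 0" if j: "j \<in> J" and l: "l < m j" and f: "f \<in> mult_hardy2 (poly p)" for j l f
  proof -
    obtain h where h: "h \<in> hardy2" "f = (\<lambda>z. poly p z * h z)" using f by (auto simp: mult_hardy2_def)
    have lim: "\<And>f. f \<in> H \<Longrightarrow> radial_deriv_limit l f (\<zeta> j) (ip f (v j l))"
      using v[OF j l] by blast
    show ?thesis unfolding h(2) by (rule p_hardy2_orthogonal[OF J(4)[OF j] p_factor[OF j] l h(1) lim])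
  qed
  show "\<forall>j\<in>J. \<forall>l<m j. kernel_deriv b (\<zeta> j) l \<in> H" using v by (simp add: v_def)
  show "\<forall>j\<in>J. \<forall>l<m j. \<forall>f\<in>mult_hardy2 (poly p). ip f (kernel_deriv b (\<zeta> j) l) = 0"
    using v_orth by (simp add: v_def)
  define S where "S = {v j l | j l. j \<in> J \<and> l < m j}"
  have "S = (\<lambda>(j, l). v j l) ` (SIGMA j:J. {..<m j})" unfolding S_def by force
  hence S_fin: "finite S" using J(1) by simp
  have S_H: "S \<subseteq> H" using v by (auto simp: S_def)
  have pH: "mult_hardy2 (poly p) \<subseteq> H" using p_hardy2_in_H by (auto simp: mult_hardy2_def)
  have perp: "ip f g = 0" if f: "f \<in> mult_hardy2 (poly p)" and g: "g \<in> fspace.span S" for f g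
  proof -
    have fH: "f \<in> H" using f pH by blast
    have "fspace.span S \<subseteq> {x \<in> H. ip f x = 0}"
    proof (intro fspace.span_minimal fspace.subspaceI)
      show "S \<subseteq> {x \<in> H. ip f x = 0}" using S_H v_orth f by (auto simp: S_def)
    qed (use fH in \<open>auto simp: ip_add_right ip_scale_right intro!: add_in scale_in ip_zero_right\<close>)
    thus ?thesis using g by blast
  qed
  have "f \<in> {f + g | f g. f \<in> mult_hardy2 (poly p) \<and> g \<in> fspace.span S}" if f: "f \<in> H" for f
  proof -
    \<comment> \<open>Orthogonality of \<open>f - u\<close> to \<open>S\<close> means that all
      boundary derivatives in question vanish at \<open>f - u\<close>.\<close>
    obtain u where u: "u \<in> fspace.span S" "\<forall>s\<in>S. ip (f - u) s = 0"
      using orthogonal_projection_finite[OF S_fin S_H f] by blast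
    have fu: "f - u \<in> H" using f u span_in_H[OF S_H] by blast
    from toeplitz_representation[OF fu] obtain h where h: "h \<in> hardy2"
      and rep: "\<And>z. cmod z < 1 \<Longrightarrow> (f - u) z = (\<Sum>k\<le>N. cnj (coeff p k) * shift_coeff k h z)" by blast
    note dec = toeplitz_decomposition[OF h rep]
    have zero: "(deriv ^^ l) (laurent_part h) (\<zeta> j) = 0" if j: "j \<in> J" and l: "l < m j" for j l
    proof -
      have "radial_deriv_limit l (f - u) (\<zeta> j) ((deriv ^^ l) (laurent_part h) (\<zeta> j))"
        by (rule deriv_tendsto[OF h H_holo[OF fu] dec J(4)[OF j] p_factor[OF j] l])
      moreover have "radial_deriv_limit l (f - u) (\<zeta> j) (ip (f - u) (v j l))"
        using v[OF j l] fu by blast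
      moreover have "ip (f - u) (v j l) = 0" using u(2) j l by (auto simp: S_def)
      ultimately show ?thesis using tendsto_unique[OF trivial_limit_at_left_real] by metis
    qed
    have "remainder h = 0" by (rule remainder_eq_0[OF J(1-3)]) (use J(4) zero in auto)
    then obtain k where "k \<in> hardy2" "f - u = (\<lambda>z. poly p z * k z)"
      using in_p_hardy2_if_remainder_0[OF fu h dec] by blast
    hence "f - u \<in> mult_hardy2 (poly p)" by (auto simp: mult_hardy2_def)
    moreover have "f = (f - u) + u" by (simp add: fun_eq_iff)
    ultimately show ?thesis using u(1) by blast
  qed
  moreover have "f + g \<in> H" if "f \<in> mult_hardy2 (poly p)" "g \<in> fspace.span S" for f g
    using that pH span_in_H[OF S_H] by (intro add_in) auto
  ultimately have "H = {f + g | f g. f \<in> mult_hardy2 (poly p) \<and> g \<in> fspace.span S}" by blast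
  thus "orthogonal_sum H ip (mult_hardy2 (poly p))
      (module.span fun_scale {kernel_deriv b (\<zeta> j) l | j l. j \<in> J \<and> l < m j})"
    unfolding orthogonal_sum_def v_def[symmetric] S_def[symmetric]
    using pH span_in_H[OF S_H] perp by blast
qed

end

subsection \<open>Pythagorean mates\<close>

text \<open>For continuous functions radial limits are boundary values, and an identity between them
  that holds almost everywhere holds everywhere.\<close>

lemma circle_identity:
  assumes a: "a \<in> disk_algebra" and q: "q \<in> disk_algebra"
    and AE: "AE \<zeta> in circle_measure. \<exists>\<alpha> \<beta>. has_radial_limit a \<zeta> \<alpha> \<and> has_radial_limit q \<zeta> \<beta> \<and>
      (cmod \<alpha>)\<^sup>2 + (cmod \<beta>)\<^sup>2 = 1"
    and z: "cmod z = 1"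
  shows "(cmod (a z))\<^sup>2 + (cmod (q z))\<^sup>2 = 1"
proof -
  have radial: "l = F w" if F: "F \<in> disk_algebra" and w: "cmod w = 1" and l: "has_radial_limit F w l" for F w l
  proof -
    have "continuous_on (cball 0 1) F" using F by (simp add: disk_algebra_def)
    hence lim: "(F \<longlongrightarrow> F w) (at w within cball 0 1)" using w by (simp add: continuous_on_def)
    have "filterlim (\<lambda>\<rho>. of_real \<rho> * w) (at w within cball 0 1) (at_left (1 :: real))"
      unfolding filterlim_at
    proof
      show "((\<lambda>\<rho>. of_real \<rho> * w) \<longlongrightarrow> w) (at_left (1 :: real))"
        using radial_tendsto[where F = "\<lambda>x. x" and ?z0.0 = w] by simp
      show "eventually (\<lambda>\<rho>. of_real \<rho> * w \<in> cball 0 1 \<and> of_real \<rho> * w \<noteq> w) (at_left (1 :: real))"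
        using eventually_between_at_left[OF zero_less_one]
      proof eventually_elim
        case (elim \<rho>)
        have n: "cmod (of_real \<rho> * w) = \<rho>" using elim w by (simp add: norm_mult)
        hence "of_real \<rho> * w \<noteq> w" using elim w by (metis less_irrefl)
        thus ?case using n elim by simp
      qed
    qed
    from filterlim_compose[OF lim this]
    have "((\<lambda>\<rho>. F (of_real \<rho> * w)) \<longlongrightarrow> F w) (at_left (1 :: real))" .
    thus ?thesis using l unfolding has_radial_limit_def
      using tendsto_unique[OF trivial_limit_at_left_real] by blast
  qed
  define C where "C = {t. (cmod (a (cis t)))\<^sup>2 + (cmod (q (cis t)))\<^sup>2 = 1}"
  have "cis \<in> measurable (uniform_measure lborel {0..2 * pi}) borel"
  proof -
    have "cis \<in> borel_measurable borel" by (intro borel_measurable_continuous_onI continuous_intros)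
    thus ?thesis by simp
  qed
  from AE_distrD[OF this AE[unfolded circle_measure_def]]
  have "AE t in uniform_measure lborel {0..2 * pi}. \<exists>\<alpha> \<beta>. has_radial_limit a (cis t) \<alpha> \<and>
      has_radial_limit q (cis t) \<beta> \<and> (cmod \<alpha>)\<^sup>2 + (cmod \<beta>)\<^sup>2 = 1" .
  hence "AE t in uniform_measure lborel {0..2 * pi}. t \<in> C"
    by (rule eventually_mono) (use radial[OF a] radial[OF q] in \<open>auto simp: C_def\<close>)
  hence "AE t in lborel. t \<in> {0..2 * pi} \<longrightarrow> t \<in> C"
    by (subst (asm) AE_uniform_measure) auto
  hence "AE t in lebesgue. t \<in> {0..2 * pi} \<longrightarrow> t \<in> C" by (rule AE_completion)
  hence AE': "AE t \<in> {0<..<2 * pi} in lebesgue. t \<in> C" by (rule eventually_mono) auto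
  have "continuous_on UNIV (\<lambda>t. (cmod (a (cis t)))\<^sup>2 + (cmod (q (cis t)))\<^sup>2)"
    by (intro continuous_intros continuous_on_compose2[OF disk_algebra_continuous[OF a]]
        continuous_on_compose2[OF disk_algebra_continuous[OF q]]) auto
  hence C: "closed C" unfolding C_def by (intro closed_Collect_eq) (auto intro: continuous_intros)
  \<comment> \<open>A closed set containing almost all of an open set contains all of it.\<close>
  have "{0<..<2 * pi} \<subseteq> C"
    using mem_closed_if_AE_lebesgue_open[OF open_greaterThanLessThan C AE'] by blast
  hence "closure {0<..<2 * pi} \<subseteq> C" using C by (rule closure_minimal)
  hence C_all: "{0..2 * pi} \<subseteq> C" by simp
  have "cis (Arg2pi z) = z"
    using z Arg2pi_eq[of z] by (simp add: cis_conv_exp mult.commute)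
  moreover have "Arg2pi z \<in> C" using C_all Arg2pi_ge_0[of z] Arg2pi_lt_2pi[of z] by (auto simp: less_imp_le)
  ultimately show ?thesis by (simp add: C_def)
qed

lemma rational_disk_algebra:
  assumes "\<And>z. cmod z \<le> 1 \<Longrightarrow> poly v z \<noteq> 0"
  shows "(\<lambda>z. poly u z / poly v z) \<in> disk_algebra"
  unfolding disk_algebra_def using assms by (auto intro!: continuous_intros holomorphic_intros)

text \<open>Turns the multiplicities of the statement into orders of roots of the numerator.\<close>

lemma order_eq_zorder_quotient:
  assumes u: "u \<noteq> 0" and v: "poly v z0 \<noteq> 0"
  shows "zorder (\<lambda>z. poly u z / poly v z) z0 = int (order z0 u)"
proof -
  obtain w where w: "u = [:- z0, 1:] ^ order z0 u * w" "\<not> [:- z0, 1:] dvd w"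
    using order_decomp[OF u] by blast
  have w0: "poly w z0 \<noteq> 0" using w(2) by (simp add: poly_eq_0_iff_dvd)
  have S: "open {z. poly v z \<noteq> 0}" by (intro open_Collect_neq continuous_intros)
  show ?thesis
  proof (rule zorder_eqI[OF S, where g = "\<lambda>z. poly w z / poly v z"])
    show "(\<lambda>z. poly w z / poly v z) holomorphic_on {z. poly v z \<noteq> 0}" by (intro holomorphic_intros) auto
    show "poly u x / poly v x = poly w x / poly v x * (x - z0) powi int (order z0 u)" for x
      by (subst w(1)) (simp add: poly_power)
  qed (use v w0 in auto)
qed

lemma mult_hardy2_subset:
  assumes "e holomorphic_on unit_disk" "\<And>z. z \<in> unit_disk \<Longrightarrow> cmod (e z) \<le> B"
    and "\<And>z. z \<in> unit_disk \<Longrightarrow> f z = g z * e z"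
  shows "mult_hardy2 f \<subseteq> mult_hardy2 g"
proof
  fix y assume "y \<in> mult_hardy2 f"
  then obtain h where h: "h \<in> hardy2" "y = (\<lambda>z. f z * h z)" by (auto simp: mult_hardy2_def)
  have "y = (\<lambda>z. g z * (e z * h z))"
  proof
    fix z show "y z = g z * (e z * h z)"
      using h(2) hardy2_off[OF h(1), of z] assms(3)[of z] by (cases "z \<in> unit_disk") auto
  qed
  thus "y \<in> mult_hardy2 g"
    using hardy2_mult_bounded[OF h(1) assms(1,2)] by (auto simp: mult_hardy2_def)
qed

lemma prod_linear_self_inversive:
  fixes \<zeta> :: "nat \<Rightarrow> complex"
  assumes z: "cmod z = 1"
  shows "z ^ degree (\<Prod>j\<in>J. [:- \<zeta> j, 1:] ^ m j) * cnj (poly (\<Prod>j\<in>J. [:- \<zeta> j, 1:] ^ m j) z) =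
    (\<Prod>j\<in>J. (z * cnj (z - \<zeta> j)) ^ m j)"
proof -
  have "degree (\<Prod>j\<in>J. [:- \<zeta> j, 1:] ^ m j) = (\<Sum>j\<in>J. m j)"
    by (subst degree_prod_sum_eq) (simp_all add: degree_linear_power)
  thus ?thesis by (simp add: poly_prod poly_power power_sum power_mult_distrib prod.distrib)
qed

context rational_power
begin

text \<open>The mate factors as \<open>p * e\<close> with \<open>e\<close> and its inverse in the
  disk algebra. Hence \<open>a\<close> and \<open>p\<close> generate the same multiples of H^2, and
  |a|^2 = 1 - |q|^2 is comparable to |p|^2 on the circle, which gives the hypotheses of
  \<open>mate_space\<close>.\<close>

lemma mate_decomposition:
  fixes n :: nat
  assumes HQ: "rkhs unit_disk (dBR_kernel Q) HQ ipQ"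
    and mate: "pythagorean_mate q a" and rat: "rational_fun a"
    and \<zeta>: "inj_on \<zeta> {1..n}" "\<zeta> ` {1..n} = {z \<in> unit_circle. a z = 0}"
    and ord: "\<forall>j\<in>{1..n}. zorder a (\<zeta> j) = int (m j)"
  shows "(\<forall>j\<in>{1..n}. \<exists>g. analytic_extension_at Q (\<zeta> j) g) \<and>
    (\<forall>j\<in>{1..n}. \<forall>l<m j. kernel_deriv Q (\<zeta> j) l \<in> HQ) \<and>
    mult_hardy2 a = mult_hardy2 (\<lambda>z. \<Prod>j=1..n. (z - \<zeta> j) ^ m j) \<and>
    (\<forall>j\<in>{1..n}. \<forall>l<m j. \<forall>f \<in> mult_hardy2 a. ipQ f (kernel_deriv Q (\<zeta> j) l) = 0) \<and>
    orthogonal_sum HQ ipQ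
      (mult_hardy2 (\<lambda>z. \<Prod>j=1..n. (z - \<zeta> j) ^ m j))
      (module.span fun_scale {kernel_deriv Q (\<zeta> j) l | j l. j \<in> {1..n} \<and> l < m j})"
proof -
  define J where "J = {1..n}"
  have J_fin: "finite J" by (simp add: J_def)
  obtain ua va :: "complex poly" where va: "va \<noteq> 0" "coprime ua va" and a_eq: "a = (\<lambda>z. poly ua z / poly va z)"
    using rat unfolding rational_fun_def by blast
  have a_ball: "(\<lambda>z. poly ua z / poly va z) \<in> ball_Hinf" using mate by (simp add: pythagorean_mate_def a_eq)
  have va_nz: "poly va z \<noteq> 0" if "cmod z \<le> 1" for z
    by (rule ball_Hinf_no_poles[OF a_ball va(2,1) that])
  have a_alg: "a \<in> disk_algebra" unfolding a_eq by (rule rational_disk_algebra) (rule va_nz)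
  have identity: "(cmod (a z))\<^sup>2 + (cmod (q z))\<^sup>2 = 1" if "cmod z = 1" for z
    by (rule circle_identity[OF a_alg q_alg _ that]) (use mate in \<open>simp add: pythagorean_mate_def\<close>)
  have "outer a" using mate by (simp add: pythagorean_mate_def)
  hence a_disk: "a z \<noteq> 0" if "z \<in> unit_disk" for z using that unfolding outer_def by fastforce
  have \<zeta>_circle: "cmod (\<zeta> j) = 1" and \<zeta>_zero: "a (\<zeta> j) = 0" if "j \<in> J" for j
    using that \<zeta>(2) unfolding J_def by auto
  have ua: "ua \<noteq> 0" using a_disk[of 0] by (auto simp: a_eq)
  have order_ua: "order (\<zeta> j) ua = m j" if "j \<in> J" for j
    using order_eq_zorder_quotient[OF ua va_nz[of "\<zeta> j"]] ord \<zeta>_circle[OF that] that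
    unfolding a_eq J_def by simp
  define p where "p = (\<Prod>j\<in>J. [:- \<zeta> j, 1:] ^ m j)"
  have p_poly: "poly p z = (\<Prod>j\<in>J. (z - \<zeta> j) ^ m j)" for z
    by (simp add: p_def poly_prod poly_power)
  have p_fun: "(\<lambda>z. \<Prod>j\<in>J. (z - \<zeta> j) ^ m j) = poly p" by (simp add: p_poly fun_eq_iff)
  have "p dvd ua" unfolding p_def
    by (rule prod_linear_powers_dvd[OF J_fin \<zeta>(1)[folded J_def]]) (simp add: order_divides order_ua)
  then obtain u1 where u1: "ua = p * u1" by (elim dvdE)
  have p_nz: "poly p z \<noteq> 0" if "z \<in> unit_disk" for z
    using a_disk[OF that] by (auto simp: a_eq u1)
  \<comment> \<open>A zero of \<open>u1\<close> would be a zero of \<open>a\<close>, hence one of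
    the points \<open>\<zeta> j\<close>, and would raise its multiplicity above
    \<open>m j\<close>.\<close>
  have u1_nz: "poly u1 z \<noteq> 0" if z: "cmod z \<le> 1" for z
  proof
    assume u1z: "poly u1 z = 0"
    hence az: "a z = 0" by (simp add: a_eq u1)
    hence "cmod z = 1" using a_disk[of z] z by force
    hence "z \<in> \<zeta> ` {1..n}" unfolding \<zeta>(2) using az by simp
    then obtain j where j: "j \<in> J" "z = \<zeta> j" unfolding J_def by auto
    have "[:- \<zeta> j, 1:] ^ m j dvd p" unfolding p_def using J_fin j by (intro dvd_prodI)
    moreover have "[:- \<zeta> j, 1:] dvd u1" using u1z j by (simp add: poly_eq_0_iff_dvd)
    ultimately have "[:- \<zeta> j, 1:] ^ m j * [:- \<zeta> j, 1:] dvd ua" unfolding u1 by (rule mult_dvd_mono)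
    hence "[:- \<zeta> j, 1:] ^ Suc (m j) dvd ua" by (simp only: power_Suc2)
    hence "Suc (m j) \<le> order (\<zeta> j) ua" using ua by (simp only: order_divides simp_thms)
    thus False using order_ua[OF j(1)] by simp
  qed
  define e where "e z = poly u1 z / poly va z" for z
  have a_e: "a z = poly p z * e z" for z by (simp add: a_eq u1 e_def)
  have e_alg: "e \<in> disk_algebra" unfolding e_def[abs_def] by (rule rational_disk_algebra) (rule va_nz)
  have e'_alg: "(\<lambda>z. poly va z / poly u1 z) \<in> disk_algebra" by (rule rational_disk_algebra) (rule u1_nz)
  obtain B where B: "B > 0" "\<And>z. cmod z \<le> 1 \<Longrightarrow> cmod (e z) \<le> B" using disk_algebra_bounded[OF e_alg] by blast
  obtain B' where B': "B' > 0" "\<And>z. cmod z \<le> 1 \<Longrightarrow> cmod (poly va z / poly u1 z) \<le> B'"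
    using disk_algebra_bounded[OF e'_alg] by blast
  have p_e: "poly p z = a z * (poly va z / poly u1 z)" if "cmod z \<le> 1" for z
    using va_nz[OF that] u1_nz[OF that] by (simp add: a_e e_def)
  have mult_eq: "mult_hardy2 a = mult_hardy2 (poly p)"
  proof
    show "mult_hardy2 a \<subseteq> mult_hardy2 (poly p)"
      by (rule mult_hardy2_subset[of e B]) (use e_alg B a_e in \<open>auto simp: disk_algebra_def\<close>)
    show "mult_hardy2 (poly p) \<subseteq> mult_hardy2 a"
    proof (rule mult_hardy2_subset[of "\<lambda>z. poly va z / poly u1 z" B'])
      show "(\<lambda>z. poly va z / poly u1 z) holomorphic_on unit_disk" using e'_alg by (simp add: disk_algebra_def)
      show "cmod (poly va z / poly u1 z) \<le> B'" if "z \<in> unit_disk" for z using B'(2)[of z] that by simp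
      show "poly p z = a z * (poly va z / poly u1 z)" if "z \<in> unit_disk" for z using p_e[of z] that by simp
    qed
  qed
  \<comment> \<open>By \<open>identity\<close>, |q| = 1 wherever \<open>a\<close> vanishes on the
    circle.\<close>
  have q_nonzero: "q z \<noteq> 0" if "cmod z = 1" "a z = 0" for z
    using identity[OF that(1)] that(2) by auto
  obtain Q' where Q': "Q' \<in> disk_algebra" "\<forall>z\<in>unit_disk. Q' z = Q z"
    "\<forall>z. cmod z = 1 \<longrightarrow> min 1 r * (1 - (cmod (q z))\<^sup>2) \<le> 1 - (cmod (Q' z))\<^sup>2 \<and>
      1 - (cmod (Q' z))\<^sup>2 \<le> max 1 r * (1 - (cmod (q z))\<^sup>2)"
    "\<forall>p. (\<forall>z. cmod z = 1 \<longrightarrow> poly p z = 0 \<longrightarrow> q z \<noteq> 0) \<longrightarrow> analytic_at_circle_zeros Q' p"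
    using Q_boundary by blast
  have Q'_an: "analytic_at_circle_zeros Q' p" using Q'(4) q_nonzero by (simp add: a_e)
  have Q'_bounds: "min 1 r * (cmod (a z))\<^sup>2 \<le> 1 - (cmod (Q' z))\<^sup>2"
    "1 - (cmod (Q' z))\<^sup>2 \<le> max 1 r * (cmod (a z))\<^sup>2" if z: "cmod z = 1" for z
  proof -
    have "(cmod (a z))\<^sup>2 = 1 - (cmod (q z))\<^sup>2" using identity[OF z] by simp
    thus "min 1 r * (cmod (a z))\<^sup>2 \<le> 1 - (cmod (Q' z))\<^sup>2"
      "1 - (cmod (Q' z))\<^sup>2 \<le> max 1 r * (cmod (a z))\<^sup>2" using Q'(3) z by simp_all
  qed
  define w where "w z = (cmod (poly p z))\<^sup>2" for z
  have w_cont: "continuous_on unit_circle w" unfolding w_def by (intro continuous_intros)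
  have w_nn: "0 \<le> w z" for z by (simp add: w_def)
  have upper: "1 - (cmod (Q' z))\<^sup>2 \<le> max 1 r * B\<^sup>2 * w z" if z: "cmod z = 1" for z
  proof -
    have "(cmod (a z))\<^sup>2 \<le> B\<^sup>2 * w z"
      unfolding a_e w_def norm_mult power_mult_distrib mult.commute[of "B\<^sup>2"]
      using B(2)[of z] z by (intro mult_left_mono power_mono) auto
    hence "max 1 r * (cmod (a z))\<^sup>2 \<le> max 1 r * (B\<^sup>2 * w z)" by (intro mult_left_mono) auto
    thus ?thesis using Q'_bounds(2)[OF z] by (simp add: mult.assoc)
  qed
  \<comment> \<open>\<open>min 1 r\<close> passes from 1 - |Q'|^2 to |a|^2, and \<open>B'\<close>
    bounds the inverse of \<open>e\<close>, which passes from |a|^2 to |p|^2.\<close>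
  define c1 where "c1 = min 1 r / B'\<^sup>2"
  have c1: "c1 > 0" using r_pos B' by (simp add: c1_def)
  have lower: "c1 * w z \<le> 1 - (cmod (Q' z))\<^sup>2" if z: "cmod z = 1" for z
  proof -
    have "w z \<le> (cmod (a z))\<^sup>2 * B'\<^sup>2"
      unfolding w_def p_e[of z, OF eq_refl[OF z]] norm_mult[of "a z"] power_mult_distrib
      using B'(2)[of z] z by (intro mult_left_mono power_mono) auto
    hence "w z / B'\<^sup>2 \<le> (cmod (a z))\<^sup>2" using B' by (simp add: field_simps)
    hence "min 1 r * (w z / B'\<^sup>2) \<le> min 1 r * (cmod (a z))\<^sup>2" using r_pos by (intro mult_left_mono) auto
    thus ?thesis using Q'_bounds(1)[OF z] by (simp add: c1_def)
  qed
  have p0: "p \<noteq> 0" using p_nz[of 0] by auto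
  obtain C2 where C2: "C2 \<ge> 0" "\<forall>xs. snd ` set xs \<subseteq> unit_disk \<longrightarrow>
      dBR_sqnorm ipQ Q xs \<le>
      C2 * circ_mean (\<lambda>z. w z * (cmod (szego_comb xs z))\<^sup>2)"
    using dBR_form_upper_weight[OF HQ Q'(1,2) p0 Q'_an w_cont w_nn upper, of 1] by (auto simp: w_def)
  \<comment> \<open>For z and \<open>\<zeta> j\<close> on the circle, z * cnj (z -
    \<open>\<zeta> j\<close>) = - cnj \<open>\<zeta> j\<close> * (z - \<open>\<zeta> j\<close>);
    each linear factor contributes one such constant.\<close>
  define c0 where "c0 = (\<Prod>j\<in>J. (- cnj (\<zeta> j)) ^ m j)"
  have "mate_space Q HQ ipQ p c0 c1 C2"
  proof (intro mate_space.intro mate_space_axioms.intro HQ)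
    show "poly p z \<noteq> 0" if "z \<in> unit_disk" for z by (rule p_nz[OF that])
    show "z ^ degree p * cnj (poly p z) = c0 * poly p z" if z: "cmod z = 1" for z
    proof -
      have "z * cnj (z - \<zeta> j) = - cnj (\<zeta> j) * (z - \<zeta> j)" if j: "j \<in> J" for j
      proof -
        have "z * cnj z = 1" "\<zeta> j * cnj (\<zeta> j) = 1"
          using z \<zeta>_circle[OF j] complex_norm_square[of z] complex_norm_square[of "\<zeta> j"] by simp_all
        thus ?thesis by (simp add: algebra_simps)
      qed
      hence "(\<Prod>j\<in>J. (z * cnj (z - \<zeta> j)) ^ m j) = (\<Prod>j\<in>J. (- cnj (\<zeta> j) * (z - \<zeta> j)) ^ m j)"
        by (intro prod.cong refl) (simp only:)
      also have "\<dots> = c0 * poly p z"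
        by (simp only: power_mult_distrib prod.distrib c0_def p_poly)
      finally show ?thesis unfolding p_def prod_linear_self_inversive[OF z] .
    qed
    show "c0 \<noteq> 0" unfolding c0_def using J_fin \<zeta>_circle by (force simp: prod_zero_iff)
    show "c1 > 0" "C2 \<ge> 0" by (fact c1, fact C2(1))
    fix xs :: "(complex \<times> complex) list" assume xs: "snd ` set xs \<subseteq> unit_disk"
    note cont = w_cont[unfolded w_def] disk_algebra_continuous[OF Q'(1)]
      disk_algebra_continuous[OF szego_comb_disk_algebra[OF xs]]
    show "dBR_sqnorm ipQ Q xs \<le>
      C2 * circ_mean (\<lambda>z. (cmod (poly p z))\<^sup>2 * (cmod (szego_comb xs z))\<^sup>2)"
      using C2(2) xs by (simp add: w_def)
    have "c1 * circ_mean (\<lambda>z. (cmod (poly p z))\<^sup>2 * (cmod (szego_comb xs z))\<^sup>2) =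
        circ_mean (\<lambda>z. (c1 * (cmod (poly p z))\<^sup>2) * (cmod (szego_comb xs z))\<^sup>2)"
      by (simp add: circ_mean_mult_left[symmetric] mult_ac)
    also have "\<dots> \<le> circ_mean (\<lambda>z. (1 - (cmod (Q' z))\<^sup>2) * (cmod (szego_comb xs z))\<^sup>2)"
    proof (rule circ_mean_mono)
      show "c1 * (cmod (poly p z))\<^sup>2 * (cmod (szego_comb xs z))\<^sup>2 \<le> (1 - (cmod (Q' z))\<^sup>2) * (cmod (szego_comb xs z))\<^sup>2"
        if "cmod z = 1" for z using lower[OF that] by (intro mult_right_mono) (simp_all add: w_def)
    qed (intro continuous_intros cont)+
    also note dBR_form_lower[OF HQ Q'(1,2) xs]
    finally show "c1 * circ_mean (\<lambda>z. (cmod (poly p z))\<^sup>2 * (cmod (szego_comb xs z))\<^sup>2) \<le>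
      dBR_sqnorm ipQ Q xs" .
  qed
  then interpret M: mate_space Q HQ ipQ p c0 c1 C2 .
  have ext: "\<exists>g. analytic_extension_at Q (\<zeta> j) g" if j: "j \<in> J" for j
  proof -
    from Q_extends[OF \<zeta>_circle[OF j] q_nonzero[OF \<zeta>_circle[OF j] \<zeta>_zero[OF j]]]
    show ?thesis unfolding analytic_extension_at_def by metis
  qed
  note decomposition = M.decomposition[OF J_fin \<zeta>(1)[folded J_def] p_def]
  have "\<forall>j\<in>J. \<forall>l<m j. kernel_deriv Q (\<zeta> j) l \<in> HQ"
    by (rule decomposition(1)) (use \<zeta>_circle ext in auto)
  moreover have "\<forall>j\<in>J. \<forall>l<m j. \<forall>f\<in>mult_hardy2 (poly p). ipQ f (kernel_deriv Q (\<zeta> j) l) = 0"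
    by (rule decomposition(2)) (use \<zeta>_circle ext in auto)
  moreover have "orthogonal_sum HQ ipQ (mult_hardy2 (poly p))
      (module.span fun_scale {kernel_deriv Q (\<zeta> j) l | j l. j \<in> J \<and> l < m j})"
    by (rule decomposition(3)) (use \<zeta>_circle ext in auto)
  ultimately show ?thesis unfolding J_def[symmetric] p_fun mult_eq using ext by blast
qed

end

theorem theorem1p5:
  fixes q Q :: "complex \<Rightarrow> complex" and r :: real
    and Hq HQ :: "(complex \<Rightarrow> complex) set"
    and ipq ipQ :: "(complex \<Rightarrow> complex) \<Rightarrow> (complex \<Rightarrow> complex) \<Rightarrow> complex"
  assumes "q \<in> ball_Hinf" and "rational_fun q" and "outer q"
    and "r > 0" and "analytic_power q r Q"
    and "de_Branges_Rovnyak q Hq ipq" and "de_Branges_Rovnyak Q HQ ipQ"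
  shows "HQ = Hq \<and>
    (\<forall>(a :: complex \<Rightarrow> complex) (n :: nat) (\<zeta> :: nat \<Rightarrow> complex) (m :: nat \<Rightarrow> nat).
       pythagorean_mate q a \<and> rational_fun a \<and>
       inj_on \<zeta> {1..n} \<and> \<zeta> ` {1..n} = {z \<in> unit_circle. a z = 0} \<and>
       (\<forall>j\<in>{1..n}. zorder a (\<zeta> j) = int (m j)) \<longrightarrow>
       (\<forall>j\<in>{1..n}. \<exists>g. analytic_extension_at Q (\<zeta> j) g) \<and>
       (\<forall>j\<in>{1..n}. \<forall>l<m j. kernel_deriv Q (\<zeta> j) l \<in> HQ) \<and>
       mult_hardy2 a = mult_hardy2 (\<lambda>z. \<Prod>j=1..n. (z - \<zeta> j) ^ m j) \<and>
       (\<forall>j\<in>{1..n}. \<forall>l<m j. \<forall>f \<in> mult_hardy2 a. ipQ f (kernel_deriv Q (\<zeta> j) l) = 0) \<and>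
       orthogonal_sum HQ ipQ
         (mult_hardy2 (\<lambda>z. \<Prod>j=1..n. (z - \<zeta> j) ^ m j))
         (module.span fun_scale {kernel_deriv Q (\<zeta> j) l | j l. j \<in> {1..n} \<and> l < m j}))"
proof -
  obtain u v :: "complex poly" where v: "v \<noteq> 0" "coprime u v" and q_eq: "q = (\<lambda>z. poly u z / poly v z)"
    using assms(2) unfolding rational_fun_def by blast
  obtain L where L: "L holomorphic_on unit_disk" "\<And>z. z \<in> unit_disk \<Longrightarrow> exp (L z) = q z"
    "\<And>z. z \<in> unit_disk \<Longrightarrow> Q z = exp (of_real r * L z)"
    using assms(5) unfolding analytic_power_def by blast
  interpret rational_power q Q L r u v
    by unfold_locales
       (use assms(1,4) L q_eq ball_Hinf_no_poles[OF assms(1)[unfolded q_eq] v(2,1)] in auto)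
  have Hq: "rkhs unit_disk (dBR_kernel q) Hq ipq" and HQ: "rkhs unit_disk (dBR_kernel Q) HQ ipQ"
    using assms(6,7) by (simp_all add: de_Branges_Rovnyak_def)
  show ?thesis
    by (intro conjI[OF spaces_equal[OF Hq HQ]] allI impI, elim conjE) (rule mate_decomposition[OF HQ])
qed

end
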